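(* Let $F=\mathbb F_q(\mathcal X)$ be the function field of the Kummer curve $\mathcal X$ described in the context, with the places $Q_0,Q_1,\dots,Q_n$ and $R_1,\dots,R_N$ described there. Let $D=\sum_{k=1}^NR_k$ and let $E=\sum_{k=0}^n\alpha_kQ_k$ (with $\alpha_k\in\mathbb Z$) be a non-special divisor of degree $g-1$. For an integer $s$ with $\frac{g-1}{\lambda_0}<s<\frac{N+1-g}{\lambda_0}$, consider the divisors $$G=\sum_{k=1}^n\alpha_kQ_k+(\alpha_0+N-s\lambda_0)Q_0$$ and $$H=\sum_{k=1}^n(s\lambda_k+\alpha_k)Q_k+\alpha_0Q_0+\sum_{k=n+1}^{r}\frac{s\lambda_k}{\gcd(m,\lambda_k)}\sum_{Q\mid P_{a_k}}Q,$$ where the inner sum runs over all places $Q$ of $F$ lying over the place $P_{a_k}$ of $\mathbb F_q(x)$ corresponding to $a_k$. Then $(C_{\mathcal L}(D,G),C_{\mathcal L}(D,H))$ is a linear complementary pair of algebraic geometry codes with parameters (length and dimension) $$[N,\,N-s\lambda_0]\quad\text{and}\quad[N,\,s\lambda_0],$$ respectively.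
   Context: Let $\mathbb F_q$ be the finite field with $q$ elements, $m,r\ge2$ integers with $\operatorname{char}(\mathbb F_q)\nmid m$, $a_1,\dots,a_r\in\mathbb F_q$ pairwise distinct, and $1\le\lambda_k\le m-1$ for $1\le k\le r$, such that $\lambda_0:=\sum_{k=1}^r\lambda_k$ is coprime to $m$. Let $\mathcal X$ be the curve over $\mathbb F_q$ defined by $y^m=f(x)=\prod_{k=1}^r(x-a_k)^{\lambda_k}$, with function field $F=\mathbb F_q(\mathcal X)=\mathbb F_q(x,y)$ of genus $g\ge1$. Let $Q_0$ be the only place at infinity of $F$. For some $2\le n\le r$, assume the places of $\mathbb F_q(x)$ corresponding to $a_1,\dots,a_n$ are totally ramified in $F/\mathbb F_q(x)$, and let $Q_1,\dots,Q_n$ be the places of $F$ over them, respectively. Let $P_1,\dots,P_t$ be pairwise distinct rational places of $\mathbb F_q(x)$ that split completely in $F/\mathbb F_q(x)$, and let $R_1,\dots,R_N$ be all the $N=mt$ rational places of $F$ lying over $P_1,\dots,P_t$. A divisor $A$ of $F$ is non-special if $\ell(A)=\deg(A)+1-g$, where $\ell(A)=\dim_{\mathbb F_q}\mathcal L(A)$. If $D$ is a sum of $M$ distinct rational places $S_1,\dots,S_M$ and $A$ is a divisor with support disjoint from that of $D$, then $C_{\mathcal L}(D,A)=\{(z(S_1),\dots,z(S_M)):z\in\mathcal L(A)\}\subseteq\mathbb F_q^M$. A pair $(\mathcal C_1,\mathcal C_2)$ of linear codes in $\mathbb F_q^M$ is a linear complementary pair (LCP) if $\mathcal C_1\oplus\mathcal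 C_2=\mathbb F_q^M$. An $[M,k]$ code is a linear code of length $M$ and dimension $k$. *)

theory Defs
  imports
    "HOL-Analysis.Analysis"
    "HOL-Library.Poly_Mapping"
    "HOL-Computational_Algebra.Polynomial"
    "HOL-Computational_Algebra.Fraction_Field"
begin

section \<open>Field extensions\<close>

text \<open>
  An extension of fields is an injective homomorphism between two types of class field. A field
  homomorphism is automatically injective, and it maps 0 to 0.
\<close>

definition field_embedding :: "('a::field \<Rightarrow> 'b::field) \<Rightarrow> bool" where
  "field_embedding h \<longleftrightarrow>
     h 1 = 1 \<and> (\<forall>u v. h (u + v) = h u + h v) \<and> (\<forall>u v. h (u * v) = h u * h v)"

definition dim_via :: "('a::field \<Rightarrow> 'b::field) \<Rightarrow> 'b set \<Rightarrow> nat" where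
  "dim_via h V = vector_space.dim (\<lambda>c z. h c * z) V"

definition extension_degree :: "('a::field \<Rightarrow> 'b::field) \<Rightarrow> nat" where
  "extension_degree h = dim_via h UNIV"

definition is_subring :: "'a::field set \<Rightarrow> bool" where
  "is_subring S \<longleftrightarrow> 0 \<in> S \<and> 1 \<in> S \<and>
     (\<forall>u\<in>S. \<forall>v\<in>S. u + v \<in> S \<and> u - v \<in> S \<and> u * v \<in> S)"

definition is_subfield :: "'a::field set \<Rightarrow> bool" where
  "is_subfield S \<longleftrightarrow> is_subring S \<and> (\<forall>u\<in>S. inverse u \<in> S)"

definition generated_field :: "'a::field set \<Rightarrow> 'a set" where
  "generated_field S = \<Inter>{L. is_subfield L \<and> S \<subseteq> L}"


section \<open>Places of a field over a constant field\<close>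

text \<open>
  The constant field is a type \<^typ>\<open>'k\<close>, mapped into the function field by \<open>\<iota>\<close>. Places are
  represented, as in Stichtenoth's book, by the maximal ideals of the valuation rings.
\<close>

definition valuation_ring :: "('k::field \<Rightarrow> 'f::field) \<Rightarrow> 'f set \<Rightarrow> bool" where
  "valuation_ring \<iota> V \<longleftrightarrow>
     is_subring V \<and> range \<iota> \<subset> V \<and> V \<subset> UNIV \<and> (\<forall>z. z \<in> V \<or> inverse z \<in> V)"

definition unit_group :: "'f::field set \<Rightarrow> 'f set" where
  "unit_group V = {u \<in> V. \<exists>w\<in>V. u * w = 1}"

definition places :: "('k::field \<Rightarrow> 'f::field) \<Rightarrow> 'f set set" where
  "places \<iota> = {V - unit_group V | V. valuation_ring \<iota> V}"

text \<open>
  A place determines its valuation ring. The element 0 is listed separately because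
  \<open>inverse 0 = 0\<close> lies in the place.
\<close>

definition place_ring :: "'f::field set \<Rightarrow> 'f set" where
  "place_ring P = {z. z = 0 \<or> inverse z \<notin> P}"

definition prime_element :: "'f::field set \<Rightarrow> 'f \<Rightarrow> bool" where
  "prime_element P t \<longleftrightarrow> P = {t * z | z. z \<in> place_ring P}"

text \<open>
  The normalized discrete valuation of a place. It is meaningful for nonzero arguments only: the
  value \<open>\<infinity>\<close> at 0 is not represented, and every use below treats 0 separately.
\<close>

definition place_val :: "'f::field set \<Rightarrow> 'f \<Rightarrow> int" where
  "place_val P z =
     (THE k. \<exists>t u. prime_element P t \<and> u \<in> unit_group (place_ring P) \<and> z = t powi k * u)"

text \<open>
  The degree of a place is the dimension of its residue class field over the constant field: the
  classes of the elements of \<open>B\<close> are a basis of the quotient of \<open>place_ring P\<close> by \<open>P\<close>.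
\<close>

definition residue_basis :: "('k::field \<Rightarrow> 'f::field) \<Rightarrow> 'f set \<Rightarrow> 'f set \<Rightarrow> bool" where
  "residue_basis \<iota> P B \<longleftrightarrow> finite B \<and> B \<subseteq> place_ring P \<and>
     (\<forall>z\<in>place_ring P. \<exists>!c. (\<forall>b. b \<notin> B \<longrightarrow> c b = 0) \<and> z - (\<Sum>b\<in>B. \<iota> (c b) * b) \<in> P)"

definition place_degree :: "('k::field \<Rightarrow> 'f::field) \<Rightarrow> 'f set \<Rightarrow> nat" where
  "place_degree \<iota> P = (THE d. \<exists>B. residue_basis \<iota> P B \<and> card B = d)"

definition rational_place :: "('k::field \<Rightarrow> 'f::field) \<Rightarrow> 'f set \<Rightarrow> bool" where
  "rational_place \<iota> P \<longleftrightarrow> P \<in> places \<iota> \<and> place_degree \<iota> P = 1"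

text \<open>
  The value of \<open>z\<close> at a rational place at which \<open>z\<close> has no pole; the residue class field is
  identified with the constant field.
\<close>

definition place_eval :: "('k::field \<Rightarrow> 'f::field) \<Rightarrow> 'f set \<Rightarrow> 'f \<Rightarrow> 'k" where
  "place_eval \<iota> P z = (THE c. z - \<iota> c \<in> P)"


section \<open>Divisors\<close>

definition divisors :: "('k::field \<Rightarrow> 'f::field) \<Rightarrow> ('f set \<Rightarrow>\<^sub>0 int) set" where
  "divisors \<iota> = {A. Poly_Mapping.keys A \<subseteq> places \<iota>}"

definition div_degree :: "('k::field \<Rightarrow> 'f::field) \<Rightarrow> ('f set \<Rightarrow>\<^sub>0 int) \<Rightarrow> int" where
  "div_degree \<iota> A =
     (\<Sum>P\<in>Poly_Mapping.keys A. Poly_Mapping.lookup A P * int (place_degree \<iota> P))"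

definition RR_space :: "('k::field \<Rightarrow> 'f::field) \<Rightarrow> ('f set \<Rightarrow>\<^sub>0 int) \<Rightarrow> 'f set" where
  "RR_space \<iota> A =
     {z. z = 0 \<or> (\<forall>P\<in>places \<iota>. place_val P z \<ge> - Poly_Mapping.lookup A P)}"

definition ell :: "('k::field \<Rightarrow> 'f::field) \<Rightarrow> ('f set \<Rightarrow>\<^sub>0 int) \<Rightarrow> nat" where
  "ell \<iota> A = dim_via \<iota> (RR_space \<iota> A)"

text \<open>The genus is the maximum of \<open>deg A - ell A + 1\<close> over all divisors \<open>A\<close>.\<close>

definition has_genus :: "('k::field \<Rightarrow> 'f::field) \<Rightarrow> nat \<Rightarrow> bool" where
  "has_genus \<iota> g \<longleftrightarrow>
     (\<exists>A\<in>divisors \<iota>. int g = div_degree \<iota> A - int (ell \<iota> A) + 1) \<and>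
     (\<forall>A\<in>divisors \<iota>. div_degree \<iota> A - int (ell \<iota> A) + 1 \<le> int g)"

definition non_special :: "('k::field \<Rightarrow> 'f::field) \<Rightarrow> nat \<Rightarrow> ('f set \<Rightarrow>\<^sub>0 int) \<Rightarrow> bool" where
  "non_special \<iota> g A \<longleftrightarrow>
     A \<in> divisors \<iota> \<and> int (ell \<iota> A) = div_degree \<iota> A + 1 - int g"


section \<open>Places in extensions\<close>

text \<open>
  In this section \<open>h\<close> embeds the smaller function field into the larger one, and \<open>\<iota>\<close> embeds the
  constant field into the larger one.
\<close>

definition lies_over :: "('e::field \<Rightarrow> 'f::field) \<Rightarrow> 'f set \<Rightarrow> 'e set \<Rightarrow> bool" where
  "lies_over h Q P \<longleftrightarrow> h ` P \<subseteq> Q"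

definition places_over ::
    "('k::field \<Rightarrow> 'f::field) \<Rightarrow> ('e::field \<Rightarrow> 'f) \<Rightarrow> 'e set \<Rightarrow> 'f set set" where
  "places_over \<iota> h P = {Q \<in> places \<iota>. lies_over h Q P}"

definition ramification_index :: "('e::field \<Rightarrow> 'f::field) \<Rightarrow> 'f set \<Rightarrow> 'e set \<Rightarrow> nat" where
  "ramification_index h Q P =
     (THE e. \<forall>z. z \<noteq> 0 \<longrightarrow> place_val Q (h z) = int e * place_val P z)"

definition totally_ramified ::
    "('k::field \<Rightarrow> 'f::field) \<Rightarrow> ('e::field \<Rightarrow> 'f) \<Rightarrow> 'e set \<Rightarrow> bool" where
  "totally_ramified \<iota> h P \<longleftrightarrow>
     (\<exists>Q. places_over \<iota> h P = {Q} \<and> ramification_index h Q P = extension_degree h)"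

definition splits_completely ::
    "('k::field \<Rightarrow> 'f::field) \<Rightarrow> ('e::field \<Rightarrow> 'f) \<Rightarrow> 'e set \<Rightarrow> bool" where
  "splits_completely \<iota> h P \<longleftrightarrow>
     finite (places_over \<iota> h P) \<and> card (places_over \<iota> h P) = extension_degree h"


section \<open>The rational function field and Kummer extensions\<close>

text \<open>The rational function field over \<^typ>\<open>'k\<close> is the type \<^typ>\<open>'k poly fract\<close>.\<close>

definition rat_const :: "'k::field \<Rightarrow> 'k poly fract" where
  "rat_const c = Fract [:c:] 1"

definition rat_x :: "'k::field poly fract" where
  "rat_x = Fract [:0, 1:] 1"

definition finite_place :: "'k::field \<Rightarrow> 'k poly fract set" where
  "finite_place a = {Fract p q | p q. poly p a = 0 \<and> poly q a \<noteq> 0}"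

definition infinite_place :: "'k::field poly fract set" where
  "infinite_place = {Fract p q | p q. degree p < degree q}"

text \<open>
  The field \<^typ>\<open>'f\<close> is generated over the rational function field (embedded by \<open>h\<close>) by a root \<open>y\<close>
  of the Kummer equation. If \<open>m\<close> is coprime to the degree of the right-hand side, then the equation
  is irreducible, so this determines the extension up to isomorphism.
\<close>

definition kummer_function_field ::
    "('k::field poly fract \<Rightarrow> 'f::field) \<Rightarrow> 'f \<Rightarrow> nat \<Rightarrow> nat \<Rightarrow> (nat \<Rightarrow> 'k) \<Rightarrow> (nat \<Rightarrow> nat) \<Rightarrow> bool" where
  "kummer_function_field h y m r a lam \<longleftrightarrow>
     field_embedding h \<and>
     y ^ m = (\<Prod>k=1..r. (h rat_x - h (rat_const (a k))) ^ lam k) \<and>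
     generated_field (range h \<union> {y}) = UNIV"


section \<open>Codes\<close>

text \<open>
  The family \<open>S\<close> enumerates the places in the support of the divisor \<open>D\<close> of the code \<open>C\<^sub>L(D, A)\<close>.
\<close>

definition ag_code ::
    "('k::field \<Rightarrow> 'f::field) \<Rightarrow> ('n::finite \<Rightarrow> 'f set) \<Rightarrow> ('f set \<Rightarrow>\<^sub>0 int) \<Rightarrow> ('k ^ 'n) set" where
  "ag_code \<iota> S A = {(\<chi> i. place_eval \<iota> (S i) z) | z. z \<in> RR_space \<iota> A}"

definition linear_complementary_pair :: "('k::field ^ 'n::finite) set \<Rightarrow> ('k ^ 'n) set \<Rightarrow> bool" where
  "linear_complementary_pair C1 C2 \<longleftrightarrow>
     vec.subspace C1 \<and> vec.subspace C2 \<and> C1 \<inter> C2 = {0} \<and>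
     {u + v | u v. u \<in> C1 \<and> v \<in> C2} = UNIV"

definition code_parameters :: "('k::field ^ 'n::finite) set \<Rightarrow> int \<Rightarrow> int \<Rightarrow> bool" where
  "code_parameters C M d \<longleftrightarrow> vec.subspace C \<and> int CARD('n) = M \<and> int (vec.dim C) = d"

end

theory Submission
  imports Defs
begin

text \<open>
  Let \<open>Q\<^sub>0\<close> be the place at infinity, \<open>\<lambda>\<^sub>0\<close> the degree of the right-hand side of the Kummer equation and
  \<open>K\<^sub>1 = N - s \<lambda>\<^sub>0\<close>, \<open>K\<^sub>2 = s \<lambda>\<^sub>0\<close>, which are nonnegative by the bounds on \<open>s\<close>. Two functions govern the
  situation: \<open>y\<close>, whose divisor is \<open>- \<lambda>\<^sub>0 Q\<^sub>0\<close> plus \<open>\<lambda>\<^sub>k / gcd m \<lambda>\<^sub>k\<close> times each place over \<open>a\<^sub>k\<close>, and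
  \<open>\<psi> = \<Prod> (x - p\<^sub>i)\<close>, whose divisor is \<open>D - N Q\<^sub>0\<close>, where \<open>p\<^sub>1, \<dots>, p\<^sub>t\<close> are the coordinates of the split
  places. Thus \<open>G = E + K\<^sub>1 Q\<^sub>0\<close> and \<open>H = E + K\<^sub>2 Q\<^sub>0 + div (y ^ s)\<close>, the greatest lower bound of \<open>G\<close> and \<open>H\<close> is
  \<open>E\<close>, and their least upper bound minus \<open>D\<close> is linearly equivalent to \<open>E\<close> by multiplication with
  \<open>y ^ s / \<psi>\<close>.

  A nonspecial divisor \<open>E\<close> of degree \<open>g - 1\<close> has \<open>L E = 0\<close>. If \<open>z\<close> in \<open>L G\<close> and \<open>z'\<close> in \<open>L H\<close> agree at the
  evaluation places, then \<open>z - z'\<close> lies in the space of the least upper bound minus \<open>D\<close> and is therefore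
  zero; now \<open>z\<close> lies in both spaces, that is in \<open>L E\<close>, and is zero as well. So the codes intersect
  trivially and evaluation is injective on both spaces. Their dimensions \<open>K\<^sub>1\<close> and \<open>K\<^sub>2\<close> add up to \<open>N\<close>: adding
  \<open>Q\<^sub>0\<close> to \<open>E\<close> a total of \<open>K\<close> times raises the dimension from 0 to at most \<open>K\<close>, and the genus bounds it below
  by \<open>K\<close>. This argument is the locale \<open>evaluation_pair\<close>; it needs no further part of the theorem of
  Riemann and Roch, and principal divisors enter only through the values of \<open>y\<close> and \<open>\<psi>\<close>.

  The remaining work is to compute these values at every place. All places are discrete because the
  value group over that of the rational function field has bounded exponent
  (\<open>discrete_place_extension\<close>). At infinity \<open>\<lambda>\<^sub>0\<close> is coprime to \<open>m\<close>, so the powers \<open>y ^ i\<close> with \<open>i < m\<close>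
  have values that are distinct modulo the values of rational functions, and the value of every element
  can be read off from its expansion in powers of \<open>y\<close> (\<open>kummer_place_infinite\<close>); in particular the
  extension has degree \<open>m\<close>. Over \<open>x = a\<close> the same method works relative to the ring generated by the
  \<open>g\<close>-th root of a unit \<open>u = y ^ (m / g) / (x - a) ^ (\<lambda> / g)\<close>, with \<open>g = gcd m \<lambda>\<close>, over the local ring of \<open>a\<close>.
  That this ring is unramified follows from the observation that a suitable power of Frobenius is the
  identity on it modulo \<open>x - a\<close> (\<open>frobenius_A\<close>): an element \<open>c\<close> of the ring that vanishes at a place is
  divisible by \<open>x - a\<close>, because \<open>c ^ q - c\<close> is, and \<open>c ^ (q - 1) - 1\<close> is a unit. The same descent shows that a
  place over \<open>a\<close> is determined by the residues of the ring (\<open>place_determined_by_ring\<close>), which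
  bounds the number of rational places over a branch point and so keeps the split places away from the
  branch points.
\<close>

section \<open>Valuation rings and discrete places\<close>

lemma field_embedding_0: "field_embedding h \<Longrightarrow> h 0 = 0"
  unfolding field_embedding_def by (metis add_cancel_right_right)

lemma field_embedding_uminus: "field_embedding h \<Longrightarrow> h (- u) = - h u"
  using field_embedding_0[of h] unfolding field_embedding_def
  by (metis add.right_inverse minus_unique)

lemma field_embedding_diff: "field_embedding h \<Longrightarrow> h (u - v) = h u - h v"
  using field_embedding_uminus[of h v] unfolding field_embedding_def
  by (metis diff_conv_add_uminus)

lemma field_embedding_eq_0_iff: "field_embedding h \<Longrightarrow> h u = 0 \<longleftrightarrow> u = 0"
  using field_embedding_0[of h] unfolding field_embedding_def
  by (metis mult_zero_left right_inverse zero_neq_one)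

lemma field_embedding_inverse: "field_embedding h \<Longrightarrow> h (inverse u) = inverse (h u)"
  using field_embedding_0[of h] field_embedding_eq_0_iff[of h u] unfolding field_embedding_def
  by (metis inverse_zero inverse_unique right_inverse)

lemma field_embedding_divide: "field_embedding h \<Longrightarrow> h (u / v) = h u / h v"
  using field_embedding_inverse[of h v] unfolding field_embedding_def
  by (metis divide_inverse)

lemma field_embedding_power: "field_embedding h \<Longrightarrow> h (u ^ n) = h u ^ n"
  by (induction n) (auto simp: field_embedding_def)

lemma field_embedding_powi: "field_embedding h \<Longrightarrow> h (u powi n) = h u powi n"
  by (auto simp: power_int_def field_embedding_power field_embedding_inverse)

lemma field_embedding_sum: "field_embedding h \<Longrightarrow> h (\<Sum>i\<in>I. f i) = (\<Sum>i\<in>I. h (f i))"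
  by (induction I rule: infinite_finite_induct) (auto simp: field_embedding_def field_embedding_0)

lemma field_embedding_prod: "field_embedding h \<Longrightarrow> h (\<Prod>i\<in>I. f i) = (\<Prod>i\<in>I. h (f i))"
  by (induction I rule: infinite_finite_induct) (auto simp: field_embedding_def)

lemmas field_embedding_simps =
  field_embedding_0 field_embedding_uminus field_embedding_diff field_embedding_inverse
  field_embedding_divide field_embedding_power field_embedding_powi field_embedding_sum
  field_embedding_prod

lemma valuation_ring_place_ring:
  assumes "valuation_ring \<iota> V"
  shows "place_ring (V - unit_group V) = V"
proof -
  have 1: "z \<in> V" if "z \<noteq> 0" "inverse z \<notin> V - unit_group V" for z
  proof (rule ccontr)
    assume "z \<notin> V"
    then have "inverse z \<in> V" using assms by (auto simp: valuation_ring_def)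
    moreover have "inverse z \<notin> unit_group V"
    proof
      assume "inverse z \<in> unit_group V"
      then obtain w where "w \<in> V" "inverse z * w = 1" by (auto simp: unit_group_def)
      then have "w = z" using that(1) by (simp add: field_simps)
      then show False using \<open>w \<in> V\<close> \<open>z \<notin> V\<close> by simp
    qed
    ultimately show False using that by simp
  qed
  have 2: "inverse z \<in> unit_group V" if "z \<noteq> 0" "z \<in> V" "inverse z \<in> V" for z
    using that by (auto simp: unit_group_def intro: bexI[of _ z])
  have "0 \<in> V" using assms by (auto simp: valuation_ring_def is_subring_def)
  show ?thesis
  proof (intro set_eqI iffI)
    fix z assume "z \<in> place_ring (V - unit_group V)"
    then show "z \<in> V" using 1[of z] \<open>0 \<in> V\<close> unfolding place_ring_def by blast
  next
    fix z assume "z \<in> V"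
    then show "z \<in> place_ring (V - unit_group V)" using 2[of z] unfolding place_ring_def by blast
  qed
qed

locale place =
  fixes \<iota> :: "'k::field \<Rightarrow> 'f::field" and P :: "'f set"
  assumes emb: "field_embedding \<iota>" and place: "P \<in> places \<iota>"
begin

abbreviation V :: "'f set" where "V \<equiv> place_ring P"

lemma valuation_ring_V: "valuation_ring \<iota> V" and P_eq: "P = V - unit_group V"
proof -
  obtain W where "valuation_ring \<iota> W" "P = W - unit_group W"
    using place by (auto simp: places_def)
  then show "valuation_ring \<iota> V" "P = V - unit_group V"
    using valuation_ring_place_ring by metis+
qed

lemma V_0: "0 \<in> V" and V_1: "1 \<in> V"
  and V_add: "z \<in> V \<Longrightarrow> w \<in> V \<Longrightarrow> z + w \<in> V"
  and V_diff: "z \<in> V \<Longrightarrow> w \<in> V \<Longrightarrow> z - w \<in> V"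
  and V_mult: "z \<in> V \<Longrightarrow> w \<in> V \<Longrightarrow> z * w \<in> V"
  and V_total: "z \<in> V \<or> inverse z \<in> V"
  using valuation_ring_V unfolding valuation_ring_def is_subring_def by blast+

lemma V_const: "\<iota> c \<in> V"
  using valuation_ring_V unfolding valuation_ring_def by blast

lemma V_proper: "\<exists>z. z \<notin> V"
  using valuation_ring_V unfolding valuation_ring_def by blast

lemma V_power: "z \<in> V \<Longrightarrow> z ^ n \<in> V"
  by (induction n) (auto intro: V_1 V_mult)

lemma V_sum: "(\<And>i. i \<in> I \<Longrightarrow> f i \<in> V) \<Longrightarrow> (\<Sum>i\<in>I. f i) \<in> V"
  by (induction I rule: infinite_finite_induct) (auto intro: V_0 V_add)

lemma P_V: "z \<in> P \<Longrightarrow> z \<in> V"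
  by (subst (asm) P_eq) simp

lemma unit_iff: "z \<in> unit_group V \<longleftrightarrow> z \<in> V \<and> z \<notin> P"
  by (subst (2) P_eq) (auto simp: unit_group_def)

lemma P_iff: "z \<noteq> 0 \<Longrightarrow> z \<in> P \<longleftrightarrow> inverse z \<notin> V"
  by (auto simp: place_ring_def)

lemma V_iff: "z \<noteq> 0 \<Longrightarrow> z \<in> V \<longleftrightarrow> inverse z \<notin> P"
  by (auto simp: place_ring_def)

lemma P_0: "0 \<in> P"
  by (subst P_eq) (auto simp: unit_group_def V_0)

lemma P_1: "1 \<notin> P"
  by (simp add: P_iff V_1)

lemma unit_nonzero: "z \<notin> P \<Longrightarrow> z \<noteq> 0"
  using P_0 by auto

lemma unit_inverse: "z \<in> V \<Longrightarrow> z \<notin> P \<Longrightarrow> inverse z \<in> V \<and> inverse z \<notin> P"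
  using P_iff[of z] V_iff[of z] unit_nonzero[of z] by auto

lemma P_mult: "z \<in> P \<Longrightarrow> w \<in> V \<Longrightarrow> z * w \<in> P"
proof (rule ccontr)
  assume *: "z \<in> P" "w \<in> V" "z * w \<notin> P"
  then have "z * w \<in> V" by (auto intro: V_mult P_V)
  then have "inverse (z * w) \<in> V" using * unit_inverse[of "z * w"] by blast
  then have "w * inverse (z * w) \<in> V" using * by (auto intro: V_mult)
  moreover have nz: "z * w \<noteq> 0" using * P_0 by auto
  ultimately have "inverse z \<in> V" by (simp add: field_simps)
  then show False using * nz P_iff by auto
qed

lemma P_mult': "z \<in> V \<Longrightarrow> w \<in> P \<Longrightarrow> z * w \<in> P"
  using P_mult[of w z] by (simp add: mult.commute)

lemma P_prime: "z \<in> V \<Longrightarrow> w \<in> V \<Longrightarrow> z * w \<in> P \<Longrightarrow> z \<in> P \<or> w \<in> P"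
proof (rule ccontr)
  assume *: "z \<in> V" "w \<in> V" "z * w \<in> P" "\<not> (z \<in> P \<or> w \<in> P)"
  then have "inverse z * inverse w \<in> V" by (metis V_mult unit_inverse)
  then have "(z * w) * (inverse z * inverse w) \<in> P" using * by (auto intro: P_mult)
  moreover have "(z * w) * (inverse z * inverse w) = 1"
    using * P_0 by (auto simp: field_simps)
  ultimately show False using P_1 by simp
qed

lemma unit_mult: "z \<in> V \<Longrightarrow> z \<notin> P \<Longrightarrow> w \<in> V \<Longrightarrow> w \<notin> P \<Longrightarrow> z * w \<in> V \<and> z * w \<notin> P"
  using P_prime V_mult by auto

lemma P_uminus: "- z \<in> P \<longleftrightarrow> z \<in> P"
proof -
  have "-1 \<in> V" using V_diff[OF V_0 V_1] by simp
  then show ?thesis using P_mult[of z "-1"] P_mult[of "-z" "-1"] by auto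
qed

text \<open>
  One of the quotients \<open>z / w\<close> and \<open>w / z\<close> lies in the valuation ring, so that the sum is a
  multiple of the larger of the two.
\<close>

lemma P_add: assumes "z \<in> P" "w \<in> P" shows "z + w \<in> P"
proof -
  have aux: "z + w \<in> P" if "z \<in> P" "w \<in> P" "z \<noteq> 0" "w / z \<in> V" for z w
  proof -
    have "z * (1 + w / z) \<in> P" using that by (intro P_mult V_add V_1)
    moreover have "z * (1 + w / z) = z + w" using that by (simp add: distrib_left)
    ultimately show ?thesis by simp
  qed
  show ?thesis
  proof (cases "z = 0 \<or> w = 0")
    case True
    then show ?thesis using assms by auto
  next
    case False
    then show ?thesis
      using V_total[of "w / z"] aux[of z w] aux[of w z] assms by (auto simp: add.commute)
  qed
qed

lemma P_diff: "z \<in> P \<Longrightarrow> w \<in> P \<Longrightarrow> z - w \<in> P"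
  using P_add[of z "-w"] by (simp add: P_uminus)

lemma P_sum: "(\<And>i. i \<in> I \<Longrightarrow> f i \<in> P) \<Longrightarrow> (\<Sum>i\<in>I. f i) \<in> P"
  by (induction I rule: infinite_finite_induct) (auto intro: P_0 P_add)

lemma unit_power: "u \<in> V \<Longrightarrow> u \<notin> P \<Longrightarrow> u ^ n \<in> V \<and> u ^ n \<notin> P"
  by (induction n) (simp_all add: V_1 P_1 unit_mult)

lemma P_power: assumes "z \<in> V" "n > 0" shows "z ^ n \<in> P \<longleftrightarrow> z \<in> P"
proof
  assume "z \<in> P"
  then have "z * z ^ (n - 1) \<in> P" using assms by (intro P_mult V_power)
  then show "z ^ n \<in> P" using assms(2) by (simp add: power_eq_if)
qed (use unit_power[of z n] assms in blast)

lemma V_power_iff: assumes "n > 0" shows "z ^ n \<in> V \<longleftrightarrow> z \<in> V"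
proof
  assume *: "z ^ n \<in> V"
  show "z \<in> V"
  proof (rule ccontr)
    assume n: "z \<notin> V"
    then have nz: "z \<noteq> 0" using V_0 by auto
    then have "inverse z \<in> P" using n V_iff by blast
    then have "inverse z ^ n \<in> P" using P_power assms P_V by blast
    then show False using * nz V_iff[of "z ^ n"] by (auto simp: power_inverse)
  qed
qed (rule V_power)

lemma const_0: "\<iota> c = 0 \<longleftrightarrow> c = 0"
  using emb by (simp add: field_embedding_eq_0_iff)

lemma const_P: "\<iota> c \<in> P \<longleftrightarrow> c = 0"
proof
  assume "\<iota> c \<in> P"
  show "c = 0"
  proof (rule ccontr)
    assume "c \<noteq> 0"
    then have "\<iota> c * \<iota> (inverse c) = 1"
      using emb const_0[of c] by (simp add: field_embedding_inverse)
    then show False using P_mult[OF \<open>\<iota> c \<in> P\<close> V_const[of "inverse c"]] P_1 by simp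
  qed
next
  assume "c = 0"
  then show "\<iota> c \<in> P" using P_0 const_0[of c] by simp
qed

lemma const_unique: "z - \<iota> c \<in> P \<Longrightarrow> z - \<iota> d \<in> P \<Longrightarrow> c = d"
  using P_diff[of "z - \<iota> d" "z - \<iota> c"] const_P[of "c - d"] emb
  by (simp add: field_embedding_diff)

lemma eval_eq: "z - \<iota> c \<in> P \<Longrightarrow> place_eval \<iota> P z = c"
  unfolding place_eval_def using const_unique by blast

lemma dominant_exists:
  assumes "finite I" "I \<noteq> {}" "\<And>i. i \<in> I \<Longrightarrow> b i \<noteq> 0"
  shows "\<exists>j\<in>I. \<forall>i\<in>I. b i / b j \<in> V"
  using assms
proof (induction I rule: finite_ne_induct)
  case (singleton i)
  then show ?case by (simp add: V_1)
next
  case (insert i I)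
  then obtain j where j: "j \<in> I" "\<And>l. l \<in> I \<Longrightarrow> b l / b j \<in> V" by auto
  show ?case
  proof (cases "b i / b j \<in> V")
    case True
    then show ?thesis using j by auto
  next
    case False
    then have *: "b j / b i \<in> V" using V_total[of "b i / b j"] by simp
    have "b l / b i \<in> V" if "l \<in> I" for l
      using V_mult[OF j(2)[OF that] *] insert.prems j(1) by (simp add: field_simps)
    then show ?thesis using V_1 insert.prems by auto
  qed
qed

text \<open>
  A sum of nonzero elements in which one element strictly dominates all others cannot vanish.
\<close>

lemma vanishing_sum_two_equivalent:
  assumes "finite I" "(\<Sum>i\<in>I. b i) = 0" "\<exists>i\<in>I. b i \<noteq> 0"
  shows "\<exists>i\<in>I. \<exists>j\<in>I. i \<noteq> j \<and> b i \<noteq> 0 \<and> b j \<noteq> 0 \<and> b i / b j \<in> V \<and> b i / b j \<notin> P"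
proof -
  define J where "J = {i \<in> I. b i \<noteq> 0}"
  have J: "finite J" "J \<noteq> {}" "\<And>i. i \<in> J \<Longrightarrow> b i \<noteq> 0"
    using assms by (auto simp: J_def)
  have sum_J: "(\<Sum>i\<in>J. b i) = 0"
  proof -
    have "(\<Sum>i\<in>I. b i) = (\<Sum>i\<in>J. b i)"
      by (rule sum.mono_neutral_right) (use assms(1) in \<open>auto simp: J_def\<close>)
    then show ?thesis using assms(2) by simp
  qed
  obtain j where j: "j \<in> J" "\<And>i. i \<in> J \<Longrightarrow> b i / b j \<in> V"
    using dominant_exists[OF J(1,2), of b] J(3) by blast
  have "\<exists>i\<in>J - {j}. b i / b j \<notin> P"
  proof (rule ccontr)
    assume "\<not> ?thesis"
    then have *: "(\<Sum>i\<in>J - {j}. b i / b j) \<in> P" by (intro P_sum) auto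
    have "(\<Sum>i\<in>J. b i / b j) = 0" using sum_J by (simp add: sum_divide_distrib[symmetric])
    then have "1 + (\<Sum>i\<in>J - {j}. b i / b j) = 0"
      using sum.remove[OF J(1) j(1), of "\<lambda>i. b i / b j"] J(3)[OF j(1)] by simp
    then have "(\<Sum>i\<in>J - {j}. b i / b j) = -1" by (simp add: add_eq_0_iff)
    then show False using * P_uminus[of 1] P_1 by simp
  qed
  then obtain i where "i \<in> J" "i \<noteq> j" "b i / b j \<notin> P" by blast
  then show ?thesis using j(1) j(2)[of i] unfolding J_def by blast
qed

lemma powi_unit_V_iff:
  assumes t: "t \<noteq> 0" "t \<in> P" and u: "u \<in> V" "u \<notin> P"
  shows "t powi k * u \<in> V \<longleftrightarrow> 0 \<le> k"
proof
  assume "0 \<le> k"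
  then show "t powi k * u \<in> V" using t u by (simp add: power_int_def V_mult V_power P_V)
next
  assume V: "t powi k * u \<in> V"
  show "0 \<le> k"
  proof (rule ccontr)
    assume "\<not> 0 \<le> k"
    then have "t powi (- k) \<in> P" using t by (simp add: power_int_def P_power P_V)
    then have "t powi (- k) * (t powi k * u) \<in> P" using V by (intro P_mult)
    moreover have "t powi (- k) * (t powi k * u) = u" using t by (simp add: power_int_minus)
    ultimately show False using u by simp
  qed
qed

lemma exponent_unique:
  assumes t: "t \<noteq> 0" "t \<in> P" and u: "u \<in> V" "u \<notin> P" and w: "w \<in> V" "w \<notin> P"
    and eq: "t powi k * u = t powi l * w"
  shows "k = l"
proof -
  have "t powi (k - l) * u = w" using eq t by (simp add: power_int_diff field_simps)
  moreover from this have "t powi (l - k) * w = u"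
    using t by (simp add: power_int_diff field_simps)
  ultimately have "0 \<le> k - l" "0 \<le> l - k"
    using powi_unit_V_iff[OF t u, of "k - l"] powi_unit_V_iff[OF t w, of "l - k"] u w by simp_all
  then show ?thesis by simp
qed

end

text \<open>
  A generator of the value group exists as soon as the value group embeds into the integers; for
  the places of a function field this is what finiteness over a rational function field yields.
\<close>

locale discrete_place = place \<iota> P for \<iota> :: "'k::field \<Rightarrow> 'f::field" and P +
  assumes uniformizer:
    "\<exists>t. t \<noteq> 0 \<and> t \<in> P \<and> (\<forall>z. z \<noteq> 0 \<longrightarrow> (\<exists>k u. u \<in> V \<and> u \<notin> P \<and> z = t powi k * u))"
begin

definition unif :: "'f" where
  "unif = (SOME t. t \<noteq> 0 \<and> t \<in> P \<and> (\<forall>z. z \<noteq> 0 \<longrightarrow> (\<exists>k u. u \<in> V \<and> u \<notin> P \<and> z = t powi k * u)))"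

lemma unif: "unif \<noteq> 0" "unif \<in> P" "z \<noteq> 0 \<Longrightarrow> \<exists>k u. u \<in> V \<and> u \<notin> P \<and> z = unif powi k * u"
  using someI_ex[OF uniformizer] unfolding unif_def by blast+

lemma unit_powi: "u \<in> V \<Longrightarrow> u \<notin> P \<Longrightarrow> u powi k \<in> V \<and> u powi k \<notin> P"
  using unit_inverse[of u] unit_power by (simp add: power_int_def)

lemma prime_element_iff: "prime_element P t \<longleftrightarrow> (\<exists>w. w \<in> V \<and> w \<notin> P \<and> t = unif * w)"
proof -
  have P: "P = {unif * z |z. z \<in> V}"
  proof
    show "P \<subseteq> {unif * z |z. z \<in> V}"
    proof
      fix z assume z: "z \<in> P"
      show "z \<in> {unif * z |z. z \<in> V}"
      proof (cases "z = 0")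
        case True
        then show ?thesis using V_0 by auto
      next
        case False
        then obtain k u where ku: "u \<in> V" "u \<notin> P" "z = unif powi k * u" using unif(3) by blast
        have "k > 0"
        proof (rule ccontr)
          assume "\<not> k > 0"
          then have "unif powi (- k) \<in> V" using P_V[OF unif(2)] by (simp add: power_int_def V_power)
          then have *: "z * unif powi (- k) \<in> P" using z by (intro P_mult)
          have "unif powi k \<noteq> 0" using unif(1) by simp
          then have "z * unif powi (- k) = u" using ku(3) by (simp add: power_int_minus)
          then show False using * ku(2) by simp
        qed
        then have "unif powi (k - 1) * u \<in> V"
          using P_V[OF unif(2)] ku by (auto simp: power_int_def intro!: V_mult V_power)
        moreover have "z = unif * (unif powi (k - 1) * u)"
          using ku(3) unif(1) by (simp add: power_int_diff)
        ultimately show ?thesis by blast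
      qed
    qed
  qed (auto intro: P_mult unif)
  show ?thesis
  proof
    assume t: "prime_element P t"
    then have "t * 1 \<in> P" using V_1 unfolding prime_element_def by blast
    then obtain w where w: "t = unif * w" "w \<in> V" using P by auto
    obtain w' where w': "unif = t * w'" "w' \<in> V" using t unif(2) unfolding prime_element_def by blast
    have "w * w' = 1" using w w' unif(1) by (metis mult.assoc mult_cancel_left2)
    then have "w \<notin> P" using P_mult[of w w'] w' P_1 by auto
    then show "\<exists>w. w \<in> V \<and> w \<notin> P \<and> t = unif * w" using w by blast
  next
    assume "\<exists>w. w \<in> V \<and> w \<notin> P \<and> t = unif * w"
    then obtain w where w: "w \<in> V" "w \<notin> P" "t = unif * w" by blast
    have "{unif * z |z. z \<in> V} = {t * z |z. z \<in> V}"
    proof (intro set_eqI iffI)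
      fix x assume "x \<in> {unif * z |z. z \<in> V}"
      then obtain z where "x = unif * z" "z \<in> V" by blast
      then have "x = t * (inverse w * z)" "inverse w * z \<in> V"
        using w unit_nonzero[of w] unit_inverse[of w] by (auto intro: V_mult)
      then show "x \<in> {t * z |z. z \<in> V}" by blast
    next
      fix x assume "x \<in> {t * z |z. z \<in> V}"
      then show "x \<in> {unif * z |z. z \<in> V}" using w V_mult by (auto simp: mult.assoc)
    qed
    then show "prime_element P t" unfolding prime_element_def using P by simp
  qed
qed

abbreviation v :: "'f \<Rightarrow> int" where "v \<equiv> place_val P"

lemma v_eq: assumes "u \<in> V" "u \<notin> P" shows "v (unif powi k * u) = k"
  unfolding place_val_def
proof (rule the_equality)
  show "\<exists>t w. prime_element P t \<and> w \<in> unit_group V \<and> unif powi k * u = t powi k * w"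
  proof (intro exI conjI)
    show "prime_element P unif" using prime_element_iff V_1 P_1 by (metis mult.right_neutral)
    show "u \<in> unit_group V" using assms by (simp add: unit_iff)
  qed simp
next
  fix l assume "\<exists>t w. prime_element P t \<and> w \<in> unit_group V \<and> unif powi k * u = t powi l * w"
  then obtain t w where t: "prime_element P t" "w \<in> V" "w \<notin> P" "unif powi k * u = t powi l * w"
    by (auto simp: unit_iff)
  obtain w' where w': "w' \<in> V" "w' \<notin> P" "t = unif * w'" using t prime_element_iff by blast
  have *: "unif powi k * u = unif powi l * (w' powi l * w)"
    using t w' by (simp add: power_int_mult_distrib mult.assoc)
  have "w' powi l * w \<in> V" "w' powi l * w \<notin> P"
    using unit_mult[of "w' powi l" w] unit_powi[of w' l] w' t by auto
  then show "l = k"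
    using exponent_unique[OF unif(1,2) assms _ _ *] by simp
qed

lemma v_decomp: assumes "z \<noteq> 0" obtains u where "u \<in> V" "u \<notin> P" "z = unif powi (v z) * u"
  using unif(3)[OF assms] v_eq by metis

lemma v_mult: assumes "z \<noteq> 0" "w \<noteq> 0" shows "v (z * w) = v z + v w"
proof -
  obtain a where a: "a \<in> V" "a \<notin> P" "z = unif powi (v z) * a" using v_decomp assms(1) by blast
  obtain b where b: "b \<in> V" "b \<notin> P" "w = unif powi (v w) * b" using v_decomp assms(2) by blast
  have "z * w = (unif powi (v z) * a) * (unif powi (v w) * b)" using a(3) b(3) by simp
  then have "z * w = unif powi (v z + v w) * (a * b)"
    using unif(1) by (simp add: power_int_add mult_ac)
  then show ?thesis using v_eq[of "a * b" "v z + v w"] unit_mult[of a b] a b by simp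
qed

lemma v_unit: "u \<in> V \<Longrightarrow> u \<notin> P \<Longrightarrow> v u = 0"
  using v_eq[of u 0] by simp

lemma v_1: "v 1 = 0"
  by (simp add: v_unit V_1 P_1)

lemma v_unif: "v unif = 1"
  using v_eq[of 1 1] by (simp add: V_1 P_1)

lemma v_inverse: "z \<noteq> 0 \<Longrightarrow> v (inverse z) = - v z"
  using v_mult[of z "inverse z"] v_1 by simp

lemma v_divide: "z \<noteq> 0 \<Longrightarrow> w \<noteq> 0 \<Longrightarrow> v (z / w) = v z - v w"
  using v_mult[of z "inverse w"] v_inverse[of w] by (simp add: divide_inverse)

lemma v_power: "z \<noteq> 0 \<Longrightarrow> v (z ^ n) = int n * v z"
  by (induction n) (auto simp: v_1 v_mult algebra_simps)

lemma v_powi: "z \<noteq> 0 \<Longrightarrow> v (z powi k) = k * v z"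
  by (auto simp: power_int_def v_power v_inverse)

lemma v_prod: "(\<And>i. i \<in> I \<Longrightarrow> f i \<noteq> 0) \<Longrightarrow> v (\<Prod>i\<in>I. f i) = (\<Sum>i\<in>I. v (f i))"
  by (induction I rule: infinite_finite_induct) (auto simp: v_1 v_mult)

lemma v_pos_iff: assumes "z \<noteq> 0" shows "z \<in> P \<longleftrightarrow> 0 < v z"
proof -
  have pos: "w \<in> P" if "w \<noteq> 0" "0 < v w" for w
  proof -
    obtain a where a: "a \<in> V" "a \<notin> P" "w = unif powi (v w) * a" using v_decomp \<open>w \<noteq> 0\<close> by blast
    have "unif powi (v w) \<in> P" using that unif(2) by (simp add: power_int_def P_power P_V)
    then show ?thesis using a P_mult by metis
  qed
  have "z \<notin> P" if "v z < 0"
    using pos[of "inverse z"] V_iff[of z] assms that v_inverse[of z] P_V[of z] by auto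
  moreover have "z \<notin> P" if "v z = 0"
    using v_decomp[of z] assms that by (metis mult_1 power_int_0_right)
  ultimately show ?thesis using pos[of z] assms by linarith
qed

lemma v_nonneg_iff: "z \<noteq> 0 \<Longrightarrow> z \<in> V \<longleftrightarrow> 0 \<le> v z"
  using v_pos_iff[of "inverse z"] v_inverse[of z] V_iff[of z] by auto

lemma v_const: "c \<noteq> 0 \<Longrightarrow> v (\<iota> c) = 0"
  using v_unit[of "\<iota> c"] by (simp add: V_const const_P)

lemma v_uminus: "v (- z) = v z"
proof (cases "z = 0")
  case False
  have "-1 \<in> V" "-1 \<notin> P" using V_diff[OF V_0 V_1] P_1 P_uminus[of 1] by auto
  then show ?thesis using v_mult[of "-1" z] v_unit[of "-1"] False by simp
qed simp

text \<open>
  The convention that 0 lies in every space of elements of value at least \<open>n\<close> stands in for the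
  value \<open>\<infinity>\<close> of 0.
\<close>

definition v_ge :: "int \<Rightarrow> 'f set" where "v_ge n = {z. z = 0 \<or> n \<le> v z}"

lemma v_ge_iff: assumes "w \<noteq> 0" shows "z \<in> v_ge (v w) \<longleftrightarrow> z / w \<in> V"
proof (cases "z = 0")
  case False
  then have "z / w \<noteq> 0" using assms by simp
  then show ?thesis
    using False assms v_nonneg_iff[of "z / w"] v_divide[of z w] by (simp add: v_ge_def)
qed (simp add: v_ge_def V_0)

lemma v_ge_0: "0 \<in> v_ge n"
  by (simp add: v_ge_def)

lemma v_ge_add: "z \<in> v_ge n \<Longrightarrow> w \<in> v_ge n \<Longrightarrow> z + w \<in> v_ge n"
proof -
  assume *: "z \<in> v_ge n" "w \<in> v_ge n"
  have "v (unif powi n) = n" using unif(1) v_powi[of unif n] v_unif by simp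
  then have eq: "x \<in> v_ge n \<longleftrightarrow> x / unif powi n \<in> V" for x
    using v_ge_iff[of "unif powi n" x] unif(1) by simp
  show ?thesis using * V_add unfolding eq by (simp add: add_divide_distrib)
qed

lemma v_ge_sum: "(\<And>i. i \<in> I \<Longrightarrow> f i \<in> v_ge n) \<Longrightarrow> (\<Sum>i\<in>I. f i) \<in> v_ge n"
  by (induction I rule: infinite_finite_induct) (auto intro: v_ge_add v_ge_0)

lemma v_add_eq: assumes "z \<noteq> 0" "w \<in> v_ge (v z + 1)" shows "z + w \<noteq> 0 \<and> v (z + w) = v z"
proof -
  have "w / z \<in> P"
  proof (cases "w = 0")
    case False
    then have "w / z \<noteq> 0" using assms by simp
    then show ?thesis
      using False assms v_pos_iff[of "w / z"] v_divide[of w z] by (simp add: v_ge_def)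
  qed (simp add: P_0)
  then have "1 + w / z \<in> V" "1 + w / z \<notin> P"
    using V_add[OF V_1 P_V] P_diff[of "1 + w / z" "w / z"] P_1 by auto
  moreover have "z + w = z * (1 + w / z)" using assms by (simp add: field_simps)
  ultimately show ?thesis using assms v_mult[of z "1 + w / z"] v_unit unit_nonzero by auto
qed

text \<open>
  Terms of distinct values cannot cancel. Values of arbitrary elements will be read off from
  expansions of this kind.
\<close>

lemma v_sum_distinct:
  assumes "finite I" "\<And>i j. i \<in> I \<Longrightarrow> j \<in> I \<Longrightarrow> b i \<noteq> 0 \<Longrightarrow> b j \<noteq> 0 \<Longrightarrow> v (b i) = v (b j) \<Longrightarrow> i = j"
    and "\<exists>i\<in>I. b i \<noteq> 0"
  shows "(\<Sum>i\<in>I. b i) \<noteq> 0 \<and>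
    (\<exists>i\<in>I. b i \<noteq> 0 \<and> v (\<Sum>i\<in>I. b i) = v (b i)) \<and>
    (\<forall>i\<in>I. b i \<noteq> 0 \<longrightarrow> v (\<Sum>i\<in>I. b i) \<le> v (b i))"
proof -
  define W where "W = {v (b i) |i. i \<in> I \<and> b i \<noteq> 0}"
  have W: "finite W" "W \<noteq> {}" using assms by (auto simp: W_def)
  then obtain j where j: "j \<in> I" "b j \<noteq> 0" "v (b j) = Min W"
    using Min_in[of W] unfolding W_def by auto
  have "b i \<in> v_ge (v (b j) + 1)" if "i \<in> I - {j}" for i
  proof (cases "b i = 0")
    case False
    then have "v (b j) \<le> v (b i)" using j that W by (auto simp: W_def intro!: Min_le)
    moreover have "v (b i) \<noteq> v (b j)" using assms(2)[of i j] that j False by auto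
    ultimately show ?thesis by (auto simp: v_ge_def)
  qed (simp add: v_ge_def)
  then have "(\<Sum>i\<in>I - {j}. b i) \<in> v_ge (v (b j) + 1)" by (rule v_ge_sum)
  then have "(\<Sum>i\<in>I. b i) \<noteq> 0" "v (\<Sum>i\<in>I. b i) = v (b j)"
    using v_add_eq[of "b j"] j(2) sum.remove[OF assms(1) j(1), of b] by simp_all
  moreover have "v (b j) \<le> v (b i)" if "i \<in> I" "b i \<noteq> 0" for i
    using j(3) W(1) that by (auto simp: W_def intro!: Min_le)
  ultimately show ?thesis using j by auto
qed

end

text \<open>
  A nontrivial homomorphism to the integers that is nonnegative exactly on the valuation ring
  need not be onto; a prime element is an element of least positive value.
\<close>

lemma (in place) discrete_placeI:
  assumes mult: "\<And>z w. z \<noteq> 0 \<Longrightarrow> w \<noteq> 0 \<Longrightarrow> \<omega> (z * w) = \<omega> z + (\<omega> w :: int)"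
    and ring: "\<And>z. z \<noteq> 0 \<Longrightarrow> z \<in> V \<longleftrightarrow> 0 \<le> \<omega> z"
  shows "discrete_place \<iota> P"
proof
  have one: "\<omega> 1 = 0" using mult[of 1 1] by simp
  have inv: "\<omega> (inverse z) = - \<omega> z" if "z \<noteq> 0" for z using mult[of z "inverse z"] that one by simp
  have pow: "\<omega> (z ^ n) = int n * \<omega> z" if "z \<noteq> 0" for z n
    by (induction n) (auto simp: one mult that algebra_simps)
  have powi: "\<omega> (z powi k) = k * \<omega> z" if "z \<noteq> 0" for z k
    using that by (auto simp: power_int_def pow inv)
  have P: "z \<in> P \<longleftrightarrow> 0 < \<omega> z" if "z \<noteq> 0" for z
    using that P_iff[of z] ring[of "inverse z"] inv by auto
  obtain z0 where z0: "z0 \<notin> V" using V_proper by blast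
  define S where "S = {n. n > 0 \<and> (\<exists>z. z \<noteq> 0 \<and> \<omega> z = int n)}"
  have nz: "z0 \<noteq> 0" using z0 V_0 by auto
  then have "\<omega> z0 < 0" using ring[OF nz] z0 by simp
  then have "inverse z0 \<noteq> 0 \<and> \<omega> (inverse z0) = int (nat (- \<omega> z0)) \<and> nat (- \<omega> z0) > 0"
    using inv[OF nz] nz by simp
  then have "nat (- \<omega> z0) \<in> S" unfolding S_def by blast
  then have "\<exists>d. d \<in> S \<and> (\<forall>n. n \<in> S \<longrightarrow> d \<le> n)"
    using LeastI[of "\<lambda>n. n \<in> S"] Least_le[of "\<lambda>n. n \<in> S"] by blast
  then obtain d where d: "d \<in> S" "\<And>n. n \<in> S \<Longrightarrow> d \<le> n" by blast
  then obtain t where t: "t \<noteq> 0" "\<omega> t = int d" "d > 0" by (auto simp: S_def)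
  have "\<exists>k u. u \<in> V \<and> u \<notin> P \<and> z = t powi k * u" if z: "z \<noteq> 0" for z
  proof -
    define k where "k = \<omega> z div int d"
    define u where "u = z * t powi (- k)"
    have u: "u \<noteq> 0" using z t by (simp add: u_def)
    have "\<omega> u = \<omega> z - k * int d" using z t mult[of z "t powi (- k)"] powi[of t "- k"] by (simp add: u_def)
    then have *: "\<omega> u = \<omega> z mod int d" by (simp add: k_def minus_div_mult_eq_mod)
    have "\<omega> u = 0"
    proof (rule ccontr)
      assume "\<omega> u \<noteq> 0"
      then have "0 < \<omega> u" "\<omega> u < int d" using * t(3) by (smt (verit) pos_mod_bound pos_mod_sign of_nat_0_less_iff)+
      then have "nat (\<omega> u) \<in> S" using u by (auto simp: S_def)
      then have "int d \<le> int (nat (\<omega> u))" using d(2)[of "nat (\<omega> u)"] by linarith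
      then show False using \<open>0 < \<omega> u\<close> \<open>\<omega> u < int d\<close> by simp
    qed
    then have "u \<in> V" "u \<notin> P" using u P ring by auto
    moreover have "z = t powi k * u" using t by (simp add: u_def power_int_minus)
    ultimately show ?thesis by blast
  qed
  then show "\<exists>t. t \<noteq> 0 \<and> t \<in> P \<and> (\<forall>z. z \<noteq> 0 \<longrightarrow> (\<exists>k u. u \<in> V \<and> u \<notin> P \<and> z = t powi k * u))"
    using t P by (intro exI[of _ t]) auto
qed

section \<open>Residue fields\<close>

lemma ex1_two: "\<exists>!x. Q x \<Longrightarrow> Q x \<Longrightarrow> Q y \<Longrightarrow> x = y"
  by blast

text \<open>
  Over a finite field, a vector space with a basis of \<open>d\<close> elements has \<open>q\<^sup>d\<close> elements, so
  the size of a basis of the residue field can be recovered by counting residue classes.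
\<close>

lemma (in place) residue_basis_card_le:
  assumes fin: "finite (UNIV :: 'k set)"
    and B: "residue_basis \<iota> P B" and B': "residue_basis \<iota> P B'"
  shows "card B \<le> card B'"
proof -
  let ?C = "\<lambda>B :: 'f set. B \<rightarrow>\<^sub>E (UNIV :: 'k set)"
  have fB: "finite B" "finite B'" and BV: "B \<subseteq> V" using B B' by (auto simp: residue_basis_def)
  have "\<exists>c'\<in>?C B'. (\<Sum>b\<in>B. \<iota> (c b) * b) - (\<Sum>b\<in>B'. \<iota> (c' b) * b) \<in> P" for c
  proof -
    have "(\<Sum>b\<in>B. \<iota> (c b) * b) \<in> V" using BV by (intro V_sum V_mult V_const) auto
    then obtain c' where "(\<Sum>b\<in>B. \<iota> (c b) * b) - (\<Sum>b\<in>B'. \<iota> (c' b) * b) \<in> P"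
      using B' unfolding residue_basis_def by blast
    moreover have "(\<Sum>b\<in>B'. \<iota> (restrict c' B' b) * b) = (\<Sum>b\<in>B'. \<iota> (c' b) * b)"
      by (rule sum.cong) auto
    ultimately show ?thesis by (intro bexI[of _ "restrict c' B'"]) auto
  qed
  then obtain \<phi> where \<phi>: "\<And>c. \<phi> c \<in> ?C B'"
      "\<And>c. (\<Sum>b\<in>B. \<iota> (c b) * b) - (\<Sum>b\<in>B'. \<iota> (\<phi> c b) * b) \<in> P"
    by metis
  have "inj_on \<phi> (?C B)"
  proof (rule inj_onI)
    fix c d assume cd: "c \<in> ?C B" "d \<in> ?C B" "\<phi> c = \<phi> d"
    have "(\<Sum>b\<in>B. \<iota> (c b) * b) - (\<Sum>b\<in>B. \<iota> (d b) * b) \<in> P"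
      using P_diff[OF \<phi>(2)[of c] \<phi>(2)[of d]] cd(3) by simp
    then have *: "(\<Sum>b\<in>B. \<iota> (c b) * b) - (\<Sum>b\<in>B. \<iota> ((if b \<in> B then d b else 0)) * b) \<in> P"
      by simp
    have **: "(\<Sum>b\<in>B. \<iota> (c b) * b) - (\<Sum>b\<in>B. \<iota> ((if b \<in> B then c b else 0)) * b) \<in> P"
      using P_0 by simp
    have "(\<Sum>b\<in>B. \<iota> (c b) * b) \<in> V" using BV by (intro V_sum V_mult V_const) auto
    then have "\<exists>!e. (\<forall>b. b \<notin> B \<longrightarrow> e b = 0) \<and>
        (\<Sum>b\<in>B. \<iota> (c b) * b) - (\<Sum>b\<in>B. \<iota> (e b) * b) \<in> P"
      using B unfolding residue_basis_def by blast
    from ex1_two[OF this, of "\<lambda>b. if b \<in> B then c b else 0" "\<lambda>b. if b \<in> B then d b else 0"]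
    have "(\<lambda>b. if b \<in> B then c b else 0) = (\<lambda>b. if b \<in> B then d b else 0)"
      using * ** by simp
    then have "\<And>b. b \<in> B \<Longrightarrow> c b = d b" by (metis (full_types))
    then show "c = d" using cd(1,2) by (intro PiE_ext) auto
  qed
  then have "card (?C B) \<le> card (?C B')"
    using \<phi>(1) fin fB by (intro card_inj_on_le[of \<phi>] finite_PiE) auto
  moreover have "CARD('k) > 1"
    using card_mono[OF fin, of "{0, 1}"] by auto
  ultimately show ?thesis using fB by (simp add: card_PiE)
qed

lemma (in place) place_degree_eq:
  assumes "finite (UNIV :: 'k set)" "residue_basis \<iota> P B"
  shows "place_degree \<iota> P = card B"
  unfolding place_degree_def
  using assms residue_basis_card_le by (intro the_equality) (auto intro!: antisym)

text \<open>Finitely many representatives span, and a minimal spanning subset of them is a basis.\<close>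

lemma (in place) residue_basis_exists:
  assumes T: "finite T" "T \<subseteq> V" "\<And>z. z \<in> V \<Longrightarrow> \<exists>\<tau>\<in>T. z - \<tau> \<in> P"
  shows "\<exists>B. residue_basis \<iota> P B"
proof -
  define spans where
    "spans B \<longleftrightarrow> B \<subseteq> T \<and> (\<forall>z\<in>V. \<exists>c. z - (\<Sum>b\<in>B. \<iota> (c b) * b) \<in> P)" for B
  have "spans T" unfolding spans_def
  proof (intro conjI ballI)
    fix z assume "z \<in> V"
    then obtain \<tau> where \<tau>: "\<tau> \<in> T" "z - \<tau> \<in> P" using T(3) by blast
    have "(\<Sum>b\<in>T. \<iota> (if b = \<tau> then 1 else 0) * b) = (\<Sum>b\<in>T. if b = \<tau> then b else 0)"
      using emb field_embedding_0[OF emb] by (intro sum.cong) (auto simp: field_embedding_def)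
    then have "(\<Sum>b\<in>T. \<iota> (if b = \<tau> then 1 else 0) * b) = \<tau>" using T(1) \<tau>(1) by simp
    then show "\<exists>c. z - (\<Sum>b\<in>T. \<iota> (c b) * b) \<in> P"
      using \<tau>(2) by (intro exI[of _ "\<lambda>b. if b = \<tau> then 1 else 0"]) simp
  qed simp
  then obtain B where B: "spans B" "\<And>B'. spans B' \<Longrightarrow> card B \<le> card B'"
    using ex_has_least_nat[of spans T card] by blast
  have fB: "finite B" using B(1) T(1) finite_subset unfolding spans_def by blast
  have BV: "B \<subseteq> V" using B(1) T(2) unfolding spans_def by blast
  have indep: "c b = 0" if c: "(\<Sum>b\<in>B. \<iota> (c b) * b) \<in> P" and b: "b \<in> B" for c b
  proof (rule ccontr)
    assume nz: "c b \<noteq> 0"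
    have "spans (B - {b})" unfolding spans_def
    proof (intro conjI ballI)
      fix z assume "z \<in> V"
      then obtain d where d: "z - (\<Sum>b\<in>B. \<iota> (d b) * b) \<in> P" using B(1) unfolding spans_def by blast
      define r where "r = d b / c b"
      define e where "e = (\<lambda>x. d x - r * c x)"
      have "(\<Sum>b\<in>B. \<iota> (e b) * b) = (\<Sum>b\<in>B. \<iota> (d b) * b) - \<iota> r * (\<Sum>b\<in>B. \<iota> (c b) * b)"
        using emb unfolding e_def
        by (simp add: field_embedding_diff sum_subtractf sum_distrib_left algebra_simps)
          (simp add: field_embedding_def mult.assoc)
      then have "z - (\<Sum>b\<in>B. \<iota> (e b) * b) =
          (z - (\<Sum>b\<in>B. \<iota> (d b) * b)) + \<iota> r * (\<Sum>b\<in>B. \<iota> (c b) * b)" by simp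
      then have "z - (\<Sum>b\<in>B. \<iota> (e b) * b) \<in> P"
        using P_add[OF d P_mult'[OF V_const c]] by metis
      moreover have "e b = 0" using nz by (simp add: e_def r_def)
      then have "(\<Sum>b\<in>B. \<iota> (e b) * b) = (\<Sum>b\<in>B - {b}. \<iota> (e b) * b)"
        using sum.remove[OF fB b, of "\<lambda>b. \<iota> (e b) * b"] const_0[of 0] by simp
      ultimately show "\<exists>e. z - (\<Sum>b\<in>B - {b}. \<iota> (e b) * b) \<in> P" by auto
    qed (use B(1) in \<open>auto simp: spans_def\<close>)
    then have "card B \<le> card (B - {b})" by (rule B(2))
    then show False using fB b by (metis card_Diff1_less leD)
  qed
  have "\<exists>!c. (\<forall>b. b \<notin> B \<longrightarrow> c b = 0) \<and> z - (\<Sum>b\<in>B. \<iota> (c b) * b) \<in> P" if z: "z \<in> V" for z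
  proof -
    obtain c where c: "z - (\<Sum>b\<in>B. \<iota> (c b) * b) \<in> P" using B(1) z unfolding spans_def by blast
    define c' where "c' = (\<lambda>b. if b \<in> B then c b else 0)"
    have c': "\<forall>b. b \<notin> B \<longrightarrow> c' b = 0" "z - (\<Sum>b\<in>B. \<iota> (c' b) * b) \<in> P"
      using c by (simp_all add: c'_def)
    have uniq: "d = c'" if d: "\<forall>b. b \<notin> B \<longrightarrow> d b = 0" "z - (\<Sum>b\<in>B. \<iota> (d b) * b) \<in> P" for d
    proof -
      have "(\<Sum>b\<in>B. \<iota> (c' b - d b) * b) = (\<Sum>b\<in>B. \<iota> (c' b) * b) - (\<Sum>b\<in>B. \<iota> (d b) * b)"
        using emb by (simp add: field_embedding_diff sum_subtractf algebra_simps)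
      then have "(\<Sum>b\<in>B. \<iota> (c' b - d b) * b) \<in> P" using P_diff[OF d(2) c'(2)] by simp
      then have "c' b - d b = 0" if "b \<in> B" for b using indep[of "\<lambda>b. c' b - d b" b] that by simp
      then show ?thesis using c'(1) d(1) by (intro ext) (metis eq_iff_diff_eq_0)
    qed
    show ?thesis
    proof (rule ex1I[of _ c'])
      fix d assume "(\<forall>b. b \<notin> B \<longrightarrow> d b = 0) \<and> z - (\<Sum>b\<in>B. \<iota> (d b) * b) \<in> P"
      then show "d = c'" by (intro uniq) simp_all
    qed (use c' in simp)
  qed
  then show ?thesis using fB BV unfolding residue_basis_def by (intro exI[of _ B] conjI ballI) auto
qed

text \<open>
  The single element \<open>b\<close> of a basis need not be a constant, but 1 is a constant multiple of it
  modulo the place.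
\<close>

lemma (in place) rational_residue:
  assumes fin: "finite (UNIV :: 'k set)" and B: "\<exists>B. residue_basis \<iota> P B"
    and deg: "place_degree \<iota> P = 1" and z: "z \<in> V"
  shows "\<exists>c. z - \<iota> c \<in> P"
proof -
  obtain B where B: "residue_basis \<iota> P B" using B by blast
  then have "card B = 1" using place_degree_eq[OF fin B] deg by simp
  then obtain b where b: "B = {b}" by (auto simp: card_1_singleton_iff)
  have span: "\<exists>c. z - \<iota> c * b \<in> P" if "z \<in> V" for z
  proof -
    have "\<exists>c. z - (\<Sum>b\<in>B. \<iota> (c b) * b) \<in> P"
      using B that unfolding residue_basis_def by blast
    then show ?thesis using b by auto
  qed
  have bV: "b \<in> V" using B b by (simp add: residue_basis_def)
  obtain e where e: "1 - \<iota> e * b \<in> P" using span V_1 by blast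
  have "e \<noteq> 0" using e P_1 const_0[of e] by auto
  obtain c where c: "z - \<iota> c * b \<in> P" using span z by blast
  have "\<iota> (c / e) * \<iota> e = \<iota> c" using \<open>e \<noteq> 0\<close> emb const_0[of e] by (simp add: field_embedding_divide)
  then have "z - \<iota> (c / e) = (z - \<iota> c * b) - \<iota> (c / e) * (1 - \<iota> e * b)"
    by (simp add: algebra_simps)
  then have "z - \<iota> (c / e) \<in> P" using P_diff[OF c P_mult'[OF V_const e]] by metis
  then show ?thesis ..
qed

lemma (in place) place_degree_1:
  assumes fin: "finite (UNIV :: 'k set)" and "\<And>z. z \<in> V \<Longrightarrow> \<exists>c. z - \<iota> c \<in> P"
  shows "place_degree \<iota> P = 1"
proof -
  have "\<exists>!c. (\<forall>b. b \<notin> {1} \<longrightarrow> c b = 0) \<and> z - (\<Sum>b\<in>{1}. \<iota> (c b) * b) \<in> P" if z: "z \<in> V" for z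
  proof -
    obtain c where c: "z - \<iota> c \<in> P" using assms(2) z by blast
    show ?thesis
    proof (rule ex1I[of _ "\<lambda>b. if b = 1 then c else 0"])
      fix d assume d: "(\<forall>b. b \<notin> {1} \<longrightarrow> d b = 0) \<and> z - (\<Sum>b\<in>{1}. \<iota> (d b) * b) \<in> P"
      then have "d 1 = c" using const_unique[of z "d 1" c] c by simp
      then show "d = (\<lambda>b. if b = 1 then c else 0)" using d by auto
    qed (use c in simp)
  qed
  then have "residue_basis \<iota> P {1}" by (simp add: residue_basis_def V_1)
  then show ?thesis using place_degree_eq[OF fin] by simp
qed


section \<open>Places above the rational function field\<close>

lemma field_embedding_rat_const: "field_embedding rat_const"
  by (auto simp: field_embedding_def rat_const_def One_fract_def one_pCons mult.commute)

lemma Fract_eq_divide: "Fract p q = Fract p 1 / Fract q 1"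
  by simp

lemma Fract_pCons: "Fract (pCons c p) 1 = rat_const c + rat_x * Fract p 1"
  by (simp add: rat_const_def rat_x_def)

text \<open>
  The embedding of the rational function field is a parameter, so that the identity gives the
  places of the rational function field itself.
\<close>

locale place_over_rational = place \<iota> P
  for \<iota> :: "'k::field \<Rightarrow> 'f::field" and P +
  fixes h :: "'k poly fract \<Rightarrow> 'f"
  assumes emb_h: "field_embedding h" and \<iota>_eq: "\<iota> = h \<circ> rat_const"
begin

abbreviation X :: 'f where "X \<equiv> h rat_x"

definition hp :: "'k poly \<Rightarrow> 'f" where "hp p = h (Fract p 1)"

lemma h_add: "h (u + w) = h u + h w" and h_mult: "h (u * w) = h u * h w" and h_1: "h 1 = 1"
  using emb_h by (auto simp: field_embedding_def)

lemma h_rat_const: "h (rat_const c) = \<iota> c"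
  by (simp add: \<iota>_eq)

lemma hp_pCons: "hp (pCons c p) = \<iota> c + X * hp p"
  by (simp add: hp_def Fract_pCons h_add h_mult h_rat_const)

lemma hp_0: "hp 0 = 0"
  using field_embedding_0[OF emb_h] by (simp add: hp_def Zero_fract_def)

lemma hp_1: "hp 1 = 1"
  using h_1 by (simp add: hp_def One_fract_def)

lemma hp_mult: "hp (p * q) = hp p * hp q"
  by (simp add: hp_def flip: h_mult)

lemma hp_add: "hp (p + q) = hp p + hp q"
  by (simp add: hp_def flip: h_add)

lemma hp_eq_0: "hp p = 0 \<longleftrightarrow> p = 0"
  using field_embedding_eq_0_iff[OF emb_h] by (simp add: hp_def Zero_fract_def eq_fract)

lemma h_Fract: "h (Fract p q) = hp p / hp q"
  unfolding hp_def Fract_eq_divide[of p q] by (rule field_embedding_divide[OF emb_h])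

lemma hp_power: "hp (p ^ n) = hp p ^ n"
  by (induction n) (simp_all add: hp_1 hp_mult)

lemma hp_linear: "hp [:- a, 1:] = X - \<iota> a"
  using emb by (simp add: hp_pCons hp_0 field_embedding_uminus) (simp add: field_embedding_def)

lemma X_minus_nonzero: "X - \<iota> a \<noteq> 0"
  using hp_eq_0[of "[:- a, 1:]"] by (simp add: hp_linear)

lemma hp_V: "X \<in> V \<Longrightarrow> hp p \<in> V"
  by (induction p) (auto simp: hp_0 hp_pCons intro!: V_0 V_add V_mult V_const)

lemma X_V: "X - \<iota> a \<in> P \<Longrightarrow> X \<in> V"
  using V_add[OF P_V V_const[of a], of "X - \<iota> a"] by simp

lemma hp_eval: assumes "X - \<iota> a \<in> P" shows "hp p - \<iota> (poly p a) \<in> P"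
proof (induction p)
  case (pCons c p)
  have "hp (pCons c p) - \<iota> (poly (pCons c p) a) =
      (X - \<iota> a) * hp p + \<iota> a * (hp p - \<iota> (poly p a))"
    using emb by (simp add: hp_pCons field_embedding_def algebra_simps)
  then show ?case
    using P_add[OF P_mult[OF assms hp_V[OF X_V[OF assms]]] P_mult'[OF V_const pCons.IH]] by metis
qed (simp add: hp_0 P_0 field_embedding_0[OF emb])

lemma hp_P_iff: assumes "X - \<iota> a \<in> P" shows "hp p \<in> P \<longleftrightarrow> poly p a = 0"
  using hp_eval[OF assms, of p] const_P[of "poly p a"]
    P_diff[of "hp p" "hp p - \<iota> (poly p a)"] P_add[of "hp p - \<iota> (poly p a)" "\<iota> (poly p a)"] by auto

lemma hp_infinite:
  assumes "X \<notin> V" "p \<noteq> 0"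
  shows "\<exists>u. u \<in> V \<and> u \<notin> P \<and> hp p = X ^ degree p * u"
  using assms(2)
proof (induction p)
  case (pCons c p)
  have X0: "X \<noteq> 0" using assms V_0 by auto
  then have inv: "inverse X \<in> P" using assms V_iff by blast
  show ?case
  proof (cases "p = 0")
    case True
    then show ?thesis using pCons.hyps const_P[of c] V_const[of c]
      by (intro exI[of _ "\<iota> c"]) (simp add: hp_pCons hp_0)
  next
    case False
    then obtain u where u: "u \<in> V" "u \<notin> P" "hp p = X ^ degree p * u" using pCons.IH by blast
    define w where "w = \<iota> c * inverse X ^ Suc (degree p)"
    have w: "w \<in> P" unfolding w_def
      using inv P_power[of "inverse X" "Suc (degree p)"] P_V by (intro P_mult' V_const) auto
    have "X ^ Suc (degree p) * w = \<iota> c"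
      using X0 by (simp add: w_def power_inverse field_simps)
    then have "hp (pCons c p) = X ^ degree (pCons c p) * (u + w)"
      using False u(3) by (simp add: hp_pCons distrib_left)
    moreover have "u + w \<in> V" "u + w \<notin> P"
      using u w V_add[OF u(1) P_V[OF w]] P_diff[of "u + w" w] by auto
    ultimately show ?thesis by blast
  qed
qed simp

lemma lies_over_finite_iff: "lies_over h P (finite_place a) \<longleftrightarrow> X - \<iota> a \<in> P"
proof
  assume "lies_over h P (finite_place a)"
  moreover have "Fract [:- a, 1:] 1 \<in> finite_place a" unfolding finite_place_def by fastforce
  ultimately have "hp [:- a, 1:] \<in> P" unfolding hp_def lies_over_def by blast
  then show "X - \<iota> a \<in> P" by (simp add: hp_linear)
next
  assume *: "X - \<iota> a \<in> P"
  have "h (Fract p q) \<in> P" if "poly p a = 0" "poly q a \<noteq> 0" for p q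
  proof -
    have "hp p \<in> P" "hp q \<in> V" "hp q \<notin> P"
      using hp_P_iff[OF *, of p] hp_P_iff[OF *, of q] hp_V[OF X_V[OF *], of q] that by auto
    then show ?thesis using unit_inverse[of "hp q"] P_mult[of "hp p" "inverse (hp q)"]
      by (simp add: h_Fract divide_inverse)
  qed
  then show "lies_over h P (finite_place a)" unfolding lies_over_def finite_place_def by blast
qed

lemma h_Fract_infinite:
  assumes "X \<notin> V" "p \<noteq> 0" "q \<noteq> 0"
  shows "\<exists>u. u \<in> V \<and> u \<notin> P \<and> h (Fract p q) = inverse X powi (int (degree q) - int (degree p)) * u"
proof -
  have X0: "X \<noteq> 0" using assms V_0 by auto
  obtain u where u: "u \<in> V" "u \<notin> P" "hp p = X ^ degree p * u" using hp_infinite assms by blast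
  obtain w where w: "w \<in> V" "w \<notin> P" "hp q = X ^ degree q * w" using hp_infinite assms by blast
  have "h (Fract p q) = inverse X powi (int (degree q) - int (degree p)) * (u * inverse w)"
    using X0 u(3) w(3) unit_nonzero[OF w(2)]
    by (simp add: h_Fract power_int_diff field_simps)
  then show ?thesis using unit_mult[of u "inverse w"] u w unit_inverse[of w] by blast
qed

lemma lies_over_infinite_iff: "lies_over h P infinite_place \<longleftrightarrow> X \<notin> V"
proof
  assume "lies_over h P infinite_place"
  moreover have "Fract 1 [:0, 1:] \<in> infinite_place" unfolding infinite_place_def by fastforce
  ultimately have "h (Fract 1 [:0, 1:]) \<in> P" unfolding lies_over_def by blast
  moreover have "hp [:0, 1:] = X" using hp_linear[of 0] field_embedding_0[OF emb] by simp
  ultimately have "inverse X \<in> P" by (simp add: h_Fract hp_1 divide_inverse)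
  then show "X \<notin> V" using V_iff[of X] X_minus_nonzero[of 0] field_embedding_0[OF emb] by auto
next
  assume *: "X \<notin> V"
  then have "X \<noteq> 0" using V_0 by auto
  then have inv: "inverse X \<in> P" using V_iff * by blast
  have "h (Fract p q) \<in> P" if "degree p < degree q" for p q
  proof (cases "p = 0")
    case True
    then show ?thesis by (simp add: h_Fract hp_0 P_0)
  next
    case False
    have "q \<noteq> 0" using that by auto
    then obtain u where u: "u \<in> V" "h (Fract p q) = inverse X powi (int (degree q) - int (degree p)) * u"
      using h_Fract_infinite[OF * False, of q] by blast
    have "inverse X powi (int (degree q) - int (degree p)) \<in> P"
      using that inv P_power[of "inverse X" "degree q - degree p"] P_V[OF inv]
      by (simp add: power_int_def nat_diff_distrib)
    then show ?thesis using u P_mult by simp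
  qed
  then show "lies_over h P infinite_place" unfolding lies_over_def infinite_place_def by blast
qed

text \<open>
  The restriction of a place to the rational function field is discrete: its prime element is
  \<open>1 / x\<close> if \<open>x\<close> has a pole, and otherwise a polynomial of least degree in the place.
\<close>

definition minimal :: "'k poly \<Rightarrow> bool" where
  "minimal p0 \<longleftrightarrow> p0 \<noteq> 0 \<and> hp p0 \<in> P \<and> (\<forall>p. p \<noteq> 0 \<longrightarrow> hp p \<in> P \<longrightarrow> degree p0 \<le> degree p)"

lemma minimal_exists:
  assumes XV: "X \<in> V" and nt: "\<exists>z. h z \<notin> V"
  shows "\<exists>p0. minimal p0"
proof -
  obtain z where z: "h z \<notin> V" using nt by blast
  obtain p q where pq: "z = Fract p q" "q \<noteq> 0" by (cases z) auto
  have "hp q \<in> P"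
  proof (rule ccontr)
    assume "hp q \<notin> P"
    then have "hp p * inverse (hp q) \<in> V" using hp_V[OF XV] unit_inverse[of "hp q"] V_mult by blast
    then show False using z by (simp add: pq h_Fract divide_inverse)
  qed
  then show ?thesis
    using ex_has_least_nat[of "\<lambda>p. p \<noteq> 0 \<and> hp p \<in> P" q degree] pq(2) unfolding minimal_def by blast
qed

lemma minimal_degree_pos: assumes "minimal p0" shows "degree p0 > 0"
proof (rule ccontr)
  assume "\<not> degree p0 > 0"
  then obtain c where "p0 = [:c:]" using degree_eq_zeroE by blast
  then show False using assms const_P[of c] by (auto simp: minimal_def hp_pCons hp_0)
qed

lemma minimal_mod:
  assumes XV: "X \<in> V" and p0: "minimal p0"
  shows "hp p - hp (p mod p0) \<in> P" "p mod p0 = 0 \<or> degree (p mod p0) < degree p0"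
proof -
  have "p = p0 * (p div p0) + p mod p0" by simp
  then have "hp p = hp p0 * hp (p div p0) + hp (p mod p0)" by (metis hp_add hp_mult)
  then show "hp p - hp (p mod p0) \<in> P"
    using P_mult[OF _ hp_V[OF XV], of "hp p0"] p0 by (simp add: minimal_def)
  show "p mod p0 = 0 \<or> degree (p mod p0) < degree p0"
    using degree_mod_less[of p0 p] p0 by (auto simp: minimal_def)
qed

lemma minimal_dvd:
  assumes XV: "X \<in> V" and p0: "minimal p0" and p: "hp p \<in> P"
  shows "p0 dvd p"
proof -
  have "hp (p mod p0) \<in> P" using P_diff[OF p minimal_mod(1)[OF XV p0, of p]] by simp
  then have "p mod p0 = 0"
    using p0 minimal_mod(2)[OF XV p0, of p] unfolding minimal_def by (metis leD)
  then show ?thesis by (simp add: mod_eq_0_iff_dvd)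
qed

lemma restriction_decomp_poly:
  assumes XV: "X \<in> V" and p0: "minimal p0" and p: "p \<noteq> 0"
  shows "\<exists>k u. u \<in> V \<and> u \<notin> P \<and> hp p = hp p0 ^ k * u"
  using p
proof (induction "degree p" arbitrary: p rule: less_induct)
  case less
  show ?case
  proof (cases "hp p \<in> P")
    case False
    then show ?thesis using hp_V[OF XV, of p] by (intro exI[of _ 0] exI[of _ "hp p"]) simp
  next
    case True
    then obtain q where pq: "p = p0 * q" using minimal_dvd[OF XV p0] by (metis dvdE)
    then have "q \<noteq> 0" "p0 \<noteq> 0" using less.prems by auto
    then have "degree q < degree p" using pq minimal_degree_pos[OF p0] by (simp add: degree_mult_eq)
    then obtain k u where "u \<in> V" "u \<notin> P" "hp q = hp p0 ^ k * u"
      using less.hyps \<open>q \<noteq> 0\<close> by blast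
    then show ?thesis by (intro exI[of _ "Suc k"] exI[of _ u]) (simp add: pq hp_mult mult.assoc)
  qed
qed

text \<open>A fraction of least denominator degree has no common factor in the place to cancel.\<close>

lemma integral_fraction:
  assumes XV: "X \<in> V" and nt: "\<exists>z. h z \<notin> V" and z: "h z \<in> V"
  shows "\<exists>p q. z = Fract p q \<and> hp q \<notin> P"
proof -
  obtain p0 where p0: "minimal p0" using minimal_exists[OF XV nt] by blast
  define good where "good = (\<lambda>q. q \<noteq> 0 \<and> (\<exists>p. z = Fract p q))"
  obtain p1 q1 where "z = Fract p1 q1" "q1 \<noteq> 0" by (cases z) auto
  then have "good q1" by (auto simp: good_def)
  then obtain q where q: "good q" "\<And>q'. good q' \<Longrightarrow> degree q \<le> degree q'"
    using ex_has_least_nat[of good q1 degree] by blast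
  then obtain p where p: "z = Fract p q" "q \<noteq> 0" by (auto simp: good_def)
  have "hp q \<notin> P"
  proof
    assume qP: "hp q \<in> P"
    have "hp p = h z * hp q" using p hp_eq_0[of q] by (simp add: h_Fract)
    then have "hp p \<in> P" using qP z P_mult' by simp
    then have "p0 dvd p" "p0 dvd q" using minimal_dvd[OF XV p0] qP by simp_all
    then obtain p' q' where p': "p = p0 * p'" "q = p0 * q'" by (elim dvdE)
    then have nz: "q' \<noteq> 0" "p0 \<noteq> 0" using p by auto
    then have "good q'" using p p' by (auto simp: good_def eq_fract intro!: exI[of _ p'])
    then have "degree q \<le> degree q'" by (rule q(2))
    then show False using p' nz minimal_degree_pos[OF p0] by (simp add: degree_mult_eq)
  qed
  then show ?thesis using p by blast
qed

lemma restriction_decomp_quotient: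
  assumes p0: "hp p0 \<noteq> 0"
    and dec: "\<And>p. p \<noteq> 0 \<Longrightarrow> \<exists>k u. u \<in> V \<and> u \<notin> P \<and> hp p = hp p0 ^ k * u" and z: "z \<noteq> 0"
  shows "\<exists>k u. u \<in> V \<and> u \<notin> P \<and> h z = hp p0 powi k * u"
proof -
  obtain p q where pq: "z = Fract p q" "q \<noteq> 0" by (cases z) auto
  then have "p \<noteq> 0" using z by (auto simp: Zero_fract_def eq_fract)
  obtain k u where u: "u \<in> V" "u \<notin> P" "hp p = hp p0 ^ k * u" using dec[OF \<open>p \<noteq> 0\<close>] by blast
  obtain l w where w: "w \<in> V" "w \<notin> P" "hp q = hp p0 ^ l * w" using dec[OF \<open>q \<noteq> 0\<close>] by blast
  have "h z = hp p0 powi (int k - int l) * (u * inverse w)"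
    using p0 u(3) w(3) unit_nonzero[OF w(2)] by (simp add: pq h_Fract power_int_diff field_simps)
  then show ?thesis using unit_mult[of u "inverse w"] u w unit_inverse[of w] by blast
qed

lemma restriction_decomp:
  assumes nt: "\<exists>z. h z \<notin> V"
  shows "\<exists>t. t \<noteq> 0 \<and> h t \<in> P \<and> (\<forall>z. z \<noteq> 0 \<longrightarrow> (\<exists>k u. u \<in> V \<and> u \<notin> P \<and> h z = h t powi k * u))"
proof (cases "X \<in> V")
  case True
  obtain p0 where p0: "minimal p0" using minimal_exists[OF True nt] by blast
  then have p0': "p0 \<noteq> 0" "hp p0 \<in> P" by (auto simp: minimal_def)
  have "\<exists>k u. u \<in> V \<and> u \<notin> P \<and> h z = hp p0 powi k * u" if "z \<noteq> 0" for z
    using restriction_decomp_quotient[OF _ restriction_decomp_poly[OF True p0]] hp_eq_0[of p0] p0'(1) that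
    by blast
  moreover have "Fract p0 1 \<noteq> 0" using p0'(1) by (simp add: Zero_fract_def eq_fract)
  ultimately show ?thesis using p0'(2) unfolding hp_def by blast
next
  case False
  then have X0: "X \<noteq> 0" using V_0 by auto
  then have "inverse X \<in> P" using False V_iff by blast
  moreover have "\<exists>k u. u \<in> V \<and> u \<notin> P \<and> h z = inverse X powi k * u" if "z \<noteq> 0" for z
  proof -
    obtain p q where pq: "z = Fract p q" "q \<noteq> 0" by (cases z) auto
    then have "p \<noteq> 0" using that by (auto simp: Zero_fract_def eq_fract)
    then show ?thesis using h_Fract_infinite[OF False, of p q] pq by blast
  qed
  moreover have "h (inverse rat_x) = inverse X" by (rule field_embedding_inverse[OF emb_h])
  moreover have "inverse rat_x \<noteq> (0 :: 'k poly fract)"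
    using X0 field_embedding_0[OF emb_h] by auto
  ultimately show ?thesis by (intro exI[of _ "inverse rat_x"]) auto
qed

lemma restriction_residue_finite:
  assumes fin: "finite (UNIV :: 'k set)" and XV: "X \<in> V" and nt: "\<exists>z. h z \<notin> V"
  shows "\<exists>T. finite T \<and> T \<subseteq> V \<and> (\<forall>z. h z \<in> V \<longrightarrow> (\<exists>\<tau>\<in>T. h z - \<tau> \<in> P))"
proof -
  obtain p0 where p0: "minimal p0" using minimal_exists[OF XV nt] by blast
  define D where "D = {p :: 'k poly. p = 0 \<or> degree p < degree p0}"
  have "finite D"
  proof -
    have "D \<subseteq> Poly ` {cs. set cs \<subseteq> UNIV \<and> length cs \<le> degree p0}"
    proof
      fix p assume "p \<in> D"
      then have "length (coeffs p) \<le> degree p0"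
        by (cases "p = 0") (auto simp: D_def length_coeffs_degree)
      then show "p \<in> Poly ` {cs. set cs \<subseteq> UNIV \<and> length cs \<le> degree p0}"
        by (intro image_eqI[of _ _ "coeffs p"]) auto
    qed
    then show ?thesis using finite_lists_length_le[OF fin] finite_subset by blast
  qed
  define \<rho> where "\<rho> p = p mod p0" for p
  have \<rho>: "hp p - hp (\<rho> p) \<in> P" "\<rho> p \<in> D" for p
    using minimal_mod[OF XV p0, of p] by (auto simp: \<rho>_def D_def)
  \<comment> \<open>The residue class of a polynomial outside the place is a root of unity, because it has
     only finitely many powers; its inverse is therefore the class of a polynomial.\<close>
  have inv: "\<exists>n. 1 - hp q * hp (q ^ n) \<in> P" if q: "hp q \<notin> P" for q
  proof -
    have "\<not> inj (\<lambda>n. \<rho> (q ^ n))"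
      using \<open>finite D\<close> \<rho>(2) finite_imageD[of "\<lambda>n. \<rho> (q ^ n)" UNIV] finite_subset[of _ D]
      by (metis image_subsetI infinite_UNIV_nat)
    then obtain i j where "i \<noteq> j" "\<rho> (q ^ i) = \<rho> (q ^ j)" unfolding inj_def by blast
    then obtain i j where ij: "i < j" "\<rho> (q ^ i) = \<rho> (q ^ j)" by (metis linorder_neqE_nat)
    have "hp (q ^ i) - hp (q ^ j) \<in> P"
      using P_diff[OF \<rho>(1)[of "q ^ i"] \<rho>(1)[of "q ^ j"]] ij by simp
    moreover have "q ^ j = q ^ i * q ^ (j - i)" using ij by (simp flip: power_add)
    then have "hp (q ^ i) - hp (q ^ j) = hp q ^ i * (1 - hp (q ^ (j - i)))"
      by (simp add: hp_mult hp_power algebra_simps)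
    moreover have "hp q ^ i \<notin> P" using unit_power[of "hp q" i] hp_V[OF XV] q by blast
    ultimately have "1 - hp (q ^ (j - i)) \<in> P"
      using P_prime[of "hp q ^ i" "1 - hp (q ^ (j - i))"] hp_V[OF XV] V_power V_diff V_1 by metis
    moreover have "q ^ (j - i) = q * q ^ (j - i - 1)" using ij by (simp add: power_eq_if)
    ultimately show ?thesis by (metis hp_mult)
  qed
  have "\<exists>\<tau>\<in>hp ` D. h z - \<tau> \<in> P" if z: "h z \<in> V" for z
  proof -
    obtain p q where pq: "z = Fract p q" "hp q \<notin> P" using integral_fraction[OF XV nt z] by blast
    obtain n where n: "1 - hp q * hp (q ^ n) \<in> P" using inv[OF pq(2)] by blast
    define r where "r = \<rho> (p * q ^ n)"
    have "hp q \<noteq> 0" using pq P_0 by auto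
    then have "h z - hp r = h z * (1 - hp q * hp (q ^ n)) + (hp (p * q ^ n) - hp r)"
      using pq by (simp add: h_Fract hp_mult field_simps)
    then have "h z - hp r \<in> P" using P_add[OF P_mult'[OF z n] \<rho>(1)] unfolding r_def by metis
    then show ?thesis using \<rho>(2) unfolding r_def by blast
  qed
  then show ?thesis using \<open>finite D\<close> hp_V[OF XV] by (intro exI[of _ "hp ` D"]) auto
qed

lemma restriction_place: assumes nt: "\<exists>z. h z \<notin> V" shows "h -` P \<in> places rat_const"
proof -
  have inv: "h (inverse z) = inverse (h z)" for z by (rule field_embedding_inverse[OF emb_h])
  have vr: "valuation_ring rat_const (h -` V)"
    unfolding valuation_ring_def is_subring_def
  proof (intro conjI ballI allI)
    show "range rat_const \<subset> h -` V"
    proof (rule psubsetI)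
      show "range rat_const \<noteq> h -` V"
      proof
        assume eq: "range rat_const = h -` V"
        have "rat_x \<in> h -` V \<or> inverse rat_x \<in> h -` V" using V_total[of X] by (simp add: inv)
        then obtain c :: 'k where "rat_x = rat_const c \<or> inverse rat_x = rat_const c"
          unfolding eq[symmetric] by blast
        moreover have "rat_const (inverse c) = inverse (rat_const c)"
          by (rule field_embedding_inverse[OF field_embedding_rat_const])
        ultimately obtain d :: 'k where "rat_x = rat_const d" by (metis inverse_inverse_eq)
        then have "h rat_x = h (rat_const d)" by (rule arg_cong)
        then show False using X_minus_nonzero[of d] h_rat_const[of d] by simp
      qed
    qed (use V_const in \<open>auto simp: h_rat_const\<close>)
    show "h -` V \<subset> UNIV" using nt by blast
  qed (use V_0 V_1 V_add V_diff V_mult V_total field_embedding_0[OF emb_h] in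
      \<open>auto simp: h_1 h_add h_mult field_embedding_diff[OF emb_h] inv\<close>)
  have "h -` P = h -` V - unit_group (h -` V)"
  proof (intro set_eqI iffI)
    fix z assume z: "z \<in> h -` P"
    then have "z \<in> h -` V" using P_V by simp
    moreover have "z \<notin> unit_group (h -` V)"
    proof
      assume "z \<in> unit_group (h -` V)"
      then obtain w where "h w \<in> V" "z * w = 1" by (auto simp: unit_group_def)
      then have "h z * h w = 1" using h_mult[of z w] h_1 by simp
      then show False using P_mult[of "h z" "h w"] z \<open>h w \<in> V\<close> P_1 by simp
    qed
    ultimately show "z \<in> h -` V - unit_group (h -` V)" by simp
  next
    fix z assume z: "z \<in> h -` V - unit_group (h -` V)"
    show "z \<in> h -` P"
    proof (rule ccontr)
      assume "z \<notin> h -` P"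
      then have "inverse (h z) \<in> V" "h z \<noteq> 0" using z unit_inverse P_0 by auto
      then have "h (inverse z) \<in> V" "z * inverse z = 1"
        using field_embedding_eq_0_iff[OF emb_h, of z] by (simp_all add: inv)
      then have "z \<in> unit_group (h -` V)" using z unfolding unit_group_def by blast
      then show False using z by simp
    qed
  qed
  then show ?thesis using vr unfolding places_def by blast
qed

end

lemma place_over_rational_id:
  "P \<in> places rat_const \<Longrightarrow> place_over_rational rat_const P (\<lambda>z. z)"
  by unfold_locales (auto simp: field_embedding_rat_const, simp add: field_embedding_def)

lemma finite_place_eqI:
  assumes P: "P \<in> places rat_const" and a: "rat_x - rat_const a \<in> P"
  shows "P = finite_place a"
proof -
  interpret place_over_rational rat_const P "\<lambda>z. z" using P by (rule place_over_rational_id)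
  have "finite_place a \<subseteq> P" using lies_over_finite_iff[of a] a by (simp add: lies_over_def)
  moreover have "z \<in> finite_place a" if z: "z \<in> P" for z
  proof -
    obtain p q where pq: "z = Fract p q" "hp q \<notin> P"
      using integral_fraction[OF X_V[OF a]] V_proper P_V[OF z] by blast
    have "hp q \<noteq> 0" using pq P_0 by auto
    then have "hp p = z * hp q" using pq h_Fract[of p q] by simp
    then have "hp p \<in> P" using P_mult[OF z hp_V[OF X_V[OF a]]] by simp
    then show ?thesis using pq hp_P_iff[OF a] unfolding finite_place_def by blast
  qed
  ultimately show ?thesis by blast
qed

lemma infinite_place_eqI:
  assumes P: "P \<in> places rat_const" and x: "rat_x \<notin> place_ring P"
  shows "P = infinite_place"
proof -
  interpret place_over_rational rat_const P "\<lambda>z. z" using P by (rule place_over_rational_id)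
  have "infinite_place \<subseteq> P" using lies_over_infinite_iff x by (simp add: lies_over_def)
  moreover have "z \<in> infinite_place" if z: "z \<in> P" for z
  proof -
    obtain p q where pq: "z = Fract p q" "q \<noteq> 0" by (cases z) auto
    show ?thesis
    proof (cases "p = 0")
      case True
      then have "z = Fract 0 [:0, 1:]" using pq by (simp add: eq_fract)
      moreover have "degree (0 :: 'a poly) < degree [:0, 1 :: 'a:]" by simp
      ultimately show ?thesis unfolding infinite_place_def by blast
    next
      case False
      have "degree p < degree q"
      proof (rule ccontr)
        assume le: "\<not> degree p < degree q"
        have x0: "rat_x \<noteq> (0 :: 'a poly fract)" using x V_0 by auto
        then have inv: "inverse rat_x \<in> V" using x V_total by blast
        obtain u where u: "u \<in> V" "u \<notin> P"
            "Fract p q = inverse rat_x powi (int (degree q) - int (degree p)) * u"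
          using h_Fract_infinite[OF x False pq(2)] by auto
        have "inverse rat_x powi (int (degree p) - int (degree q)) \<in> V"
          using le V_power[OF inv] by (simp add: power_int_def)
        then have "z * inverse rat_x powi (int (degree p) - int (degree q)) \<in> P" using z P_mult by blast
        moreover have "inverse rat_x powi (int (degree q) - int (degree p)) *
            inverse rat_x powi (int (degree p) - int (degree q)) = (1 :: 'a poly fract)"
          using x0 by (simp flip: power_int_add)
        ultimately have "u \<in> P" using u(3) pq(1) by (simp add: mult_ac)
        then show False using u by simp
      qed
      then show ?thesis using pq unfolding infinite_place_def by blast
    qed
  qed
  ultimately show ?thesis by blast
qed

lemma rational_place_rat_cases:
  fixes P :: "'k::{field,finite} poly fract set"
  assumes "rational_place rat_const P"
  shows "P = infinite_place \<or> (\<exists>c. P = finite_place c)"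
proof -
  have P: "P \<in> places rat_const" and deg: "place_degree rat_const P = 1"
    using assms by (auto simp: rational_place_def)
  interpret place_over_rational rat_const P "\<lambda>z. z" using P by (rule place_over_rational_id)
  show ?thesis
  proof (cases "rat_x \<in> V")
    case True
    have "\<exists>T. finite T \<and> T \<subseteq> V \<and> (\<forall>z. z \<in> V \<longrightarrow> (\<exists>\<tau>\<in>T. z - \<tau> \<in> P))"
      using restriction_residue_finite True V_proper by simp
    then have "\<exists>B. residue_basis rat_const P B" using residue_basis_exists by blast
    then obtain c where "rat_x - rat_const c \<in> P" using rational_residue[OF _ _ deg True] by auto
    then show ?thesis using finite_place_eqI[OF P] by blast
  qed (use infinite_place_eqI[OF P] in blast)
qed

lemma discrete_place_rational: "P \<in> places rat_const \<Longrightarrow> discrete_place rat_const P"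
proof -
  assume P: "P \<in> places rat_const"
  interpret place_over_rational rat_const P "\<lambda>z. z" using P by (rule place_over_rational_id)
  show ?thesis by unfold_locales (use restriction_decomp V_proper in blast)
qed

section \<open>Radical extensions of the rational function field\<close>

text \<open>
  Every element is a polynomial of degree less than \<open>m\<close> in \<open>y\<close>. These powers need not be
  independent at this level of generality; for a Kummer curve, independence will be a consequence
  of total ramification at infinity.
\<close>

locale radical_extension =
  fixes h :: "'k::field poly fract \<Rightarrow> 'f::field" and y :: 'f and m :: nat
  assumes emb_h: "field_embedding h" and m_pos: "m > 0" and y_pow: "y ^ m \<in> range h"
    and gen: "generated_field (range h \<union> {y}) = UNIV"
begin

lemma hom_add: "h (u + w) = h u + h w" and hom_mult: "h (u * w) = h u * h w" and hom_1: "h 1 = 1"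
  using emb_h by (auto simp: field_embedding_def)

lemma hom_0: "h 0 = 0"
  by (rule field_embedding_0[OF emb_h])

sublocale vs: vector_space "\<lambda>c z. h c * z"
  by unfold_locales (auto simp: hom_add hom_mult hom_1 algebra_simps)

declare vs.scale_scale [simp del] vs.scale_right_distrib [simp del] vs.scale_left_distrib [simp del]

definition y_span :: "'f set" where "y_span = vs.span ((\<lambda>i. y ^ i) ` {..<m})"

lemma y_span_power: "y ^ n \<in> y_span"
proof -
  obtain b where b: "y ^ m = h b" using y_pow by blast
  have "y ^ n = (y ^ m) ^ (n div m) * y ^ (n mod m)" by (simp flip: power_mult power_add)
  then have "y ^ n = h (b ^ (n div m)) * y ^ (n mod m)" by (simp add: b field_embedding_power[OF emb_h])
  moreover have "y ^ (n mod m) \<in> y_span"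
    using m_pos unfolding y_span_def by (intro vs.span_base) auto
  ultimately show ?thesis unfolding y_span_def by (metis vs.span_scale)
qed

lemma y_span_mult: assumes "z \<in> y_span" "w \<in> y_span" shows "z * w \<in> y_span"
proof -
  have pow: "z * y ^ j \<in> y_span" for j
    using assms(1) unfolding y_span_def
  proof (induction rule: vs.span_induct)
    case base
    show ?case unfolding vs.subspace_def
      by (auto simp: distrib_right mult.assoc vs.span_zero intro: vs.span_add vs.span_scale)
  next
    case (step x)
    then show ?case using y_span_power unfolding y_span_def by (auto simp flip: power_add)
  qed
  show ?thesis
    using assms(2) unfolding y_span_def
  proof (induction rule: vs.span_induct)
    case base
    show ?case unfolding vs.subspace_def
      by (auto simp: distrib_left mult.left_commute[of z] vs.span_zero
          intro: vs.span_add vs.span_scale)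
  next
    case (step x)
    then show ?case using pow unfolding y_span_def by auto
  qed
qed

lemma y_span_const: "h c \<in> y_span"
  using vs.span_scale[of "y ^ 0" "(\<lambda>i. y ^ i) ` {..<m}" c] y_span_power[of 0]
  unfolding y_span_def by simp

lemma y_span_pow: "z \<in> y_span \<Longrightarrow> z ^ n \<in> y_span"
  using y_span_const[of 1] by (induction n) (auto simp: hom_1 y_span_mult)

text \<open>The \<open>m + 1\<close> powers of \<open>z\<close> lie in a space spanned by \<open>m\<close> elements.\<close>

lemma algebraic_relation_span:
  assumes "z \<in> y_span"
  shows "\<exists>c. (\<exists>i\<le>m. c i \<noteq> 0) \<and> (\<Sum>i\<le>m. h (c i) * z ^ i) = 0"
proof (cases "inj_on (\<lambda>i. z ^ i) {..m}")
  case False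
  then obtain i j where ij: "i \<le> m" "j \<le> m" "i \<noteq> j" "z ^ i = z ^ j" by (auto simp: inj_on_def)
  define c where "c = (\<lambda>l. if l = i then 1 else if l = j then - 1 else 0 :: 'k poly fract)"
  have "(\<Sum>l\<le>m. h (c l) * z ^ l) = (\<Sum>l\<in>{i, j}. h (c l) * z ^ l)"
    using ij by (intro sum.mono_neutral_right) (auto simp: c_def hom_0)
  also have "\<dots> = 0"
    using ij by (simp add: c_def hom_1 field_embedding_uminus[OF emb_h])
  finally show ?thesis using ij by (intro exI[of _ c]) (auto simp: c_def)
next
  case True
  let ?S = "(\<lambda>i. z ^ i) ` {..m}"
  have "vs.dependent ?S"
  proof (rule ccontr)
    assume "\<not> vs.dependent ?S"
    then have "card ?S \<le> card ((\<lambda>i. y ^ i) ` {..<m})"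
      using vs.independent_span_bound[of "(\<lambda>i. y ^ i) ` {..<m}" ?S] y_span_pow[OF assms]
      unfolding y_span_def by blast
    also have "\<dots> \<le> m" using card_image_le[of "{..<m}" "\<lambda>i. y ^ i"] by simp
    finally show False using card_image[OF True] by simp
  qed
  then obtain u where u: "\<exists>v\<in>?S. u v \<noteq> 0" "(\<Sum>v\<in>?S. h (u v) * v) = 0"
    using vs.dependent_finite[of ?S] by auto
  then have "(\<Sum>i\<le>m. h (u (z ^ i)) * z ^ i) = 0" using sum.reindex[OF True, of "\<lambda>v. h (u v) * v"] by simp
  then show ?thesis using u(1) by (intro exI[of _ "\<lambda>i. u (z ^ i)"]) auto
qed

text \<open>
  After division by the lowest power of \<open>z\<close> that occurs, a relation has a nonzero constant term and
  can be solved for the inverse of \<open>z\<close>.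
\<close>

lemma y_span_inverse: assumes z: "z \<in> y_span" shows "inverse z \<in> y_span"
proof (cases "z = 0")
  case True
  then show ?thesis using z by simp
next
  case False
  obtain c where c: "\<exists>i. i \<le> m \<and> c i \<noteq> 0" "(\<Sum>i\<le>m. h (c i) * z ^ i) = 0"
    using algebraic_relation_span[OF z] by blast
  define j where "j = (LEAST i. i \<le> m \<and> c i \<noteq> 0)"
  have j: "j \<le> m" "c j \<noteq> 0" using LeastI_ex[OF c(1)] by (auto simp: j_def)
  have lt: "c i = 0" if "i < j" for i using not_less_Least[of i] that j(1) unfolding j_def by force
  define r where "r = (\<Sum>i\<in>{j<..m}. h (c i) * z ^ (i - j - 1))"
  have "r \<in> y_span" unfolding r_def
  proof -
    have "h (c i) * z ^ (i - j - 1) \<in> y_span" for i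
      using y_span_mult y_span_const y_span_pow[OF z] by blast
    then show "(\<Sum>i\<in>{j<..m}. h (c i) * z ^ (i - j - 1)) \<in> y_span"
      unfolding y_span_def by (intro vs.span_sum) auto
  qed
  have "(\<Sum>i\<le>m. h (c i) * z ^ i) = (\<Sum>i\<in>{j..m}. h (c i) * z ^ i)"
    using lt by (intro sum.mono_neutral_right) (auto simp: hom_0)
  also have "\<dots> = h (c j) * z ^ j + (\<Sum>i\<in>{j<..m}. h (c i) * z ^ i)"
    using j(1) by (simp add: sum.head)
  also have "(\<Sum>i\<in>{j<..m}. h (c i) * z ^ i) = z ^ j * (z * r)"
    unfolding r_def sum_distrib_left
  proof (rule sum.cong)
    fix i assume "i \<in> {j<..m}"
    then have "i = j + Suc (i - j - 1)" by simp
    then have "z ^ i = z ^ j * (z * z ^ (i - j - 1))" by (metis power_add power_Suc)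
    then show "h (c i) * z ^ i = z ^ j * (z * (h (c i) * z ^ (i - j - 1)))" by (simp add: mult_ac)
  qed simp
  finally have "z ^ j * (h (c j) + z * r) = 0" using c(2) by (simp add: algebra_simps)
  then have "z * r = - h (c j)" using False by (simp add: add_eq_0_iff2)
  moreover have "h (c j) \<noteq> 0" using j(2) field_embedding_eq_0_iff[OF emb_h] by simp
  moreover have "z * (h (- inverse (c j)) * r) = h (- inverse (c j)) * (z * r)"
    by (simp only: mult.left_commute)
  ultimately have "z * (h (- inverse (c j)) * r) = 1"
    by (simp add: field_embedding_uminus[OF emb_h] field_embedding_inverse[OF emb_h])
  then have "inverse z = h (- inverse (c j)) * r" by (rule inverse_unique)
  then show ?thesis using y_span_mult[OF y_span_const \<open>r \<in> y_span\<close>] by metis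
qed

lemma y_span_UNIV: "y_span = UNIV"
proof -
  have "is_subfield y_span"
    unfolding is_subfield_def is_subring_def
    using y_span_const[of 0] y_span_const[of 1] y_span_mult y_span_inverse
    unfolding y_span_def by (auto simp: hom_0 hom_1 intro: vs.span_add vs.span_diff)
  moreover have "range h \<union> {y} \<subseteq> y_span" using y_span_const y_span_power[of 1] by auto
  ultimately have "generated_field (range h \<union> {y}) \<subseteq> y_span" unfolding generated_field_def by blast
  then show ?thesis using gen by auto
qed

lemma expansion: "\<exists>c. z = (\<Sum>i<m. h (c i) * y ^ i)"
proof -
  define E where "E = (\<lambda>c. \<Sum>i<m. h (c i) * y ^ i)"
  have "vs.span ((\<lambda>i. y ^ i) ` {..<m}) \<subseteq> range E"
  proof (rule vs.span_minimal)
    show "(\<lambda>i. y ^ i) ` {..<m} \<subseteq> range E"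
    proof
      fix w assume "w \<in> (\<lambda>i. y ^ i) ` {..<m}"
      then obtain j where j: "j < m" "w = y ^ j" by auto
      have "(\<Sum>i<m. h (if i = j then 1 else 0) * y ^ i) = (\<Sum>i<m. if i = j then y ^ i else 0)"
        by (intro sum.cong) (auto simp: hom_0 hom_1)
      also have "\<dots> = w" using j by simp
      finally have "E (\<lambda>i. if i = j then 1 else 0) = w" by (simp add: E_def)
      then show "w \<in> range E" by (metis rangeI)
    qed
    show "vs.subspace (range E)"
      unfolding vs.subspace_def
    proof (intro conjI ballI allI)
      have "E (\<lambda>_. 0) = 0" by (simp add: E_def hom_0)
      then show "0 \<in> range E" by (metis rangeI)
    next
      fix u w assume uw: "u \<in> range E" "w \<in> range E"
      obtain c where c: "u = E c" using uw(1) by (rule rangeE)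
      obtain d where d: "w = E d" using uw(2) by (rule rangeE)
      have "E c + E d = E (\<lambda>i. c i + d i)" by (simp add: E_def hom_add distrib_right sum.distrib)
      then show "u + w \<in> range E" using c d by simp
    next
      fix b u assume "u \<in> range E"
      then obtain c where c: "u = E c" by (rule rangeE)
      have "h b * E c = E (\<lambda>i. b * c i)"
        unfolding E_def sum_distrib_left by (rule sum.cong) (simp_all add: hom_mult)
      then show "h b * u \<in> range E" using c by simp
    qed
  qed
  moreover have "z \<in> vs.span ((\<lambda>i. y ^ i) ` {..<m})" using y_span_UNIV unfolding y_span_def by blast
  ultimately obtain c where "z = E c" by blast
  then show ?thesis unfolding E_def by blast
qed

text \<open>
  In an algebraic relation for \<open>z\<close> two terms must be equivalent, so that a power of \<open>z\<close> with
  exponent at most \<open>m\<close> agrees, up to a unit, with a rational function. Raising this to the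
  common exponent \<open>m!\<close> embeds the value group into that of the rational function field.
\<close>

lemma power_equivalent_to_rational:
  assumes S: "place_over_rational \<iota> S h" and z: "z \<noteq> 0"
  shows "\<exists>k c u. 0 < k \<and> k \<le> m \<and> c \<noteq> 0 \<and> u \<in> place_ring S \<and> u \<notin> S \<and> z ^ k = h c * u"
proof -
  interpret place_over_rational \<iota> S h by (rule S)
  have nz: "h c \<noteq> 0 \<longleftrightarrow> c \<noteq> 0" for c using field_embedding_eq_0_iff[OF emb_h] by simp
  obtain c where c: "\<exists>i\<le>m. c i \<noteq> 0" "(\<Sum>i\<le>m. h (c i) * z ^ i) = 0"
    using algebraic_relation_span y_span_UNIV by blast
  have "\<exists>i\<in>{..m}. h (c i) * z ^ i \<noteq> 0" using c(1) z nz by auto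
  from vanishing_sum_two_equivalent[OF _ c(2) this] obtain i j where ij: "i \<le> m" "j \<le> m" "i \<noteq> j"
      "c i \<noteq> 0" "c j \<noteq> 0" "(h (c i) * z ^ i) / (h (c j) * z ^ j) \<in> V"
      "(h (c i) * z ^ i) / (h (c j) * z ^ j) \<notin> S"
    using field_embedding_eq_0_iff[OF emb_h] by auto
  have main: ?thesis if ij: "i \<le> m" "j < i" "c i \<noteq> 0" "c j \<noteq> 0"
      "u = (h (c i) * z ^ i) / (h (c j) * z ^ j)" "u \<in> V" "u \<notin> S" for i j u
  proof -
    have "z ^ i = z ^ j * z ^ (i - j)" using ij by (simp flip: power_add)
    then have "u = h (c i) * z ^ (i - j) / h (c j)" using ij z by simp
    then have "z ^ (i - j) = (h (c j) / h (c i)) * u" using ij nz by simp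
    then have "z ^ (i - j) = h (c j / c i) * u" by (simp only: field_embedding_divide[OF emb_h])
    then show ?thesis using ij by (intro exI[of _ "i - j"] exI[of _ "c j / c i"] exI[of _ u]) simp
  qed
  show ?thesis
  proof (cases "j < i")
    case True
    then show ?thesis using main[OF ij(1) True ij(4,5) refl ij(6,7)] by simp
  next
    case False
    then have "i < j" using ij(3) by simp
    moreover have "(h (c j) * z ^ j) / (h (c i) * z ^ i) = inverse ((h (c i) * z ^ i) / (h (c j) * z ^ j))"
      by simp
    ultimately show ?thesis using main[OF ij(2) _ ij(5,4)] unit_inverse[OF ij(6,7)] by metis
  qed
qed

lemma place_nontrivial:
  assumes S: "place_over_rational \<iota> S h"
  shows "\<exists>z. h z \<notin> place_ring S"
proof (rule ccontr)
  interpret place_over_rational \<iota> S h by (rule S)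
  assume all: "\<not> ?thesis"
  obtain z where z: "z \<notin> V" using V_proper by blast
  then have "z \<noteq> 0" using V_0 by auto
  then obtain k c u where k: "0 < k" "u \<in> V" "z ^ k = h c * u"
    using power_equivalent_to_rational[OF S] by blast
  then have "z ^ k \<in> V" using all V_mult by simp
  then show False using V_power_iff[OF k(1)] z by blast
qed

lemma discrete_place_extension:
  assumes S: "place_over_rational \<iota> S h"
  shows "discrete_place \<iota> S"
proof -
  interpret place_over_rational \<iota> S h by (rule S)
  obtain t where t: "t \<noteq> 0" "h t \<in> S" "\<And>z. z \<noteq> 0 \<Longrightarrow> \<exists>k u. u \<in> V \<and> u \<notin> S \<and> h z = h t powi k * u"
    using restriction_decomp[OF place_nontrivial[OF S]] by blast
  have T0: "h t \<noteq> 0" using t(1) field_embedding_eq_0_iff[OF emb_h] by simp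
  have ex: "\<exists>l u. u \<in> V \<and> u \<notin> S \<and> z ^ fact m = h t powi l * u" if z: "z \<noteq> 0" for z
  proof -
    obtain k c u where k: "0 < k" "k \<le> m" "c \<noteq> 0" "u \<in> V" "u \<notin> S" "z ^ k = h c * u"
      using power_equivalent_to_rational[OF S z] by blast
    obtain l w where l: "w \<in> V" "w \<notin> S" "h c = h t powi l * w" using t(3)[OF k(3)] by blast
    have "k dvd fact m" using k(1,2) by (simp add: dvd_fact)
    then obtain e where e: "fact m = k * e" by blast
    have "z ^ fact m = (h t powi l * w * u) ^ e" using k(6) l(3) by (simp add: e power_mult)
    also have "\<dots> = h t powi (l * int e) * (w * u) ^ e"
      by (simp add: power_mult_distrib mult.assoc power_int_mult)
    finally have "z ^ fact m = h t powi (l * int e) * (w * u) ^ e" .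
    then show ?thesis using unit_power[of "w * u" e] unit_mult[of w u] k l by blast
  qed
  define \<omega> where "\<omega> z = (THE l. \<exists>u. u \<in> V \<and> u \<notin> S \<and> z ^ fact m = h t powi l * u)" for z
  have \<omega>_eq: "\<omega> z = l" if "u \<in> V" "u \<notin> S" "z ^ fact m = h t powi l * u" for z l u
    unfolding \<omega>_def
  proof (rule the_equality)
    show "\<exists>u. u \<in> V \<and> u \<notin> S \<and> z ^ fact m = h t powi l * u" using that by blast
  next
    fix l' assume "\<exists>u. u \<in> V \<and> u \<notin> S \<and> z ^ fact m = h t powi l' * u"
    then obtain u' where u': "u' \<in> V" "u' \<notin> S" "z ^ fact m = h t powi l' * u'" by blast
    show "l' = l" using exponent_unique[OF T0 t(2) u'(1,2) that(1,2)] u'(3) that(3) by simp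
  qed
  show ?thesis
  proof (rule discrete_placeI[of \<omega>])
    fix z w :: 'f assume "z \<noteq> 0" "w \<noteq> 0"
    obtain l u where l: "u \<in> V" "u \<notin> S" "z ^ fact m = h t powi l * u" using ex[OF \<open>z \<noteq> 0\<close>] by blast
    obtain l' u' where l': "u' \<in> V" "u' \<notin> S" "w ^ fact m = h t powi l' * u'" using ex[OF \<open>w \<noteq> 0\<close>] by blast
    have "(z * w) ^ fact m = h t powi (l + l') * (u * u')"
      using l l' T0 by (simp add: power_mult_distrib power_int_add mult_ac)
    then show "\<omega> (z * w) = \<omega> z + \<omega> w"
      using \<omega>_eq[OF l] \<omega>_eq[OF l'] \<omega>_eq[of "u * u'"] unit_mult[of u u'] l l' by simp
  next
    fix z :: 'f assume "z \<noteq> 0"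
    obtain l u where l: "u \<in> V" "u \<notin> S" "z ^ fact m = h t powi l * u" using ex[OF \<open>z \<noteq> 0\<close>] by blast
    have "z \<in> V \<longleftrightarrow> z ^ fact m \<in> V" by (rule V_power_iff[symmetric]) simp
    then show "z \<in> V \<longleftrightarrow> 0 \<le> \<omega> z"
      using \<omega>_eq[OF l] powi_unit_V_iff[OF T0 t(2) l(1,2), of l] l(3) by simp
  qed
qed

end

section \<open>Kummer extensions and their place at infinity\<close>

locale kummer_extension = radical_extension h y m
  for h :: "'k::field poly fract \<Rightarrow> 'f::field" and y :: 'f and m :: nat +
  fixes f :: "'k poly" and \<iota> :: "'k \<Rightarrow> 'f"
  assumes f_nz: "f \<noteq> 0" and y_eq: "y ^ m = h (Fract f 1)" and \<iota>_h: "\<iota> = h \<circ> rat_const"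
begin

lemma emb_\<iota>: "field_embedding \<iota>"
proof -
  have "field_embedding (rat_const :: 'k \<Rightarrow> 'k poly fract)" by (rule field_embedding_rat_const)
  then show ?thesis using emb_h by (simp add: \<iota>_h field_embedding_def)
qed

lemma place_over_rational: "S \<in> places \<iota> \<Longrightarrow> place_over_rational \<iota> S h"
  by (intro place_over_rational.intro place.intro place_over_rational_axioms.intro emb_\<iota> emb_h \<iota>_h)

lemma discrete_place: "S \<in> places \<iota> \<Longrightarrow> discrete_place \<iota> S"
  by (intro discrete_place_extension place_over_rational)

lemma y_nonzero: "y \<noteq> 0"
proof
  assume "y = 0"
  then have "h (Fract f 1) = 0" using y_eq m_pos by (simp add: power_0_left)
  then show False using f_nz field_embedding_eq_0_iff[OF emb_h, of "Fract f 1"]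
    by (simp add: Zero_fract_def eq_fract)
qed

end

locale kummer_place = kummer_extension h y m f \<iota> + place_over_rational \<iota> S h
  for h :: "'k::field poly fract \<Rightarrow> 'f::field" and y :: 'f and m :: nat and f \<iota> S

sublocale kummer_place \<subseteq> discrete_place \<iota> S
  by (rule discrete_place[OF place])

context kummer_place
begin

lemma nontrivial: "\<exists>z. h z \<notin> V"
  by (rule place_nontrivial[OF place_over_rational[OF place]])

lemma m_v_y: "int m * v y = v (hp f)"
  using v_power[OF y_nonzero, of m] y_eq by (simp add: hp_def)

lemma v_hp_infinite: assumes "X \<notin> V" "p \<noteq> 0" shows "v (hp p) = int (degree p) * v X"
proof -
  obtain u where u: "u \<in> V" "u \<notin> S" "hp p = X ^ degree p * u" using hp_infinite assms by blast
  have "X \<noteq> 0" using assms V_0 by auto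
  then show ?thesis using u v_mult[of "X ^ degree p" u] v_power v_unit unit_nonzero by simp
qed

lemma v_X_infinite: assumes "X \<notin> V" shows "v X < 0"
proof -
  have "X \<noteq> 0" using assms V_0 by auto
  then show ?thesis using v_nonneg_iff[of X] assms by simp
qed

lemma v_h_infinite:
  assumes X: "X \<notin> V" and c: "c \<noteq> 0"
  shows "\<exists>k. v (h c) = k * v X"
proof -
  obtain p q where pq: "c = Fract p q" "q \<noteq> 0" by (cases c) auto
  then have "p \<noteq> 0" using c by (auto simp: Zero_fract_def eq_fract)
  then have "v (h c) = int (degree p) * v X - int (degree q) * v X"
    using pq v_divide[of "hp p" "hp q"] v_hp_infinite[OF X] hp_eq_0 by (simp add: h_Fract)
  then show ?thesis by (intro exI[of _ "int (degree p) - int (degree q)"]) (simp add: left_diff_distrib)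
qed

end

lemma coprime_dvd_diff_imp_eq:
  assumes "coprime d m" "i < m" "j < m" "int m dvd (int i - int j) * int d"
  shows "i = j"
proof -
  have "coprime (int m) (int d)" using assms(1) by (simp add: coprime_commute)
  then have "int m dvd int i - int j" using assms(4) coprime_dvd_mult_left_iff by blast
  then have "int i mod int m = int j mod int m" by (simp add: mod_eq_dvd_iff)
  then show ?thesis using assms(2,3) by simp
qed

text \<open>
  Comparing values in the equation for \<open>y\<close> shows that \<open>x\<close> and \<open>y\<close> have values \<open>- m c\<close> and
  \<open>- degree f * c\<close>. The monomials \<open>y ^ i\<close> with \<open>i < m\<close> then have pairwise distinct values
  modulo the values of rational functions, so every value is a multiple of \<open>c\<close>, and \<open>c = 1\<close>.
\<close>

locale kummer_place_infinite = kummer_place +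
  assumes X_pole: "X \<notin> V" and coprime_deg: "coprime (degree f) m"
begin

lemma v_X_y_multiple: "\<exists>c>0. v X = - int m * c \<and> v y = - int (degree f) * c"
proof -
  have eq: "int m * v y = int (degree f) * v X" using m_v_y v_hp_infinite[OF X_pole f_nz] by simp
  then have "int m dvd int (degree f) * v X" by (metis dvd_triv_left)
  then have "int m dvd v X"
    using coprime_deg by (simp add: coprime_dvd_mult_right_iff coprime_commute)
  then obtain c where c: "v X = int m * c" by blast
  then have "v y = int (degree f) * c" using eq m_pos by simp
  moreover have "c < 0" using c v_X_infinite[OF X_pole] m_pos by (simp add: mult_less_0_iff)
  ultimately show ?thesis using c by (intro exI[of _ "- c"]) simp
qed

lemma v_term: assumes "c \<noteq> 0" shows "v (h c * y ^ i) = v (h c) + int i * v y"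
  using v_mult[of "h c" "y ^ i"] v_power[of y i] y_nonzero field_embedding_eq_0_iff[OF emb_h] assms
  by simp

lemma terms_distinct:
  assumes "i < m" "j < m" "h (c i) * y ^ i \<noteq> 0" "h (c j) * y ^ j \<noteq> 0"
    and eq: "v (h (c i) * y ^ i) = v (h (c j) * y ^ j)"
  shows "i = j"
proof -
  obtain e where e: "e > 0" "v X = - int m * e" "v y = - int (degree f) * e"
    using v_X_y_multiple by blast
  have nz: "c i \<noteq> 0" "c j \<noteq> 0" using assms(3,4) field_embedding_0[OF emb_h] by auto
  obtain k where k: "v (h (c i)) = k * v X" using v_h_infinite[OF X_pole nz(1)] by blast
  obtain l where l: "v (h (c j)) = l * v X" using v_h_infinite[OF X_pole nz(2)] by blast
  have "e * (- int m * k - int i * int (degree f)) = e * (- int m * l - int j * int (degree f))"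
    using eq v_term[OF nz(1), of i] v_term[OF nz(2), of j] k l e by (simp add: algebra_simps)
  then have "- int m * k - int i * int (degree f) = - int m * l - int j * int (degree f)"
    using e(1) mult_left_cancel[of e] by simp
  then have "(int i - int j) * int (degree f) = int m * (l - k)" by (simp add: algebra_simps)
  then have "int m dvd (int i - int j) * int (degree f)" by simp
  then show ?thesis by (rule coprime_dvd_diff_imp_eq[OF coprime_deg assms(1,2)])
qed

lemma expansion_value:
  assumes "z = (\<Sum>i<m. h (c i) * y ^ i)" "\<exists>i<m. c i \<noteq> 0"
  shows "z \<noteq> 0" "\<exists>i<m. c i \<noteq> 0 \<and> v z = v (h (c i)) + int i * v y"
    "\<And>i. i < m \<Longrightarrow> c i \<noteq> 0 \<Longrightarrow> v z \<le> v (h (c i)) + int i * v y"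
proof -
  have nz: "h (c i) * y ^ i \<noteq> 0 \<longleftrightarrow> c i \<noteq> 0" for i
    using field_embedding_eq_0_iff[OF emb_h] y_nonzero by simp
  have ex: "\<exists>i\<in>{..<m}. h (c i) * y ^ i \<noteq> 0" using assms(2) nz by auto
  have *: "z \<noteq> 0 \<and> (\<exists>i\<in>{..<m}. h (c i) * y ^ i \<noteq> 0 \<and> v z = v (h (c i) * y ^ i)) \<and>
      (\<forall>i\<in>{..<m}. h (c i) * y ^ i \<noteq> 0 \<longrightarrow> v z \<le> v (h (c i) * y ^ i))"
    unfolding assms(1)
    by (rule v_sum_distinct[OF finite_lessThan _ ex]) (rule terms_distinct, simp_all)
  then show "z \<noteq> 0" by blast
  from * obtain i where i: "i < m" "h (c i) * y ^ i \<noteq> 0" "v z = v (h (c i) * y ^ i)" by auto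
  then show "\<exists>i<m. c i \<noteq> 0 \<and> v z = v (h (c i)) + int i * v y"
    using nz v_term[of "c i" i] by auto
  show "v z \<le> v (h (c i)) + int i * v y" if "i < m" "c i \<noteq> 0" for i
    using * that nz[of i] v_term[of "c i" i] by auto
qed

lemma v_X: "v X = - int m" and v_y: "v y = - int (degree f)"
proof -
  obtain e where e: "e > 0" "v X = - int m * e" "v y = - int (degree f) * e"
    using v_X_y_multiple by blast
  obtain c where c: "unif = (\<Sum>i<m. h (c i) * y ^ i)" using expansion by blast
  have "\<exists>i<m. c i \<noteq> 0" using unif(1) c field_embedding_0[OF emb_h] by (metis (no_types, lifting)
      lessThan_iff mult_zero_left sum.neutral)
  from expansion_value(2)[OF c this] obtain i where i: "c i \<noteq> 0" "1 = v (h (c i)) + int i * v y"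
    using v_unif by auto
  obtain k where k: "v (h (c i)) = k * v X" using v_h_infinite[OF X_pole i(1)] by blast
  have "1 = e * (- int m * k - int i * int (degree f))" using i k e by (simp add: algebra_simps)
  then have "e dvd 1" by (metis dvd_triv_left)
  then have "e = 1" using e(1) by simp
  then show "v X = - int m" "v y = - int (degree f)" using e by simp_all
qed

text \<open>Distinct values make the powers of \<open>y\<close> independent; this is where the degree of the extension comes from.\<close>

lemma powers_independent:
  assumes "(\<Sum>i<m. h (c i) * y ^ i) = 0" "i < m"
  shows "c i = 0"
  using expansion_value(1)[OF refl, of c] assms by blast

lemma extension_degree: "extension_degree h = m"
proof -
  have inj: "inj_on (\<lambda>i. y ^ i) {..<m}"
  proof (rule inj_onI)
    fix i j assume ij: "i \<in> {..<m}" "j \<in> {..<m}" "y ^ i = y ^ j"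
    show "i = j"
    proof (rule ccontr)
      assume "i \<noteq> j"
      define c where "c = (\<lambda>l. if l = i then 1 else if l = j then - 1 else 0 :: 'a poly fract)"
      have "(\<Sum>l<m. h (c l) * y ^ l) = (\<Sum>l\<in>{i, j}. h (c l) * y ^ l)"
        using ij by (intro sum.mono_neutral_right) (auto simp: c_def hom_0)
      also have "\<dots> = 0"
        using ij \<open>i \<noteq> j\<close> by (simp add: c_def h_1 field_embedding_uminus[OF emb_h])
      finally have "c i = 0" using powers_independent ij(1) by blast
      then show False by (simp add: c_def)
    qed
  qed
  let ?B = "(\<lambda>i. y ^ i) ` {..<m}"
  have "\<not> vs.dependent ?B"
  proof
    assume "vs.dependent ?B"
    then obtain u where u: "\<exists>b\<in>?B. u b \<noteq> 0" "(\<Sum>b\<in>?B. h (u b) * b) = 0"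
      using vs.dependent_finite[of ?B] by auto
    then have "(\<Sum>i<m. h (u (y ^ i)) * y ^ i) = 0"
      using sum.reindex[OF inj, of "\<lambda>b. h (u b) * b"] by simp
    then show False using u(1) powers_independent[of "\<lambda>i. u (y ^ i)"] by auto
  qed
  moreover have "vs.span ?B = UNIV" using y_span_UNIV unfolding y_span_def .
  ultimately have "vs.dim UNIV = card ?B" by (intro vs.dim_unique) auto
  then show ?thesis using card_image[OF inj] by (simp add: extension_degree_def dim_via_def)
qed

text \<open>
  In an integral element every term \<open>y ^ i\<close> with \<open>0 < i < m\<close> has nonzero, hence positive, value;
  the residue field is therefore that of the place of the rational function field.
\<close>

lemma residue: assumes z: "z \<in> V" shows "\<exists>c. z - \<iota> c \<in> S"
proof (cases "z = 0")
  case True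
  then show ?thesis using P_0 field_embedding_0[OF emb_\<iota>] by (intro exI[of _ 0]) simp
next
  case False
  obtain c where c: "z = (\<Sum>i<m. h (c i) * y ^ i)" using expansion by blast
  have nz: "\<exists>i<m. c i \<noteq> 0" using False c field_embedding_0[OF emb_h]
    by (metis (no_types, lifting) lessThan_iff mult_zero_left sum.neutral)
  have vz: "v z \<ge> 0" using z False v_nonneg_iff by simp
  have ge: "v (h (c i)) + int i * v y \<ge> 0" if "i < m" "c i \<noteq> 0" for i
    using expansion_value(3)[OF c nz that] vz by simp
  have "h (c i) * y ^ i \<in> S" if i: "i \<in> {..<m} - {0}" for i
  proof (cases "c i = 0")
    case True
    then show ?thesis by (simp add: field_embedding_0[OF emb_h] P_0)
  next
    case False
    then obtain k where k: "v (h (c i)) = k * v X" using v_h_infinite[OF X_pole] by blast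
    have "v (h (c i)) + int i * v y \<noteq> 0"
    proof
      assume "v (h (c i)) + int i * v y = 0"
      then have "(int i - int 0) * int (degree f) = int m * (- k)"
        using k v_X v_y by (simp add: mult.commute)
      then have "int m dvd (int i - int 0) * int (degree f)" by (metis dvd_triv_left)
      then have "i = 0" using i by (intro coprime_dvd_diff_imp_eq[OF coprime_deg]) auto
      then show False using i by simp
    qed
    then have "v (h (c i) * y ^ i) > 0" using ge[of i] False i v_term[OF False, of i] by auto
    then show ?thesis
      using v_pos_iff[of "h (c i) * y ^ i"] False y_nonzero field_embedding_eq_0_iff[OF emb_h] by simp
  qed
  then have "(\<Sum>i\<in>{..<m} - {0}. h (c i) * y ^ i) \<in> S" by (rule P_sum)
  moreover have "z = h (c 0) + (\<Sum>i\<in>{..<m} - {0}. h (c i) * y ^ i)"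
    using c m_pos sum.remove[of "{..<m}" 0 "\<lambda>i. h (c i) * y ^ i"] by simp
  ultimately have z0: "z - h (c 0) \<in> S" by simp
  then have V0: "h (c 0) \<in> V" using V_diff[OF z P_V[OF z0]] by simp
  have "\<exists>d. h (c 0) - \<iota> d \<in> S"
  proof (cases "c 0 = 0")
    case True
    then show ?thesis
      using P_0 field_embedding_0[OF emb_\<iota>] field_embedding_0[OF emb_h] by (intro exI[of _ 0]) simp
  next
    case False
    obtain p q where pq: "c 0 = Fract p q" "q \<noteq> 0" by (cases "c 0") auto
    then have p: "p \<noteq> 0" using False by (auto simp: Zero_fract_def eq_fract)
    have "v (h (c 0)) \<ge> 0"
      using V0 v_nonneg_iff[of "h (c 0)"] False field_embedding_eq_0_iff[OF emb_h] by simp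
    moreover have "v (h (c 0)) = int (degree p) * v X - int (degree q) * v X"
      using pq p v_divide[of "hp p" "hp q"] v_hp_infinite[OF X_pole] hp_eq_0 by (simp add: h_Fract)
    ultimately have "int m * (int (degree q) - int (degree p)) \<ge> 0"
      by (simp add: v_X algebra_simps)
    then have le: "degree p \<le> degree q" using m_pos by (simp add: zero_le_mult_iff)
    define d where "d = coeff p (degree q) / lead_coeff q"
    define r where "r = p - smult d q"
    have small: "h (Fract r q) \<in> S"
    proof (cases "r = 0")
      case True
      then show ?thesis by (simp add: h_Fract hp_0 P_0)
    next
      case False
      have "coeff r (degree q) = 0" using pq(2) by (simp add: r_def d_def)
      moreover have "degree r \<le> degree q" using le by (simp add: r_def degree_diff_le)
      ultimately have "degree r < degree q"
        using False by (metis leading_coeff_0_iff le_neq_implies_less)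
      then have "Fract r q \<in> infinite_place" unfolding infinite_place_def by blast
      moreover have "lies_over h S infinite_place" using lies_over_infinite_iff X_pole by simp
      ultimately show ?thesis unfolding lies_over_def by blast
    qed
    have "smult d q = [:d:] * q" by simp
    then have "hp (smult d q) = \<iota> d * hp q" by (simp only: hp_mult) (simp add: hp_pCons hp_0)
    moreover have "p = r + smult d q" by (simp add: r_def)
    ultimately have "hp p = hp r + \<iota> d * hp q" using hp_add by metis
    then have "h (c 0) - \<iota> d = h (Fract r q)"
      using pq hp_eq_0[of q] by (simp add: h_Fract field_simps)
    then show ?thesis using small by metis
  qed
  then obtain d where "h (c 0) - \<iota> d \<in> S" by blast
  then have "z - \<iota> d \<in> S" using P_add[OF z0] by force
  then show ?thesis ..
qed

end

section \<open>Frobenius exponents\<close>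

lemma finite_field_power_card_minus_1:
  fixes k :: "'k::field"
  assumes fin: "finite (UNIV :: 'k set)" and k: "k \<noteq> 0"
  shows "k ^ (CARD('k) - 1) = 1"
proof -
  let ?U = "UNIV - {0 :: 'k}"
  have "bij_betw (\<lambda>x. k * x) ?U ?U"
    by (rule bij_betw_byWitness[of _ "\<lambda>x. x / k"]) (use k in auto)
  then have "(\<Prod>x\<in>?U. k * x) = (\<Prod>x\<in>?U. x)" by (rule prod.reindex_bij_betw)
  then have "k ^ card ?U * (\<Prod>x\<in>?U. x) = 1 * (\<Prod>x\<in>?U. x)" by (simp add: prod.distrib)
  moreover have "(\<Prod>x\<in>?U. x) \<noteq> 0" using fin by simp
  ultimately have "k ^ card ?U = 1" by (metis mult_right_cancel)
  then show ?thesis using fin by (simp add: card_Diff_singleton)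
qed

text \<open>Translation by 1 permutes the field, so it does not change the sum of all elements.\<close>

lemma CHAR_dvd_card_field:
  assumes fin: "finite (UNIV :: 'k::field set)"
  shows "CHAR('k) dvd CARD('k)"
proof -
  have "bij_betw (\<lambda>x :: 'k. x + 1) UNIV UNIV"
    by (rule bij_betw_byWitness[of _ "\<lambda>x. x - 1"]) auto
  then have "(\<Sum>x\<in>UNIV. x + 1) = (\<Sum>x\<in>(UNIV :: 'k set). x)" by (rule sum.reindex_bij_betw)
  then have "of_nat CARD('k) = (0 :: 'k)" by (simp add: sum.distrib)
  then show ?thesis by (simp add: of_nat_eq_0_iff_char_dvd)
qed

text \<open>Among the residues of the powers of \<open>p\<close> two coincide, and \<open>p\<close> can be cancelled modulo \<open>n\<close>.\<close>

lemma coprime_power_cong_1_exists: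
  fixes p n :: nat
  assumes "coprime p n" "n > 0" "p > 0"
  shows "\<exists>j>0. n dvd p ^ j - 1"
proof -
  have "finite ((\<lambda>i. p ^ i mod n) ` (UNIV :: nat set))"
    by (rule finite_subset[of _ "{..<n}"]) (use assms(2) in auto)
  then have "\<not> inj (\<lambda>i. p ^ i mod n)" using finite_imageD infinite_UNIV_nat by blast
  then obtain i j where "i \<noteq> j" "p ^ i mod n = p ^ j mod n" unfolding inj_def by blast
  then obtain i j where ij: "i < j" "p ^ i mod n = p ^ j mod n" by (metis linorder_neqE_nat)
  have "n dvd p ^ j - p ^ i"
    using ij assms(3) by (metis mod_eq_dvd_iff_nat less_imp_le power_increasing Suc_leI One_nat_def)
  moreover have "p ^ j - p ^ i = p ^ i * (p ^ (j - i) - 1)"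
  proof -
    have "p ^ j = p ^ i * p ^ (j - i)"
      using power_add[of p i "j - i"] ij(1) by simp
    then show ?thesis by (simp only: diff_mult_distrib2 mult_1_right)
  qed
  moreover have "coprime n (p ^ i)" using assms(1) by (simp add: coprime_commute)
  ultimately have "n dvd p ^ (j - i) - 1" by (simp add: coprime_dvd_mult_right_iff)
  then show ?thesis using ij(1) by (intro exI[of _ "j - i"]) simp
qed

lemma Fract_power: "Fract p q ^ n = Fract (p ^ n) (q ^ n)"
  by (induction n) (simp_all add: One_fract_def)

text \<open>
  A power \<open>g * e + 1\<close> of the characteristic with \<open>q - 1\<close> dividing \<open>e\<close>. Raising to it is additive and fixes
  the constants, and it also fixes the \<open>g\<close>-th roots of constants, since \<open>u ^ (g * e) = (u ^ g) ^ e = 1\<close>.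
\<close>

lemma frobenius_exponent_exists:
  fixes \<iota> :: "'k::field \<Rightarrow> 'f::field"
  assumes fin: "finite (UNIV :: 'k set)" and emb: "field_embedding \<iota>"
    and g: "g > 0" "\<not> CHAR('k) dvd g"
  shows "\<exists>e>0. (\<forall>k :: 'k. k \<noteq> 0 \<longrightarrow> k ^ e = 1) \<and>
    (\<forall>a b :: 'f. (a + b) ^ Suc (g * e) = a ^ Suc (g * e) + b ^ Suc (g * e))"
proof -
  define p q where "p = CHAR('k)" and "q = CARD('k)"
  have prime: "prime p" unfolding p_def by (intro prime_CHAR_semidom finite_imp_CHAR_pos fin)
  have q: "q > 1" using card_mono[OF fin, of "{0, 1}"] by (simp add: q_def)
  have "p dvd q" unfolding p_def q_def by (rule CHAR_dvd_card_field[OF fin])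
  have "\<not> p dvd q - 1"
  proof
    assume "p dvd q - 1"
    then have "p dvd q - (q - 1)" using \<open>p dvd q\<close> by (rule dvd_diff_nat[rotated])
    then show False using q prime by (simp add: prime_nat_iff)
  qed
  define n where "n = g * (q - 1)"
  have "n > 0" using g q by (simp add: n_def)
  have "\<not> p dvd n" using prime g(2) \<open>\<not> p dvd q - 1\<close> by (simp add: n_def p_def prime_dvd_mult_iff)
  then have "coprime p n" using prime by (simp add: prime_imp_coprime)
  then obtain j where j: "j > 0" "n dvd p ^ j - 1"
    using coprime_power_cong_1_exists \<open>n > 0\<close> prime_gt_0_nat[OF prime] by blast
  have big: "p ^ j > 1" using prime j(1) by (intro one_less_power) (auto simp: prime_nat_iff)
  obtain d where d: "p ^ j - 1 = n * d" using j(2) by blast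
  define e where "e = (q - 1) * d"
  have Q: "p ^ j = Suc (g * e)" using d big by (simp add: e_def n_def)
  have "e > 0" using Q big by (cases "e = 0") auto
  have char: "CHAR('f) = p"
  proof (rule CHAR_eqI)
    have nat: "\<iota> (of_nat i) = of_nat i" for i
      using emb by (induction i) (auto simp: field_embedding_0 field_embedding_def)
    show "of_nat p = (0 :: 'f)" using nat[of p] emb by (simp add: p_def field_embedding_0)
    show "p dvd i" if "of_nat i = (0 :: 'f)" for i
      using nat[of i] that field_embedding_eq_0_iff[OF emb, of "of_nat i"]
      by (simp add: p_def of_nat_eq_0_iff_char_dvd)
  qed
  have "k ^ e = 1" if "k \<noteq> 0" for k :: 'k
    using finite_field_power_card_minus_1[OF fin that] by (simp add: e_def q_def power_mult)
  moreover have "(a + b) ^ Suc (g * e) = a ^ Suc (g * e) + b ^ Suc (g * e)" for a b :: 'f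
    using freshmans_dream'[where 'a = 'f] char prime Q by metis
  ultimately show ?thesis using \<open>e > 0\<close> by blast
qed


section \<open>Kummer extensions: places over a finite rational place\<close>

text \<open>
  Over \<open>x = a\<close>, a zero of order \<open>l\<close> of \<open>f\<close>, the extension is built in two steps. With
  \<open>g = gcd m l\<close>, the element \<open>u = y ^ (m / g) / (x - a) ^ (l / g)\<close> is a \<open>g\<close>-th root of a unit, and the
  first step, the adjunction of \<open>u\<close>, is unramified; in the second step the ramification index is
  \<open>m / g\<close>.
\<close>

locale kummer_point = kummer_extension h y m f \<iota>
  for h :: "'k::field poly fract \<Rightarrow> 'f::field" and y :: 'f and m :: nat and f \<iota> +
  fixes a :: 'k and l :: nat and \<phi> :: "'k poly"
  assumes fin: "finite (UNIV :: 'k set)" and char: "\<not> CHAR('k) dvd m"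
    and f_eq: "f = [:- a, 1:] ^ l * \<phi>" and \<phi>_a: "poly \<phi> a \<noteq> 0"
begin

definition g :: nat where "g = gcd m l"
definition m' :: nat where "m' = m div g"
definition l' :: nat where "l' = l div g"
definition Z :: 'f where "Z = h (Fract [:- a, 1:] 1)"
definition u :: 'f where "u = y ^ m' / Z ^ l'"

lemma g_pos: "g > 0" using m_pos by (simp add: g_def)
lemma m_eq: "m = m' * g" by (simp add: m'_def g_def)
lemma l_eq: "l = l' * g" by (simp add: l'_def g_def)
lemma m'_pos: "m' > 0" using m_pos m_eq by (cases "m' = 0") auto
lemma coprime_m'_l': "coprime m' l'"
  unfolding m'_def l'_def g_def using m_pos by (intro div_gcd_coprime) auto

lemma h_0_iff: "h c = 0 \<longleftrightarrow> c = 0"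
  by (rule field_embedding_eq_0_iff[OF emb_h])

lemma Z_nonzero: "Z \<noteq> 0"
  by (simp add: Z_def h_0_iff Zero_fract_def eq_fract)

lemma u_power: "u ^ g = h (Fract \<phi> 1)"
proof -
  have "Fract f 1 = Fract [:- a, 1:] 1 ^ l * Fract \<phi> 1"
    by (simp add: f_eq Fract_power)
  then have "y ^ m = Z ^ l * h (Fract \<phi> 1)"
    by (simp add: y_eq Z_def hom_mult field_embedding_power[OF emb_h])
  moreover have "u ^ g = y ^ m / Z ^ l"
    unfolding u_def power_divide by (metis m_eq l_eq power_mult)
  ultimately show ?thesis using Z_nonzero by simp
qed

lemma y_power_m': "y ^ m' = u * Z ^ l'"
  using Z_nonzero by (simp add: u_def)

text \<open>The ring generated by \<open>u\<close> over the local ring of \<open>x = a\<close>.\<close>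

inductive_set A :: "'f set" where
  A_rat: "poly q a \<noteq> 0 \<Longrightarrow> h (Fract p q) \<in> A"
| A_u: "u \<in> A"
| A_add: "c \<in> A \<Longrightarrow> d \<in> A \<Longrightarrow> c + d \<in> A"
| A_mult: "c \<in> A \<Longrightarrow> d \<in> A \<Longrightarrow> c * d \<in> A"

lemma A_const: "\<iota> c \<in> A"
  using A_rat[of 1 "[:c:]"] by (simp add: \<iota>_h rat_const_def)

lemma A_0: "0 \<in> A" and A_1: "1 \<in> A"
  using A_const[of 0] A_const[of 1] field_embedding_0[OF emb_\<iota>] emb_\<iota>
  by (simp_all add: field_embedding_def)

lemma A_uminus: "c \<in> A \<Longrightarrow> - c \<in> A"
  using A_mult[OF A_const[of "- 1"], of c] emb_\<iota>
  by (simp add: field_embedding_uminus[OF emb_\<iota>]) (simp add: field_embedding_def)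

lemma A_diff: "c \<in> A \<Longrightarrow> d \<in> A \<Longrightarrow> c - d \<in> A"
  using A_add[OF _ A_uminus] by (metis diff_conv_add_uminus)

lemma A_power: "c \<in> A \<Longrightarrow> c ^ n \<in> A"
  by (induction n) (auto intro: A_1 A_mult)

lemma A_sum: "(\<And>i. i \<in> I \<Longrightarrow> c i \<in> A) \<Longrightarrow> (\<Sum>i\<in>I. c i) \<in> A"
  by (induction I rule: infinite_finite_induct) (auto intro: A_0 A_add)

lemma A_Z: "Z \<in> A"
  unfolding Z_def by (rule A_rat) simp

definition ZA :: "'f set" where "ZA = (\<lambda>c. Z * c) ` A"

lemma ZA_I: "c \<in> A \<Longrightarrow> Z * c \<in> ZA"
  by (auto simp: ZA_def)

lemma ZA_E: assumes "d \<in> ZA" obtains c where "c \<in> A" "d = Z * c"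
  using assms by (auto simp: ZA_def)

lemma ZA_0: "0 \<in> ZA"
  using ZA_I[OF A_0] by simp

lemma ZA_add: assumes "c \<in> ZA" "d \<in> ZA" shows "c + d \<in> ZA"
proof -
  obtain c' where c: "c' \<in> A" "c = Z * c'" using assms(1) by (rule ZA_E)
  obtain d' where d: "d' \<in> A" "d = Z * d'" using assms(2) by (rule ZA_E)
  show ?thesis using ZA_I[OF A_add[OF c(1) d(1)]] c d by (simp add: distrib_left)
qed

lemma ZA_mult: assumes "c \<in> ZA" "d \<in> A" shows "c * d \<in> ZA"
proof -
  obtain c' where c: "c' \<in> A" "c = Z * c'" using assms(1) by (rule ZA_E)
  show ?thesis using ZA_I[OF A_mult[OF c(1) assms(2)]] c by (simp add: mult.assoc)
qed

lemma ZA_rat: assumes "poly p a = 0" "poly q a \<noteq> 0" shows "h (Fract p q) \<in> ZA"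
proof -
  obtain r where r: "p = [:- a, 1:] * r" using assms(1) by (metis dvdE poly_eq_0_iff_dvd)
  have "Fract p q = Fract [:- a, 1:] 1 * Fract r q" unfolding r by simp
  then have "h (Fract p q) = Z * h (Fract r q)" by (simp only: hom_mult Z_def)
  then show ?thesis using ZA_I[OF A_rat[OF assms(2)]] by simp
qed

text \<open>
  The elements fixed modulo \<open>x - a\<close> form a ring, so it is enough to consider the generators. This is
  how separability of \<open>T ^ g - \<phi> a\<close> enters: the quotient by \<open>x - a\<close> is reduced.
\<close>

lemma frobenius_A:
  assumes e: "e > 0" "\<And>k :: 'k. k \<noteq> 0 \<Longrightarrow> k ^ e = 1"
    and add: "\<And>b c :: 'f. (b + c) ^ Suc (g * e) = b ^ Suc (g * e) + c ^ Suc (g * e)"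
    and c: "c \<in> A"
  shows "c ^ Suc (g * e) - c \<in> ZA"
  using c
proof (induction rule: A.induct)
  case (A_rat q p)
  define Q where "Q = Suc (g * e)"
  have pow_Q: "k ^ Q = k" for k :: 'k
    using e(2)[of k] by (cases "k = 0") (simp_all add: Q_def mult.commute[of g] power_mult)
  have q0: "q \<noteq> 0" using A_rat by auto
  have "Fract p q ^ Q - Fract p q = Fract (p ^ Q * q - p * q ^ Q) (q ^ Q * q)"
    unfolding Fract_power using q0 by simp
  then have "h (Fract p q) ^ Q - h (Fract p q) = h (Fract (p ^ Q * q - p * q ^ Q) (q ^ Q * q))"
    by (metis field_embedding_diff[OF emb_h] field_embedding_power[OF emb_h])
  also have "\<dots> \<in> ZA" by (rule ZA_rat) (use A_rat in \<open>simp_all add: pow_Q\<close>)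
  finally show ?case by (simp add: Q_def)
next
  case A_u
  have "Fract (\<phi> ^ e - 1) 1 = Fract \<phi> 1 ^ e - 1" by (simp add: One_fract_def Fract_power)
  then have "h (Fract (\<phi> ^ e - 1) 1) = (u ^ g) ^ e - 1"
    by (simp add: u_power field_embedding_diff[OF emb_h] field_embedding_power[OF emb_h] hom_1)
  moreover have "h (Fract (\<phi> ^ e - 1) 1) \<in> ZA"
    by (rule ZA_rat) (use \<phi>_a e(2) in simp_all)
  ultimately have "((u ^ g) ^ e - 1) * u \<in> ZA" using ZA_mult[OF _ A.A_u] by simp
  moreover have "u ^ Suc (g * e) - u = ((u ^ g) ^ e - 1) * u"
    unfolding power_Suc power_mult by (simp add: algebra_simps)
  ultimately show ?case by simp
next
  case (A_add c d)
  then show ?case using ZA_add[of "c ^ Suc (g * e) - c" "d ^ Suc (g * e) - d"]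
    by (simp only: add) (simp add: algebra_simps)
next
  case (A_mult c d)
  have "(c * d) ^ Suc (g * e) - c * d =
      (c ^ Suc (g * e) - c) * d ^ Suc (g * e) + (d ^ Suc (g * e) - d) * c"
    by (simp only: power_mult_distrib) (simp add: algebra_simps)
  then show ?case using ZA_add[OF ZA_mult ZA_mult] A_mult A_power by metis
qed

text \<open>
  Normal forms of the elements of the ring modulo \<open>x - a\<close>. Over a finite field there are finitely many.
\<close>

definition u_comb :: "(nat \<Rightarrow> 'k) \<Rightarrow> 'f" where "u_comb k = (\<Sum>i<g. \<iota> (k i) * u ^ i)"

definition reducible :: "'f \<Rightarrow> bool" where "reducible c \<longleftrightarrow> (\<exists>k. c - u_comb k \<in> ZA)"

lemma reducible_0: "reducible 0"
  unfolding reducible_def u_comb_def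
  by (rule exI[of _ "\<lambda>_. 0"]) (simp add: field_embedding_0[OF emb_\<iota>] ZA_0)

lemma reducible_add: assumes "reducible c" "reducible d" shows "reducible (c + d)"
proof -
  obtain k k' where k: "c - u_comb k \<in> ZA" "d - u_comb k' \<in> ZA"
    using assms unfolding reducible_def by blast
  have "u_comb (\<lambda>i. k i + k' i) = u_comb k + u_comb k'"
    using emb_\<iota> by (simp add: u_comb_def field_embedding_def distrib_right sum.distrib)
  then have "c + d - u_comb (\<lambda>i. k i + k' i) = (c - u_comb k) + (d - u_comb k')" by simp
  then show ?thesis unfolding reducible_def using ZA_add[OF k] by metis
qed

lemma reducible_sum: "(\<And>i. i \<in> I \<Longrightarrow> reducible (c i)) \<Longrightarrow> reducible (\<Sum>i\<in>I. c i)"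
  by (induction I rule: infinite_finite_induct) (auto intro: reducible_0 reducible_add)

lemma reducible_cong: assumes "reducible c" "d - c \<in> ZA" shows "reducible d"
proof -
  obtain k where k: "c - u_comb k \<in> ZA" using assms(1) unfolding reducible_def by blast
  have "d - u_comb k = (d - c) + (c - u_comb k)" by simp
  then show ?thesis unfolding reducible_def using ZA_add[OF assms(2) k] by metis
qed

lemma reducible_monomial_small: assumes "i < g" shows "reducible (\<iota> b * u ^ i)"
proof -
  have "u_comb (\<lambda>j. if j = i then b else 0) = (\<Sum>j<g. if j = i then \<iota> b * u ^ j else 0)"
    unfolding u_comb_def by (rule sum.cong) (auto simp: field_embedding_0[OF emb_\<iota>])
  also have "\<dots> = \<iota> b * u ^ i" using assms by simp
  finally show ?thesis unfolding reducible_def using ZA_0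
    by (intro exI[of _ "\<lambda>j. if j = i then b else 0"]) simp
qed

lemma rat_cong_const:
  assumes "poly q a \<noteq> 0" shows "h (Fract p q) - \<iota> (poly p a / poly q a) \<in> ZA"
proof -
  define b where "b = poly p a / poly q a"
  have "q \<noteq> 0" using assms by auto
  then have "Fract p q - rat_const b = Fract (p - smult b q) q" by (simp add: rat_const_def)
  then have "h (Fract p q) - \<iota> b = h (Fract (p - smult b q) q)"
    by (metis field_embedding_diff[OF emb_h] \<iota>_h comp_apply)
  then show ?thesis using ZA_rat[of "p - smult b q" q] assms by (simp add: b_def)
qed

lemma reducible_monomial: "reducible (\<iota> b * u ^ n)"
proof (induction n arbitrary: b rule: less_induct)
  case (less n)
  show ?case
  proof (cases "n < g")
    case True
    then show ?thesis by (rule reducible_monomial_small)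
  next
    case False
    have "h (Fract \<phi> 1) - \<iota> (poly \<phi> a) \<in> ZA" using rat_cong_const[of 1 \<phi>] by simp
    then have "(u ^ g - \<iota> (poly \<phi> a)) * (\<iota> b * u ^ (n - g)) \<in> ZA"
      unfolding u_power by (intro ZA_mult A_mult A_const A_power A_u)
    moreover have "u ^ n = u ^ g * u ^ (n - g)" using False by (simp flip: power_add)
    then have "\<iota> b * u ^ n - \<iota> (poly \<phi> a * b) * u ^ (n - g) =
        (u ^ g - \<iota> (poly \<phi> a)) * (\<iota> b * u ^ (n - g))"
      using emb_\<iota> by (simp add: field_embedding_def algebra_simps)
    moreover have "reducible (\<iota> (poly \<phi> a * b) * u ^ (n - g))"
      using False g_pos by (intro less.IH) simp
    ultimately show ?thesis using reducible_cong by metis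
  qed
qed

lemma u_comb_A: "u_comb k \<in> A"
  unfolding u_comb_def by (intro A_sum A_mult A_const A_power A_u)

lemma A_reducible: "c \<in> A \<Longrightarrow> reducible c"
proof (induction rule: A.induct)
  case (A_rat q p)
  have "reducible (\<iota> (poly p a / poly q a))"
    using reducible_monomial[of "poly p a / poly q a" 0] by simp
  then show ?case using rat_cong_const[OF A_rat] by (rule reducible_cong)
next
  case A_u
  show ?case using reducible_monomial[of 1 1] emb_\<iota> by (simp add: field_embedding_def)
next
  case (A_add c d)
  then show ?case using reducible_add by simp
next
  case (A_mult c d)
  obtain k k' where k: "c - u_comb k \<in> ZA" "d - u_comb k' \<in> ZA"
    using A_mult unfolding reducible_def by blast
  have "u_comb k * u_comb k' = (\<Sum>i<g. \<Sum>j<g. \<iota> (k i * k' j) * u ^ (i + j))"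
    unfolding u_comb_def sum_product using emb_\<iota>
    by (intro sum.cong refl) (simp add: field_embedding_def power_add mult_ac)
  then have "reducible (u_comb k * u_comb k')"
    by (simp only:) (intro reducible_sum reducible_monomial)
  moreover have "c * d - u_comb k * u_comb k' = (c - u_comb k) * d + (d - u_comb k') * u_comb k"
    by (simp add: algebra_simps)
  then have "c * d - u_comb k * u_comb k' \<in> ZA"
    using ZA_add[OF ZA_mult[OF k(1) A_mult(2)] ZA_mult[OF k(2) u_comb_A]] by simp
  ultimately show ?case by (rule reducible_cong)
qed

text \<open>
  A power of \<open>x - a\<close> clears the denominators of the coefficients, and \<open>y ^ m' = u * (x - a) ^ l'\<close> absorbs
  the powers of \<open>y\<close> with exponent at least \<open>m'\<close> into the ring.
\<close>

lemma A_expansion: "\<exists>N c. (\<forall>i. c i \<in> A) \<and> Z ^ N * z = (\<Sum>i<m'. c i * y ^ i)"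
proof -
  obtain b where b: "z = (\<Sum>i<m. h (b i) * y ^ i)" using expansion by blast
  have "\<exists>N. Z ^ N * h c \<in> A" for c
  proof -
    obtain p q where pq: "c = Fract p q" "q \<noteq> 0" by (cases c) auto
    obtain q' where q': "q = [:- a, 1:] ^ order a q * q'" "\<not> [:- a, 1:] dvd q'"
      using order_decomp[OF pq(2)] by blast
    define n where "n = order a q"
    have nz: "poly q' a \<noteq> 0" using q'(2) by (simp add: poly_eq_0_iff_dvd)
    have "Fract [:- a, 1:] 1 ^ n * c = Fract ([:- a, 1:] ^ n) 1 * Fract p q"
      using pq(1) by (simp add: Fract_power)
    also have "\<dots> = Fract p q'"
    proof -
      have "[:- a, 1:] ^ n * p * q' = p * q" by (subst q'(1)) (simp only: n_def mult_ac)
      moreover have "q' \<noteq> 0" using nz by auto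
      ultimately show ?thesis using pq(2) by (simp add: eq_fract)
    qed
    finally have "Z ^ n * h c = h (Fract p q')"
      by (metis Z_def hom_mult field_embedding_power[OF emb_h])
    then show ?thesis using A_rat[OF nz] by metis
  qed
  then obtain n where n: "\<And>c. Z ^ n c * h c \<in> A" by metis
  define N where "N = (\<Sum>i<m. n (b i))"
  have N: "Z ^ N * h (b i) \<in> A" if "i < m" for i
  proof -
    have "n (b i) \<le> N" unfolding N_def using that by (intro member_le_sum) auto
    then have "Z ^ N = Z ^ (N - n (b i)) * Z ^ n (b i)" by (simp flip: power_add)
    then have "Z ^ N * h (b i) = Z ^ (N - n (b i)) * (Z ^ n (b i) * h (b i))" by simp
    then show ?thesis using A_mult[OF A_power[OF A_Z] n] by metis
  qed
  define d where "d i = Z ^ N * h (b i) * (u * Z ^ l') ^ (i div m')" for i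
  have dA: "d i \<in> A" if "i < m" for i
    unfolding d_def by (rule A_mult[OF N[OF that] A_power[OF A_mult[OF A_u A_power[OF A_Z]]]])
  have "Z ^ N * z = (\<Sum>i<m. d i * y ^ (i mod m'))"
    unfolding b sum_distrib_left
  proof (rule sum.cong)
    fix i assume "i \<in> {..<m}"
    have "y ^ i = y ^ (m' * (i div m') + i mod m')" by simp
    also have "\<dots> = (u * Z ^ l') ^ (i div m') * y ^ (i mod m')"
      by (simp only: power_add power_mult y_power_m')
    finally show "Z ^ N * (h (b i) * y ^ i) = d i * y ^ (i mod m')" by (simp add: d_def mult.assoc)
  qed simp
  also have "\<dots> = (\<Sum>j<m'. \<Sum>i | i \<in> {..<m} \<and> i mod m' = j. d i * y ^ (i mod m'))"
    using m'_pos by (intro sum.group[symmetric]) auto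
  also have "\<dots> = (\<Sum>j<m'. (\<Sum>i | i \<in> {..<m} \<and> i mod m' = j. d i) * y ^ j)"
    by (intro sum.cong refl) (simp add: sum_distrib_right)
  finally have "Z ^ N * z = (\<Sum>j<m'. (\<Sum>i | i \<in> {..<m} \<and> i mod m' = j. d i) * y ^ j)" .
  then show ?thesis using dA
    by (intro exI[of _ N] exI[of _ "\<lambda>j. \<Sum>i | i \<in> {..<m} \<and> i mod m' = j. d i"])
      (auto intro: A_sum)
qed

end

locale kummer_point_place = kummer_point h y m f \<iota> a l \<phi> + kummer_place h y m f \<iota> S
  for h :: "'k::field poly fract \<Rightarrow> 'f::field" and y :: 'f and m :: nat and f \<iota> a l \<phi> S +
  assumes Z_S: "Z \<in> S"
begin

lemma X_minus_a: "X - \<iota> a \<in> S"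
  using Z_S hp_linear[of a] by (simp add: Z_def hp_def)

lemma v_Z_pos: "v Z > 0"
  using v_pos_iff[OF Z_nonzero] Z_S by simp

lemma v_phi: "v (h (Fract \<phi> 1)) = 0"
  using v_unit[OF hp_V[OF X_V[OF X_minus_a]]] hp_P_iff[OF X_minus_a, of \<phi>] \<phi>_a
  by (simp add: hp_def)

lemma u_nonzero: "u \<noteq> 0"
  using y_nonzero Z_nonzero by (simp add: u_def)

lemma v_u: "v u = 0"
  using v_power[OF u_nonzero, of g] v_phi g_pos by (simp add: u_power)

lemma A_V: "c \<in> A \<Longrightarrow> c \<in> V"
proof (induction rule: A.induct)
  case (A_rat q p)
  have "hp q \<in> V" "hp q \<notin> S"
    using hp_V[OF X_V[OF X_minus_a]] hp_P_iff[OF X_minus_a, of q] A_rat by auto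
  then show ?case using V_mult[OF hp_V[OF X_V[OF X_minus_a], of p]] unit_inverse[of "hp q"]
    by (simp add: h_Fract divide_inverse)
next
  case A_u
  show ?case using v_u v_nonneg_iff[OF u_nonzero] by simp
qed (auto intro: V_add V_mult)

lemma ZA_S: "c \<in> ZA \<Longrightarrow> c \<in> S"
  by (elim ZA_E) (simp add: P_mult[OF Z_S A_V])

text \<open>
  If \<open>c\<close> lies in \<open>S\<close> and \<open>Q = g * e + 1\<close> is a Frobenius exponent, then \<open>c ^ Q - c = - c * (1 - c ^ (Q - 1))\<close> is
  divisible by \<open>x - a\<close> and the second factor is a unit. Hence the value group of the ring is generated by the value of
  \<open>x - a\<close>.
\<close>

lemma descent:
  assumes "c \<in> A" "c \<in> S"
  shows "\<exists>d\<in>A. \<exists>w\<in>A. w - 1 \<in> S \<and> c * w = Z * d"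
proof -
  obtain e where e: "e > 0" "\<And>k :: 'k. k \<noteq> 0 \<Longrightarrow> k ^ e = 1"
      "\<And>b c :: 'f. (b + c) ^ Suc (g * e) = b ^ Suc (g * e) + c ^ Suc (g * e)"
  proof -
    have "\<not> CHAR('k) dvd g" using char m_eq by (metis dvd_mult)
    then show ?thesis using frobenius_exponent_exists[OF fin emb_\<iota> g_pos] that by blast
  qed
  obtain d where d: "d \<in> A" "c ^ Suc (g * e) - c = Z * d"
    using frobenius_A[OF e assms(1)] by (rule ZA_E)
  define w where "w = 1 - c ^ (g * e)"
  have "c ^ (g * e) \<in> S" using assms P_power[of c "g * e"] P_V e(1) g_pos by simp
  then have "w - 1 \<in> S" by (simp add: w_def P_uminus)
  moreover have "w \<in> A" unfolding w_def using assms by (intro A_diff A_1 A_power)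
  moreover have "c * w = Z * (- d)" using d(2) by (simp add: w_def algebra_simps)
  ultimately show ?thesis using A_uminus[OF d(1)] by blast
qed

lemma near_1: assumes "w - 1 \<in> S" shows "w \<in> V" "w \<notin> S" "w \<noteq> 0" "v w = 0"
proof -
  show "w \<in> V" using V_add[OF P_V[OF assms] V_1] by simp
  show "w \<notin> S" using P_diff[of w "w - 1"] assms P_1 by auto
  then show "w \<noteq> 0" "v w = 0" using v_unit[OF \<open>w \<in> V\<close>] unit_nonzero by auto
qed

lemma v_descent:
  assumes "c \<noteq> 0" "w - 1 \<in> S" "c * w = Z * d"
  shows "d \<noteq> 0" "v c = v Z + v d"
proof -
  show "d \<noteq> 0" using assms near_1[OF assms(2)] by auto
  then show "v c = v Z + v d"
    using v_mult[of c w] v_mult[of Z d] near_1[OF assms(2)] Z_nonzero assms by simp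
qed

lemma v_A_multiple: "c \<in> A \<Longrightarrow> c \<noteq> 0 \<Longrightarrow> v Z dvd v c"
proof (induction "nat (v c)" arbitrary: c rule: less_induct)
  case less
  show ?case
  proof (cases "c \<in> S")
    case False
    then show ?thesis using v_unit[OF A_V[OF less.prems(1)]] by simp
  next
    case True
    obtain d w where d: "d \<in> A" "w - 1 \<in> S" "c * w = Z * d" using descent[OF less.prems(1) True] by blast
    note vd = v_descent[OF less.prems(2) d(2,3)]
    have "v c > 0" using True v_pos_iff[OF less.prems(2)] by simp
    then have "nat (v d) < nat (v c)" using vd(2) v_Z_pos by simp
    then have "v Z dvd v d" using less.hyps d(1) vd(1) by blast
    then show ?thesis using vd(2) by simp
  qed
qed

text \<open>
  From \<open>m * v y = l * v (x - a)\<close> the value of \<open>x - a\<close> is a multiple \<open>m' * e\<close> of \<open>m'\<close>, and the terms of an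
  expansion have distinct values modulo this number, all of them multiples of \<open>e\<close>.
\<close>

lemma v_Z_y_multiple: "\<exists>e>0. v Z = int m' * e \<and> v y = int l' * e"
proof -
  have "v (y ^ m') = v (u * Z ^ l')" by (simp add: y_power_m')
  then have eq: "int m' * v y = int l' * v Z"
    using v_mult[OF u_nonzero, of "Z ^ l'"] v_u v_power[OF Z_nonzero] v_power[OF y_nonzero] Z_nonzero
    by simp
  then have "int m' dvd int l' * v Z" by (metis dvd_triv_left)
  then have "int m' dvd v Z" using coprime_m'_l' by (simp add: coprime_dvd_mult_right_iff)
  then obtain e where e: "v Z = int m' * e" by blast
  then have "v y = int l' * e" using eq m'_pos by simp
  moreover have "e > 0" using e v_Z_pos m'_pos by (simp add: zero_less_mult_iff)
  ultimately show ?thesis using e by blast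
qed

lemma v_A_term:
  assumes "c \<in> A" "c \<noteq> 0"
  shows "v (c * y ^ i) = v c + int i * v y"
  using v_mult[of c "y ^ i"] v_power[of y i] y_nonzero assms by simp

lemma A_terms_distinct:
  assumes A: "c \<in> A" "d \<in> A" and nz: "c \<noteq> 0" "d \<noteq> 0" and ij: "i < m'" "j < m'"
    and eq: "v (c * y ^ i) = v (d * y ^ j)"
  shows "i = j"
proof -
  obtain e where e: "e > 0" "v Z = int m' * e" "v y = int l' * e" using v_Z_y_multiple by blast
  obtain k where k: "v c = v Z * k" using v_A_multiple A nz by blast
  obtain k' where k': "v d = v Z * k'" using v_A_multiple A nz by blast
  have "e * (int m' * k + int i * int l') = e * (int m' * k' + int j * int l')"
    using eq v_A_term[OF A(1) nz(1), of i] v_A_term[OF A(2) nz(2), of j] k k' e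
    by (simp add: algebra_simps)
  then have "int m' * k + int i * int l' = int m' * k' + int j * int l'"
    using e(1) mult_left_cancel[of e] by simp
  then have "(int i - int j) * int l' = int m' * (k' - k)" by (simp add: algebra_simps)
  then have "int m' dvd (int i - int j) * int l'" by simp
  then show ?thesis
    using coprime_m'_l' ij by (intro coprime_dvd_diff_imp_eq) (auto simp: coprime_commute)
qed

lemma A_expansion_value:
  assumes c: "\<And>i. c i \<in> A" and z: "z = (\<Sum>i<m'. c i * y ^ i)" "z \<noteq> 0"
  shows "\<exists>i<m'. c i \<noteq> 0 \<and> v z = v (c i) + int i * v y"
    "\<And>i. i < m' \<Longrightarrow> c i \<noteq> 0 \<Longrightarrow> v z \<le> v (c i) + int i * v y"
proof -
  have ex: "\<exists>i\<in>{..<m'}. c i * y ^ i \<noteq> 0"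
  proof (rule ccontr)
    assume "\<not> ?thesis"
    then have "z = 0" unfolding z(1) by (intro sum.neutral) blast
    then show False using z(2) by simp
  qed
  have *: "z \<noteq> 0 \<and> (\<exists>i\<in>{..<m'}. c i * y ^ i \<noteq> 0 \<and> v z = v (c i * y ^ i)) \<and>
      (\<forall>i\<in>{..<m'}. c i * y ^ i \<noteq> 0 \<longrightarrow> v z \<le> v (c i * y ^ i))"
    unfolding z(1)
    by (rule v_sum_distinct[OF finite_lessThan _ ex]) (rule A_terms_distinct[OF c c], simp_all)
  then obtain i where i: "i < m'" "c i * y ^ i \<noteq> 0" "v z = v (c i * y ^ i)" by auto
  then show "\<exists>i<m'. c i \<noteq> 0 \<and> v z = v (c i) + int i * v y"
    using v_A_term[OF c, of i i] by auto
  show "v z \<le> v (c i) + int i * v y" if "i < m'" "c i \<noteq> 0" for i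
    using * that y_nonzero v_A_term[OF c, of i i] by auto
qed

lemma v_Z: "v Z = int m'" and v_y: "v y = int l'"
proof -
  obtain e where e: "e > 0" "v Z = int m' * e" "v y = int l' * e" using v_Z_y_multiple by blast
  obtain N c where c: "\<And>i. c i \<in> A" "Z ^ N * unif = (\<Sum>i<m'. c i * y ^ i)"
    using A_expansion[of unif] by blast
  have nz: "Z ^ N * unif \<noteq> 0" using Z_nonzero unif(1) by simp
  obtain i where i: "c i \<noteq> 0" "v (Z ^ N * unif) = v (c i) + int i * v y"
    using A_expansion_value(1)[OF c nz] by blast
  obtain k where k: "v (c i) = v Z * k" using v_A_multiple[OF c(1) i(1)] by blast
  have "v (Z ^ N * unif) = int N * v Z + 1"
    using v_mult[of "Z ^ N" unif] v_power[OF Z_nonzero] v_unif Z_nonzero unif(1) by simp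
  then have "1 = e * (int m' * k + int i * int l' - int N * int m')"
    using i(2) k e by (simp add: algebra_simps)
  then have "e dvd 1" by (metis dvd_triv_left)
  then have "e = 1" using e(1) by simp
  then show "v Z = int m'" "v y = int l'" using e by simp_all
qed

text \<open>
  The factor \<open>w\<close> of the descent has residue 1, so dividing by it does not change residues.
\<close>

lemma A_divided_residue:
  "c \<in> A \<Longrightarrow> c \<noteq> 0 \<Longrightarrow> v c \<ge> int N * v Z \<Longrightarrow> \<exists>d\<in>A. c / Z ^ N - d \<in> S"
proof (induction N arbitrary: c)
  case 0
  then show ?case using P_0 by (intro bexI[of _ c]) simp_all
next
  case (Suc N)
  have "v c \<ge> v Z + int N * v Z" using Suc.prems(3) by (simp add: distrib_right)
  moreover have "int N * v Z \<ge> 0" using v_Z_pos by simp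
  ultimately have "v c > 0" using v_Z_pos by linarith
  then have "c \<in> S" using v_pos_iff[OF Suc.prems(2)] by simp
  then obtain d w where d: "d \<in> A" "w - 1 \<in> S" "c * w = Z * d"
    using descent[OF Suc.prems(1)] by blast
  note vd = v_descent[OF Suc.prems(2) d(2,3)] and w = near_1[OF d(2)]
  have "v d \<ge> int N * v Z" using vd(2) \<open>v c \<ge> v Z + int N * v Z\<close> by simp
  then obtain b where b: "b \<in> A" "d / Z ^ N - b \<in> S" using Suc.IH[OF d(1) vd(1)] by blast
  have "d / Z ^ N \<in> V" using V_add[OF P_V[OF b(2)] A_V[OF b(1)]] by simp
  then have "(d / Z ^ N * inverse w) * (1 - w) \<in> S"
    using unit_inverse[OF w(1,2)] d(2) P_uminus[of "w - 1"] by (intro P_mult' V_mult) auto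
  moreover have "c / Z ^ Suc N - d / Z ^ N = (d / Z ^ N * inverse w) * (1 - w)"
  proof -
    have "c = Z * d / w" using d(3) w(3) by (simp add: field_simps)
    then show ?thesis using Z_nonzero w(3) by (simp add: field_simps)
  qed
  ultimately have "c / Z ^ Suc N - d / Z ^ N \<in> S" by simp
  then have "c / Z ^ Suc N - b \<in> S" using P_add[OF _ b(2)] by force
  then show ?case using b(1) by blast
qed

text \<open>
  In the expansion of an integral element, the terms with \<open>0 < i < m'\<close> have values that are not multiples
  of \<open>m'\<close> and hence vanish at \<open>S\<close> after division by the power of \<open>x - a\<close>; only the ring contributes to
  the residue field.
\<close>

lemma residue_u_comb: assumes z: "z \<in> V" shows "\<exists>k. z - u_comb k \<in> S"
proof -
  have "\<exists>d\<in>A. z - d \<in> S"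
  proof (cases "z = 0")
    case True
    then show ?thesis using A_0 P_0 by (intro bexI[of _ 0]) simp_all
  next
    case False
    obtain N c where c: "\<And>i. c i \<in> A" "Z ^ N * z = (\<Sum>i<m'. c i * y ^ i)"
      using A_expansion[of z] by blast
    have nz: "Z ^ N * z \<noteq> 0" using Z_nonzero False by simp
    have "v (Z ^ N * z) \<ge> int N * v Z"
      using v_mult[of "Z ^ N" z] v_power[OF Z_nonzero] Z_nonzero False v_nonneg_iff[OF False] z by simp
    then have ge: "v (c i) + int i * v y \<ge> int N * v Z" if "i < m'" "c i \<noteq> 0" for i
      using A_expansion_value(2)[OF c nz that] by simp
    have "c i * y ^ i / Z ^ N \<in> S" if i: "i \<in> {..<m'} - {0}" for i
    proof (cases "c i = 0")
      case True
      then show ?thesis by (simp add: P_0)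
    next
      case False
      obtain k where k: "v (c i) = v Z * k" using v_A_multiple[OF c(1) False] by blast
      have "v (c i) + int i * v y \<noteq> int N * v Z"
      proof
        assume "v (c i) + int i * v y = int N * v Z"
        then have "(int i - int 0) * int l' = int m' * (int N - k)"
          using k v_Z v_y by (simp add: algebra_simps)
        then have "int m' dvd (int i - int 0) * int l'" by (metis dvd_triv_left)
        then have "i = 0" using i coprime_m'_l'
          by (intro coprime_dvd_diff_imp_eq[of l' m']) (auto simp: coprime_commute)
        then show False using i by simp
      qed
      then have "v (c i * y ^ i) > v (Z ^ N)"
        using ge[of i] i False v_A_term[OF c(1) False, of i] v_power[OF Z_nonzero] by auto
      then show ?thesis
        using v_pos_iff[of "c i * y ^ i / Z ^ N"] v_divide[of "c i * y ^ i" "Z ^ N"] False y_nonzero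
          Z_nonzero by simp
    qed
    then have "(\<Sum>i\<in>{..<m'} - {0}. c i * y ^ i / Z ^ N) \<in> S" by (rule P_sum)
    moreover have "z = c 0 / Z ^ N + (\<Sum>i\<in>{..<m'} - {0}. c i * y ^ i / Z ^ N)"
    proof -
      have "z = (\<Sum>i<m'. c i * y ^ i) / Z ^ N" using c(2)[symmetric] Z_nonzero by simp
      also have "\<dots> = (\<Sum>i<m'. c i * y ^ i / Z ^ N)" by (rule sum_divide_distrib)
      finally show ?thesis using m'_pos sum.remove[of "{..<m'}" 0 "\<lambda>i. c i * y ^ i / Z ^ N"] by simp
    qed
    ultimately have z0: "z - c 0 / Z ^ N \<in> S" by simp
    have "\<exists>d\<in>A. c 0 / Z ^ N - d \<in> S"
    proof (cases "c 0 = 0")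
      case True
      then show ?thesis using A_0 P_0 by (intro bexI[of _ 0]) simp_all
    next
      case False
      then show ?thesis using A_divided_residue[OF c(1) False] ge[of 0] m'_pos by simp
    qed
    then obtain d where "d \<in> A" "c 0 / Z ^ N - d \<in> S" by blast
    then show ?thesis using P_add[OF z0] by force
  qed
  then obtain d where d: "d \<in> A" "z - d \<in> S" by blast
  obtain k where "d - u_comb k \<in> ZA" using A_reducible[OF d(1)] unfolding reducible_def by blast
  then have "z - u_comb k \<in> S" using P_add[OF d(2) ZA_S] by force
  then show ?thesis by blast
qed

lemma residue_basis: "\<exists>B. residue_basis \<iota> S B"
proof (rule residue_basis_exists)
  let ?T = "u_comb ` ({..<g} \<rightarrow>\<^sub>E (UNIV :: 'k set))"
  show "finite ?T" using fin by (intro finite_imageI finite_PiE) auto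
  show "?T \<subseteq> V" using u_comb_A A_V by auto
  show "\<exists>\<tau>\<in>?T. z - \<tau> \<in> S" if "z \<in> V" for z
  proof -
    obtain k where k: "z - u_comb k \<in> S" using residue_u_comb[OF \<open>z \<in> V\<close>] by blast
    have "u_comb (restrict k {..<g}) = u_comb k" unfolding u_comb_def by (rule sum.cong) auto
    then show ?thesis using k by (intro bexI[of _ "u_comb k"] image_eqI[of _ _ "restrict k {..<g}"]) auto
  qed
qed

end

text \<open>
  The intersection of \<open>S\<close> with the ring determines, by descent, the values on the ring, and by
  expansions the place.
\<close>

lemma (in kummer_point) place_determined_by_ring:
  assumes S: "kummer_point_place h y m f \<iota> a l \<phi> S" and S': "kummer_point_place h y m f \<iota> a l \<phi> S'"
    and same: "\<And>c. c \<in> A \<Longrightarrow> c \<in> S \<longleftrightarrow> c \<in> S'"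
  shows "S = S'"
proof -
  interpret S: kummer_point_place h y m f \<iota> a l \<phi> S by (rule S)
  interpret S': kummer_point_place h y m f \<iota> a l \<phi> S' by (rule S')
  have v_A: "S.v c = S'.v c" if "c \<in> A" "c \<noteq> 0" for c
    using that
  proof (induction "nat (S.v c)" arbitrary: c rule: less_induct)
    case less
    show ?case
    proof (cases "c \<in> S")
      case False
      then show ?thesis
        using S.v_unit[OF S.A_V] S'.v_unit[OF S'.A_V] less.prems(1) same by simp
    next
      case True
      obtain d w where d: "d \<in> A" "w \<in> A" "w - 1 \<in> S" "c * w = Z * d"
        using S.descent[OF less.prems(1) True] by blast
      have "w - 1 \<in> S'" using same[OF A_diff[OF d(2) A_1]] d(3) by simp
      note vd = S.v_descent[OF less.prems(2) d(3,4)] and vd' = S'.v_descent[OF less.prems(2) this d(4)]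
      have "S.v c > 0" using True S.v_pos_iff[OF less.prems(2)] by simp
      then have "nat (S.v d) < nat (S.v c)" using vd(2) S.v_Z_pos by simp
      then have "S.v d = S'.v d" using less.hyps d(1) vd(1) by blast
      then show ?thesis using vd(2) vd'(2) S.v_Z S'.v_Z by simp
    qed
  qed
  have v_eq: "S.v z = S'.v z" if z: "z \<noteq> 0" for z
  proof -
    obtain N c where c: "\<And>i. c i \<in> A" "Z ^ N * z = (\<Sum>i<m'. c i * y ^ i)"
      using A_expansion[of z] by blast
    have nz: "Z ^ N * z \<noteq> 0" using Z_nonzero z by simp
    obtain i where i: "i < m'" "c i \<noteq> 0" "S.v (Z ^ N * z) = S.v (c i) + int i * int l'"
      using S.A_expansion_value(1)[OF c nz] unfolding S.v_y by blast
    obtain j where j: "j < m'" "c j \<noteq> 0" "S'.v (Z ^ N * z) = S'.v (c j) + int j * int l'"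
      using S'.A_expansion_value(1)[OF c nz] unfolding S'.v_y by blast
    have "S.v (Z ^ N * z) \<le> S.v (c j) + int j * int l'"
      using S.A_expansion_value(2)[OF c nz j(1,2)] unfolding S.v_y .
    moreover have "S'.v (Z ^ N * z) \<le> S'.v (c i) + int i * int l'"
      using S'.A_expansion_value(2)[OF c nz i(1,2)] unfolding S'.v_y .
    ultimately have "S.v (Z ^ N * z) = S'.v (Z ^ N * z)"
      using i(3) j(3) v_A[OF c(1) i(2)] v_A[OF c(1) j(2)] by linarith
    then show ?thesis
      using S.v_mult[of "Z ^ N" z] S'.v_mult[of "Z ^ N" z] S.v_power[OF Z_nonzero]
        S'.v_power[OF Z_nonzero] S.v_Z S'.v_Z z Z_nonzero by simp
  qed
  have "z \<in> S \<longleftrightarrow> z \<in> S'" for z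
    using S.v_pos_iff[of z] S'.v_pos_iff[of z] v_eq[of z] S.P_0 S'.P_0 by (cases "z = 0") auto
  then show ?thesis by blast
qed

lemma (in kummer_point) place_determined_by_residue:
  assumes S: "kummer_point_place h y m f \<iota> a l \<phi> S" and S': "kummer_point_place h y m f \<iota> a l \<phi> S'"
    and \<kappa>: "u - \<iota> \<kappa> \<in> S" "u - \<iota> \<kappa> \<in> S'"
  shows "S = S'"
proof (rule place_determined_by_ring[OF S S'])
  interpret S: kummer_point_place h y m f \<iota> a l \<phi> S by (rule S)
  interpret S': kummer_point_place h y m f \<iota> a l \<phi> S' by (rule S')
  have res: "\<exists>k. c - \<iota> k \<in> S \<and> c - \<iota> k \<in> S'" if "c \<in> A" for c
    using that
  proof (induction rule: A.induct)
    case (A_rat q p)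
    show ?case using rat_cong_const[OF A_rat] S.ZA_S S'.ZA_S by blast
  next
    case A_u
    show ?case using \<kappa> by blast
  next
    case (A_add c d)
    then obtain k k' where k: "c - \<iota> k \<in> S" "c - \<iota> k \<in> S'" "d - \<iota> k' \<in> S" "d - \<iota> k' \<in> S'" by blast
    have "c + d - \<iota> (k + k') = (c - \<iota> k) + (d - \<iota> k')"
      using emb_\<iota> by (simp add: field_embedding_def)
    then show ?case using S.P_add[OF k(1,3)] S'.P_add[OF k(2,4)] by metis
  next
    case (A_mult c d)
    then obtain k k' where k: "c - \<iota> k \<in> S" "c - \<iota> k \<in> S'" "d - \<iota> k' \<in> S" "d - \<iota> k' \<in> S'" by blast
    have "c * d - \<iota> (k * k') = (c - \<iota> k) * d + \<iota> k * (d - \<iota> k')"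
      using emb_\<iota> by (simp add: field_embedding_def algebra_simps)
    then show ?case
      using S.P_add[OF S.P_mult[OF k(1) S.A_V[OF A_mult(2)]] S.P_mult'[OF S.V_const k(3)]]
        S'.P_add[OF S'.P_mult[OF k(2) S'.A_V[OF A_mult(2)]] S'.P_mult'[OF S'.V_const k(4)]]
      by metis
  qed
  show "c \<in> S \<longleftrightarrow> c \<in> S'" if c: "c \<in> A" for c
  proof -
    obtain k where k: "c - \<iota> k \<in> S" "c - \<iota> k \<in> S'" using res[OF c] by blast
    have "c \<in> S \<longleftrightarrow> k = 0"
      using k(1) S.const_unique[of c k 0] field_embedding_0[OF emb_\<iota>] by auto
    moreover have "c \<in> S' \<longleftrightarrow> k = 0"
      using k(2) S'.const_unique[of c k 0] field_embedding_0[OF emb_\<iota>] by auto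
    ultimately show ?thesis by simp
  qed
qed

text \<open>
  Modulo \<open>x - a\<close> the ring is finite, so that only finitely many subsets of it can be the intersection
  with a place.
\<close>

lemma (in kummer_point) finite_places:
  assumes \<S>: "\<And>S. S \<in> \<S> \<Longrightarrow> kummer_point_place h y m f \<iota> a l \<phi> S"
  shows "finite \<S>"
proof -
  define K where "K = ({..<g} \<rightarrow>\<^sub>E (UNIV :: 'k set))"
  have "finite K" unfolding K_def using fin by (intro finite_PiE) auto
  define \<kappa> where "\<kappa> S = {k \<in> K. u_comb k \<in> S}" for S
  have "inj_on \<kappa> \<S>"
  proof (rule inj_onI)
    fix S S' assume S: "S \<in> \<S>" "S' \<in> \<S>" "\<kappa> S = \<kappa> S'"
    interpret S: kummer_point_place h y m f \<iota> a l \<phi> S by (rule \<S>[OF S(1)])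
    interpret S': kummer_point_place h y m f \<iota> a l \<phi> S' by (rule \<S>[OF S(2)])
    show "S = S'"
    proof (rule place_determined_by_ring)
      fix c assume "c \<in> A"
      then obtain k where k: "c - u_comb k \<in> ZA" using A_reducible unfolding reducible_def by blast
      define k' where "k' = restrict k {..<g}"
      have k': "k' \<in> K" "u_comb k' = u_comb k"
        by (auto simp: k'_def K_def u_comb_def intro!: sum.cong)
      have "c \<in> S \<longleftrightarrow> u_comb k \<in> S"
        using S.P_diff[of c "c - u_comb k"] S.P_add[of "c - u_comb k" "u_comb k"] S.ZA_S[OF k] by auto
      moreover have "c \<in> S' \<longleftrightarrow> u_comb k \<in> S'"
        using S'.P_diff[of c "c - u_comb k"] S'.P_add[of "c - u_comb k" "u_comb k"] S'.ZA_S[OF k] by auto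
      moreover have "u_comb k \<in> S \<longleftrightarrow> u_comb k \<in> S'"
        using S(3) k' unfolding \<kappa>_def by (metis (no_types, lifting) mem_Collect_eq)
      ultimately show "c \<in> S \<longleftrightarrow> c \<in> S'" by simp
    qed (use \<S> S in simp_all)
  qed
  moreover have "\<kappa> ` \<S> \<subseteq> Pow K" by (auto simp: \<kappa>_def)
  ultimately show ?thesis using \<open>finite K\<close> by (meson finite_Pow_iff inj_on_finite)
qed

text \<open>The residue of \<open>u\<close> at a rational place is a root of \<open>T ^ g - \<phi> a\<close>.\<close>

lemma (in kummer_point) card_rational_places:
  assumes \<S>: "\<And>S. S \<in> \<S> \<Longrightarrow> kummer_point_place h y m f \<iota> a l \<phi> S"
    and rat: "\<And>S z. S \<in> \<S> \<Longrightarrow> z \<in> place_ring S \<Longrightarrow> \<exists>c. z - \<iota> c \<in> S"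
  shows "card \<S> \<le> g"
proof -
  have "\<exists>\<kappa>. u - \<iota> \<kappa> \<in> S" if "S \<in> \<S>" for S
  proof -
    interpret S: kummer_point_place h y m f \<iota> a l \<phi> S by (rule \<S>[OF that])
    show ?thesis using rat[OF that S.A_V[OF A_u]] .
  qed
  then obtain \<kappa> where \<kappa>: "\<And>S. S \<in> \<S> \<Longrightarrow> u - \<iota> (\<kappa> S) \<in> S" by metis
  define \<psi> where "\<psi> = monom 1 g + [:- poly \<phi> a:]"
  have "inj_on \<kappa> \<S>" using place_determined_by_residue \<S> \<kappa> by (intro inj_onI) metis
  moreover have "\<kappa> ` \<S> \<subseteq> {c. poly \<psi> c = 0}"
  proof
    fix c assume "c \<in> \<kappa> ` \<S>"
    then obtain S where S: "S \<in> \<S>" "c = \<kappa> S" by auto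
    interpret S: kummer_point_place h y m f \<iota> a l \<phi> S by (rule \<S>[OF S(1)])
    have uc: "u - \<iota> c \<in> S" using \<kappa> S by simp
    have "u ^ n - \<iota> (c ^ n) \<in> S" for n
    proof (induction n)
      case (Suc n)
      have "u ^ Suc n - \<iota> (c ^ Suc n) = (u - \<iota> c) * u ^ n + \<iota> c * (u ^ n - \<iota> (c ^ n))"
        using emb_\<iota> by (simp add: field_embedding_def algebra_simps)
      then show ?case
        using S.P_add[OF S.P_mult[OF uc S.A_V[OF A_power[OF A_u]]] S.P_mult'[OF S.V_const Suc]] by metis
    qed (use S.P_0 emb_\<iota> in \<open>simp add: field_embedding_def\<close>)
    from this[of g] have "u ^ g - \<iota> (c ^ g) \<in> S" .
    moreover have "u ^ g - \<iota> (poly \<phi> a) \<in> S"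
      using S.ZA_S[OF rat_cong_const[of 1 \<phi>]] by (simp add: u_power)
    ultimately have "c ^ g = poly \<phi> a" by (rule S.const_unique)
    then show "c \<in> {c. poly \<psi> c = 0}" by (simp add: \<psi>_def poly_monom)
  qed
  moreover have deg: "degree \<psi> = g"
    using g_pos unfolding \<psi>_def by (subst degree_add_eq_left) (auto simp: degree_monom_eq)
  then have "\<psi> \<noteq> 0" using g_pos by auto
  then have "card {c. poly \<psi> c = 0} \<le> g" "finite {c. poly \<psi> c = 0}"
    using card_poly_roots_bound[of \<psi>] deg poly_roots_finite by auto
  ultimately show ?thesis by (metis card_inj_on_le le_trans)
qed

section \<open>Riemann-Roch spaces\<close>

locale function_field =
  fixes \<iota> :: "'k::field \<Rightarrow> 'f::field"
  assumes emb: "field_embedding \<iota>"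
    and discrete: "\<And>P. P \<in> places \<iota> \<Longrightarrow> discrete_place \<iota> P"
begin

sublocale ks: vector_space "\<lambda>c z. \<iota> c * z"
  using emb by unfold_locales (auto simp: field_embedding_def algebra_simps)

declare ks.scale_scale [simp del] ks.scale_right_distrib [simp del] ks.scale_left_distrib [simp del]

abbreviation L :: "('f set \<Rightarrow>\<^sub>0 int) \<Rightarrow> 'f set" where "L \<equiv> RR_space \<iota>"

lemma ell_eq: "ell \<iota> B = ks.dim (L B)"
  by (simp add: ell_def dim_via_def)

lemma RR_I: "(\<And>P. z \<noteq> 0 \<Longrightarrow> P \<in> places \<iota> \<Longrightarrow> - Poly_Mapping.lookup B P \<le> place_val P z) \<Longrightarrow> z \<in> L B"
  by (auto simp: RR_space_def)

lemma RR_D: "z \<in> L B \<Longrightarrow> z \<noteq> 0 \<Longrightarrow> P \<in> places \<iota> \<Longrightarrow> - Poly_Mapping.lookup B P \<le> place_val P z"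
  by (auto simp: RR_space_def)

lemma RR_0: "0 \<in> L B"
  by (simp add: RR_space_def)

lemma RR_add: assumes "z \<in> L B" "w \<in> L B" shows "z + w \<in> L B"
proof (rule RR_I)
  fix P assume nz: "z + w \<noteq> 0" and P: "P \<in> places \<iota>"
  interpret discrete_place \<iota> P by (rule discrete[OF P])
  have "z \<in> v_ge (- Poly_Mapping.lookup B P)" "w \<in> v_ge (- Poly_Mapping.lookup B P)"
    using assms P by (auto simp: v_ge_def intro: RR_D)
  then show "- Poly_Mapping.lookup B P \<le> place_val P (z + w)"
    using v_ge_add[of z _ w] nz by (auto simp: v_ge_def)
qed

lemma RR_scale: assumes "z \<in> L B" shows "\<iota> c * z \<in> L B"
proof (rule RR_I)
  fix P assume nz: "\<iota> c * z \<noteq> 0" and P: "P \<in> places \<iota>"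
  interpret discrete_place \<iota> P by (rule discrete[OF P])
  have "c \<noteq> 0" "z \<noteq> 0" using nz field_embedding_0[OF emb] by auto
  then show "- Poly_Mapping.lookup B P \<le> place_val P (\<iota> c * z)"
    using v_mult[of "\<iota> c" z] v_const[of c] const_0[of c] RR_D[OF assms _ P] by simp
qed

lemma RR_subspace: "ks.subspace (L B)"
  unfolding ks.subspace_def using RR_0 RR_add RR_scale by simp

lemma RR_diff: "z \<in> L B \<Longrightarrow> w \<in> L B \<Longrightarrow> z - w \<in> L B"
  by (rule ks.subspace_diff[OF RR_subspace])

lemma RR_mono:
  assumes "\<And>P. P \<in> places \<iota> \<Longrightarrow> Poly_Mapping.lookup B P \<le> Poly_Mapping.lookup C P"
  shows "L B \<subseteq> L C"
proof
  fix z assume z: "z \<in> L B"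
  show "z \<in> L C" by (rule RR_I) (use RR_D[OF z] assms in fastforce)
qed

lemma RR_mult:
  assumes z: "z \<in> L B" and w: "w \<noteq> 0"
    and C: "\<And>P. P \<in> places \<iota> \<Longrightarrow> Poly_Mapping.lookup C P = Poly_Mapping.lookup B P - place_val P w"
  shows "z * w \<in> L C"
proof (rule RR_I)
  fix P assume nz: "z * w \<noteq> 0" and P: "P \<in> places \<iota>"
  interpret discrete_place \<iota> P by (rule discrete[OF P])
  show "- Poly_Mapping.lookup C P \<le> place_val P (z * w)"
    using RR_D[OF z _ P] C[OF P] v_mult[of z w] nz by auto
qed

text \<open>
  Over a place whose residue field consists of constants, leading coefficients can be cancelled,
  so that allowing one more pole there raises the dimension by at most one.
\<close>

lemma RR_add_place:
  assumes Q: "Q \<in> places \<iota>" and res: "\<And>z. z \<in> place_ring Q \<Longrightarrow> \<exists>c. z - \<iota> c \<in> Q"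
    and B: "finite B" "L C \<subseteq> ks.span B"
  shows "\<exists>B'. finite B' \<and> card B' \<le> Suc (card B) \<and> L (C + Poly_Mapping.single Q 1) \<subseteq> ks.span B'"
proof (cases "L (C + Poly_Mapping.single Q 1) \<subseteq> L C")
  case True
  then show ?thesis using B by (intro exI[of _ B]) auto
next
  case False
  let ?C = "C + Poly_Mapping.single Q 1"
  obtain w where w: "w \<in> L ?C" "w \<notin> L C" using False by blast
  interpret Q: discrete_place \<iota> Q by (rule discrete[OF Q])
  have look: "Poly_Mapping.lookup ?C P = Poly_Mapping.lookup C P + (if P = Q then 1 else 0)" for P
    by (simp add: lookup_add lookup_single when_def)
  have w0: "w \<noteq> 0" using w RR_0 by auto
  have vw: "Q.v w = - Poly_Mapping.lookup C Q - 1"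
  proof (rule ccontr)
    assume ne: "Q.v w \<noteq> - Poly_Mapping.lookup C Q - 1"
    have "w \<in> L C"
    proof (rule RR_I)
      fix P assume P: "P \<in> places \<iota>"
      show "- Poly_Mapping.lookup C P \<le> place_val P w"
        using RR_D[OF w(1) w0 P] look[of P] ne by (cases "P = Q") auto
    qed
    then show False using w by simp
  qed
  have "z \<in> ks.span (insert w B)" if z: "z \<in> L ?C" for z
  proof -
    have "z / w \<in> Q.V"
    proof (cases "z = 0")
      case False
      then show ?thesis
        using Q.v_nonneg_iff[of "z / w"] Q.v_divide[of z w] w0 RR_D[OF z False Q] look[of Q] vw by simp
    qed (simp add: Q.V_0)
    then obtain c where c: "z / w - \<iota> c \<in> Q" using res by blast
    define d where "d = z - \<iota> c * w"
    have dC: "d \<in> L ?C" unfolding d_def using z w by (intro RR_diff RR_scale)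
    have "d \<in> L C"
    proof (rule RR_I)
      fix P assume d0: "d \<noteq> 0" and P: "P \<in> places \<iota>"
      show "- Poly_Mapping.lookup C P \<le> place_val P d"
      proof (cases "P = Q")
        case True
        have eq: "d = w * (z / w - \<iota> c)" using w0 by (simp add: d_def algebra_simps)
        then have nz: "z / w - \<iota> c \<noteq> 0" using d0 by auto
        then have "Q.v (z / w - \<iota> c) > 0" using c Q.v_pos_iff by blast
        then have "Q.v d \<ge> Q.v w + 1" unfolding eq using Q.v_mult[OF w0 nz] by simp
        then show ?thesis using vw True by simp
      next
        case False
        then show ?thesis using RR_D[OF dC d0 P] look[of P] by simp
      qed
    qed
    then have "d \<in> ks.span (insert w B)" using B(2) ks.span_mono[of B "insert w B"] by auto
    moreover have "\<iota> c * w \<in> ks.span (insert w B)" by (intro ks.span_scale ks.span_base) simp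
    moreover have "z = d + \<iota> c * w" by (simp add: d_def)
    ultimately show ?thesis by (metis ks.span_add)
  qed
  moreover have "card (insert w B) \<le> Suc (card B)" by (rule card_insert_le_m1) auto
  ultimately show ?thesis using B(1) by (intro exI[of _ "insert w B"]) auto
qed

lemma RR_add_places:
  assumes Q: "Q \<in> places \<iota>" and res: "\<And>z. z \<in> place_ring Q \<Longrightarrow> \<exists>c. z - \<iota> c \<in> Q"
    and E: "L E = {0}"
  shows "\<exists>B. finite B \<and> card B \<le> k \<and> L (E + Poly_Mapping.single Q (int k)) \<subseteq> ks.span B"
proof (induction k)
  case 0
  then show ?case using E by (intro exI[of _ "{}"]) simp
next
  case (Suc k)
  then obtain B where B: "finite B" "card B \<le> k" "L (E + Poly_Mapping.single Q (int k)) \<subseteq> ks.span B" by blast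
  have "E + Poly_Mapping.single Q (int (Suc k)) = (E + Poly_Mapping.single Q (int k)) + Poly_Mapping.single Q 1"
    by (simp add: add.assoc add.commute[of 1] flip: single_add)
  then show ?case using RR_add_place[OF Q res B(1,3)] B(2) by (metis Suc_le_mono le_trans)
qed

lemma div_degree_superset:
  assumes "finite K" "Poly_Mapping.keys B \<subseteq> K"
  shows "div_degree \<iota> B = (\<Sum>P\<in>K. Poly_Mapping.lookup B P * int (place_degree \<iota> P))"
  unfolding div_degree_def using assms
  by (intro sum.mono_neutral_left) (auto simp: in_keys_iff)

lemma div_degree_add: "div_degree \<iota> (B + C) = div_degree \<iota> B + div_degree \<iota> C"
proof -
  let ?K = "Poly_Mapping.keys B \<union> Poly_Mapping.keys C"
  have "Poly_Mapping.keys (B + C) \<subseteq> ?K" by (rule Poly_Mapping.keys_add)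
  then show ?thesis
    using div_degree_superset[of ?K "B + C"] div_degree_superset[of ?K B] div_degree_superset[of ?K C]
    by (simp add: lookup_add distrib_right sum.distrib)
qed

lemma div_degree_single: "div_degree \<iota> (Poly_Mapping.single Q k) = k * int (place_degree \<iota> Q)"
  using div_degree_superset[of "{Q}" "Poly_Mapping.single Q k"] by simp

text \<open>
  The dimension of an infinite-dimensional space is 0 by convention, so a vanishing dimension does
  not by itself give the zero space. An infinite-dimensional space would remain so after adding
  \<open>Q\<close>, and the divisor \<open>E + Q\<close> of degree \<open>g\<close> would violate the bound that defines the genus.
\<close>

lemma nonspecial_degree_minus_1:
  assumes Q: "Q \<in> places \<iota>" and deg: "place_degree \<iota> Q = 1"
    and genus: "has_genus \<iota> g" and E: "non_special \<iota> g E" "div_degree \<iota> E = int g - 1"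
  shows "L E = {0}"
proof (rule ccontr)
  assume "L E \<noteq> {0}"
  then obtain z where z: "z \<in> L E" "z \<noteq> 0" using RR_0 by auto
  let ?E = "E + Poly_Mapping.single Q 1"
  have dim0: "ks.dim (L E) = 0" using E by (simp add: non_special_def ell_eq)
  obtain B where B: "B \<subseteq> L E" "ks.independent B" "L E \<subseteq> ks.span B" "card B = ks.dim (L E)"
    by (rule ks.basis_exists)
  have "infinite B"
  proof
    assume "finite B"
    then have "B = {}" using B(4) dim0 by simp
    then show False using B(3) z by auto
  qed
  obtain B' where B': "B' \<subseteq> L ?E" "ks.independent B'" "L ?E \<subseteq> ks.span B'" "card B' = ks.dim (L ?E)"
    by (rule ks.basis_exists)
  have "L E \<subseteq> L ?E" by (rule RR_mono) (simp add: lookup_add lookup_single when_def)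
  then have "infinite B'"
    using ks.independent_span_bound[OF _ B(2), of B'] B(1) B'(3) \<open>infinite B\<close> by blast
  then have "ell \<iota> ?E = 0" using B'(4) by (simp add: ell_eq)
  moreover have "?E \<in> divisors \<iota>"
    using E Q Poly_Mapping.keys_add[of E "Poly_Mapping.single Q 1"]
    by (auto simp: non_special_def divisors_def split: if_splits)
  then have "div_degree \<iota> ?E - int (ell \<iota> ?E) + 1 \<le> int g" using genus by (auto simp: has_genus_def)
  ultimately show False using E(2) deg by (simp add: div_degree_add div_degree_single)
qed

text \<open>
  Adding \<open>Q\<close> to \<open>E\<close> \<open>k\<close> times gives at most dimension \<open>k\<close>, one for each step, and the definition of the
  genus as a maximum gives at least this dimension.
\<close>

lemma RR_dimension:
  assumes Q: "Q \<in> places \<iota>" and res: "\<And>z. z \<in> place_ring Q \<Longrightarrow> \<exists>c. z - \<iota> c \<in> Q"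
    and deg: "place_degree \<iota> Q = 1"
    and genus: "has_genus \<iota> g" and E: "non_special \<iota> g E" "div_degree \<iota> E = int g - 1"
  shows "ks.dim (L (E + Poly_Mapping.single Q (int k))) = k"
    "\<exists>B. finite B \<and> L (E + Poly_Mapping.single Q (int k)) \<subseteq> ks.span B"
proof -
  let ?E = "E + Poly_Mapping.single Q (int k)"
  obtain B where B: "finite B" "card B \<le> k" "L ?E \<subseteq> ks.span B"
    using RR_add_places[OF Q res nonspecial_degree_minus_1[OF Q deg genus E]] by blast
  then show "\<exists>B. finite B \<and> L ?E \<subseteq> ks.span B" by blast
  have "ks.dim (L ?E) \<le> k" using ks.dim_le_card[OF B(3,1)] B(2) by simp
  moreover have "?E \<in> divisors \<iota>"
    using E Q Poly_Mapping.keys_add[of E "Poly_Mapping.single Q (int k)"]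
    by (auto simp: non_special_def divisors_def split: if_splits)
  then have "div_degree \<iota> ?E - int (ell \<iota> ?E) + 1 \<le> int g" using genus by (auto simp: has_genus_def)
  then have "int k \<le> int (ks.dim (L ?E))"
    using E(2) deg by (simp add: div_degree_add div_degree_single ell_eq)
  ultimately show "ks.dim (L ?E) = k" by simp
qed

text \<open>
  The map is linear on the subspace only (evaluation is meaningless at a pole); it is replaced by a
  linear map on the whole field that agrees with it on a basis.
\<close>

lemma dim_image:
  assumes W: "ks.subspace W" and fin: "finite B" "W \<subseteq> ks.span B"
    and lin: "\<And>z w. z \<in> W \<Longrightarrow> w \<in> W \<Longrightarrow> T (z + w) = T z + T w"
      "\<And>c z. z \<in> W \<Longrightarrow> T (\<iota> c * z) = c *s T z"
    and inj: "inj_on T W"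
  shows "vec.subspace (T ` W)" "vec.dim (T ` W :: ('k ^ 'n::finite) set) = ks.dim W"
proof -
  interpret vp: vector_space_pair "\<lambda>c z. \<iota> c * z" "(*s) :: 'k \<Rightarrow> 'k ^ 'n \<Rightarrow> 'k ^ 'n"
    by unfold_locales
  obtain B' where B': "B' \<subseteq> W" "ks.independent B'" "W \<subseteq> ks.span B'" "card B' = ks.dim W"
    by (rule ks.basis_exists)
  have span: "ks.span B' = W" using B' W by (metis ks.span_minimal subset_antisym)
  obtain T' where T': "Vector_Spaces.linear (\<lambda>c z. \<iota> c * z) (*s) T'" "\<forall>b\<in>B'. T' b = T b"
    using vp.linear_independent_extend[OF B'(2), of T] by blast
  interpret T': Vector_Spaces.linear "\<lambda>c z. \<iota> c * z" "(*s)" T' by (rule T'(1))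
  have T0: "T 0 = 0" using lin(1)[of 0 0] ks.subspace_0[OF W] by simp
  have eq: "T' z = T z \<and> z \<in> W" if "z \<in> ks.span B'" for z
    using that
  proof (induction rule: ks.span_induct_alt)
    case base
    show ?case using T0 ks.subspace_0[OF W] T'.zero by simp
  next
    case (step c x z)
    have "x \<in> W" using step B'(1) by blast
    then have cx: "\<iota> c * x \<in> W" by (rule ks.subspace_scale[OF W])
    then have "T (\<iota> c * x + z) = c *s T x + T z" using lin \<open>x \<in> W\<close> step by simp
    moreover have "T' (\<iota> c * x + z) = c *s T' x + T' z" by (simp add: T'.add T'.scale)
    ultimately show ?case using step T'(2) ks.subspace_add[OF W cx] by simp
  qed
  have im: "T ` W = T' ` ks.span B'" using eq span by (metis image_cong)
  have span_im: "vec.span (T' ` B') = T ` W" using T'.span_image[of B'] im by simp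
  show "vec.subspace (T ` W)" unfolding span_im[symmetric] by (rule vec.subspace_span)
  have inj': "inj_on T' (ks.span B')" using inj eq span by (metis inj_on_cong)
  have "vec.independent (T' ` B')" by (rule T'.independent_injective_image[OF B'(2) inj'])
  then have "vec.dim (T ` W) = card (T' ` B')" unfolding span_im[symmetric] by (rule vec.dim_span_eq_card_independent)
  also have "\<dots> = card B'" using inj' ks.span_superset[of B'] by (intro card_image) (rule inj_on_subset)
  finally show "vec.dim (T ` W) = ks.dim W" using B'(4) by simp
qed

end


section \<open>Linear complementary pairs of evaluation codes\<close>

lemma linear_complementary_pairI:
  fixes C1 C2 :: "('k::field ^ 'n::finite) set"
  assumes "vec.subspace C1" "vec.subspace C2" "C1 \<inter> C2 = {0}" "vec.dim C1 + vec.dim C2 = CARD('n)"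
  shows "linear_complementary_pair C1 C2"
proof -
  let ?S = "{u + v |u v. u \<in> C1 \<and> v \<in> C2}"
  have "vec.dim ?S = CARD('n)" using vec.dim_sums_Int[OF assms(1,2)] assms(3,4) by simp
  then have "vec.dim (UNIV :: ('k ^ 'n) set) \<le> vec.dim ?S" by (simp only: vec_dim_card)
  then have "?S = UNIV"
    using vec.subspace_dim_equal[OF vec.subspace_sums[OF assms(1,2)] vec.subspace_UNIV] by simp
  then show ?thesis using assms by (simp add: linear_complementary_pair_def)
qed

text \<open>
  The function \<open>\<psi>\<close> has at most simple zeros, only at the evaluation places \<open>R i\<close>, and a pole at \<open>Q\<close> whose
  order is at least their number; \<open>w\<close> has no pole other than \<open>Q\<close>, and value 0 at the \<open>R i\<close>. If \<open>z\<close> in \<open>L G\<close> and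
  \<open>z'\<close> in \<open>L H\<close> have the same values at all \<open>R i\<close>, then \<open>(z - z') * w / \<psi>\<close> lies in \<open>L E\<close>, which is zero,
  so \<open>z = z'\<close>. Since \<open>E\<close> is the greatest lower bound of \<open>G\<close> and \<open>H\<close>, this common function vanishes
  too. With one of the functions equal to 0, this is the injectivity of evaluation, whence the
  dimensions of the codes are those of the Riemann-Roch spaces.
\<close>

locale evaluation_pair = function_field \<iota>
  for \<iota> :: "'k::field \<Rightarrow> 'f::field" +
  fixes Q :: "'f set" and R :: "'n::finite \<Rightarrow> 'f set" and E G H :: "'f set \<Rightarrow>\<^sub>0 int"
    and w \<psi> :: 'f and k1 k2 g :: nat
  assumes Q: "Q \<in> places \<iota>" and Q_res: "\<And>z. z \<in> place_ring Q \<Longrightarrow> \<exists>c. z - \<iota> c \<in> Q"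
    and Q_deg: "place_degree \<iota> Q = 1"
    and genus: "has_genus \<iota> g" and E: "non_special \<iota> g E" "div_degree \<iota> E = int g - 1"
    and R: "\<And>i. R i \<in> places \<iota>" and R_res: "\<And>i z. z \<in> place_ring (R i) \<Longrightarrow> \<exists>c. z - \<iota> c \<in> R i"
    and R_Q: "\<And>i. R i \<noteq> Q" and E_R: "\<And>i. Poly_Mapping.lookup E (R i) = 0"
    and k: "k1 + k2 = CARD('n)"
    and w: "w \<noteq> 0" "\<And>P. P \<in> places \<iota> \<Longrightarrow> P \<noteq> Q \<Longrightarrow> place_val P w \<ge> 0"
      "place_val Q w = - int k2" "\<And>i. place_val (R i) w = 0"
    and \<psi>: "\<psi> \<noteq> 0" "\<And>P. P \<in> places \<iota> \<Longrightarrow> P \<noteq> Q \<Longrightarrow> P \<notin> range R \<Longrightarrow> place_val P \<psi> \<le> 0"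
      "\<And>i. place_val (R i) \<psi> \<le> 1" "place_val Q \<psi> \<le> - int CARD('n)"
    and G: "G = E + Poly_Mapping.single Q (int k1)"
    and H: "\<And>P. P \<in> places \<iota> \<Longrightarrow> Poly_Mapping.lookup H P =
      Poly_Mapping.lookup E P + place_val P w + (if P = Q then int k2 else 0)"
begin

lemma L_E: "L E = {0}"
  by (rule nonspecial_degree_minus_1[OF Q Q_deg genus E])

lemma lookup_G: "Poly_Mapping.lookup G P = Poly_Mapping.lookup E P + (if P = Q then int k1 else 0)"
  by (simp add: G lookup_add lookup_single when_def)

definition ev :: "'f \<Rightarrow> 'k ^ 'n" where "ev z = (\<chi> i. place_eval \<iota> (R i) z)"

lemma ag_code_eq: "ag_code \<iota> R C = ev ` L C"
  by (auto simp: ag_code_def ev_def)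

definition regular :: "'f set" where "regular = {z. \<forall>i. z \<in> place_ring (R i)}"

lemma RR_regular:
  assumes "\<And>i. Poly_Mapping.lookup C (R i) = 0" shows "L C \<subseteq> regular"
proof
  fix z assume z: "z \<in> L C"
  show "z \<in> regular" unfolding regular_def
  proof (intro CollectI allI)
    fix i
    interpret discrete_place \<iota> "R i" by (rule discrete[OF R])
    show "z \<in> place_ring (R i)"
      using RR_D[OF z _ R, of i] assms[of i] v_nonneg_iff[of z] V_0 by (cases "z = 0") auto
  qed
qed

lemma ev_eqI: assumes "\<And>i. z - \<iota> (x $ i) \<in> R i" shows "ev z = x"
proof -
  have "place_eval \<iota> (R i) z = x $ i" for i
  proof -
    interpret discrete_place \<iota> "R i" by (rule discrete[OF R])
    show ?thesis by (rule eval_eq[OF assms])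
  qed
  then show ?thesis by (simp add: ev_def vec_eq_iff)
qed

lemma ev_residue: fixes i :: 'n assumes "z \<in> regular" shows "z - \<iota> (ev z $ i) \<in> R i"
proof -
  interpret discrete_place \<iota> "R i" by (rule discrete[OF R])
  obtain c where c: "z - \<iota> c \<in> R i" using R_res[of z i] assms by (auto simp: regular_def)
  then show ?thesis using eval_eq[OF c] by (simp add: ev_def)
qed

lemma ev_add: assumes "z \<in> regular" "z' \<in> regular" shows "ev (z + z') = ev z + ev z'"
proof (rule ev_eqI)
  fix i
  interpret discrete_place \<iota> "R i" by (rule discrete[OF R])
  have "z + z' - \<iota> ((ev z + ev z') $ i) = (z - \<iota> (ev z $ i)) + (z' - \<iota> (ev z' $ i))"
    using emb by (simp add: field_embedding_def)
  then show "z + z' - \<iota> ((ev z + ev z') $ i) \<in> R i"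
    using P_add[OF ev_residue[OF assms(1), of i] ev_residue[OF assms(2), of i]] by metis
qed

lemma ev_scale: assumes "z \<in> regular" shows "ev (\<iota> c * z) = c *s ev z"
proof (rule ev_eqI)
  fix i
  interpret discrete_place \<iota> "R i" by (rule discrete[OF R])
  have "\<iota> c * z - \<iota> ((c *s ev z) $ i) = \<iota> c * (z - \<iota> (ev z $ i))"
    using emb by (simp add: field_embedding_def right_diff_distrib)
  then show "\<iota> c * z - \<iota> ((c *s ev z) $ i) \<in> R i"
    using P_mult'[OF V_const[of c] ev_residue[OF assms, of i]] by metis
qed

lemma v_w_R_H: "Poly_Mapping.lookup H (R i) = 0" and lookup_G_R: "Poly_Mapping.lookup G (R i) = 0"
  using H[OF R, of i] R_Q[of i] E_R w(4) lookup_G[of "R i"] by simp_all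

lemma G_regular: "z \<in> L G \<Longrightarrow> z \<in> regular" and H_regular: "z \<in> L H \<Longrightarrow> z \<in> regular"
  using RR_regular[of G] RR_regular[of H] v_w_R_H lookup_G_R by auto

lemma same_values_imp_0:
  assumes z: "z \<in> L G" and z': "z' \<in> L H" and eq: "ev z = ev z'"
  shows "z = 0" "z' = 0"
proof -
  define d where "d = z - z'"
  have dR: "d \<in> R i" for i
  proof -
    interpret discrete_place \<iota> "R i" by (rule discrete[OF R])
    have "d = (z - \<iota> (ev z $ i)) - (z' - \<iota> (ev z' $ i))" using eq by (simp add: d_def)
    then show ?thesis
      using P_diff[OF ev_residue[OF G_regular[OF z], of i] ev_residue[OF H_regular[OF z'], of i]] by metis
  qed
  have "d * w / \<psi> \<in> L E"
  proof (rule RR_I)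
    fix P assume nz: "d * w / \<psi> \<noteq> 0" and P: "P \<in> places \<iota>"
    interpret discrete_place \<iota> P by (rule discrete[OF P])
    have d0: "d \<noteq> 0" using nz by auto
    have v: "v (d * w / \<psi>) = v d + v w - v \<psi>"
      using v_divide[of "d * w" \<psi>] v_mult[of d w] d0 w(1) \<psi>(1) by simp
    have G': "z \<in> v_ge (- Poly_Mapping.lookup G P)" and H': "z' \<in> v_ge (- Poly_Mapping.lookup H P)"
      using RR_D[OF z _ P] RR_D[OF z' _ P] by (auto simp: v_ge_def)
    have low: "v d \<ge> b" if "b \<le> - Poly_Mapping.lookup G P" "b \<le> - Poly_Mapping.lookup H P" for b
    proof -
      have "z \<in> v_ge b" "- z' \<in> v_ge b" using G' H' that by (auto simp: v_ge_def v_uminus)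
      then have "z + - z' \<in> v_ge b" by (rule v_ge_add)
      then show ?thesis using d0 by (simp add: v_ge_def d_def)
    qed
    show "- Poly_Mapping.lookup E P \<le> v (d * w / \<psi>)"
    proof (cases "P = Q")
      case True
      have "v d \<ge> - Poly_Mapping.lookup E P - int k1"
        using True H[OF P] w(3) by (intro low) (simp_all add: lookup_G)
      then show ?thesis using True v w(3) \<psi>(4) k by simp
    next
      case False
      show ?thesis
      proof (cases "P \<in> range R")
        case True
        then obtain i where i: "P = R i" by blast
        have "v d \<ge> 1" using v_pos_iff[OF d0] dR[of i] i by simp
        then show ?thesis using v i w(4)[of i] \<psi>(3)[of i] E_R[of i] by simp
      next
        case nR: False
        have "v d \<ge> - Poly_Mapping.lookup E P - v w"
          using False H[OF P] w(2)[OF P False] by (intro low) (simp_all add: lookup_G)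
        then show ?thesis using v \<psi>(2)[OF P False nR] by simp
      qed
    qed
  qed
  then have "d = 0" using L_E w(1) \<psi>(1) by simp
  then have zz: "z = z'" by (simp add: d_def)
  have "z \<in> L E"
  proof (rule RR_I)
    fix P assume z0: "z \<noteq> 0" and P: "P \<in> places \<iota>"
    show "- Poly_Mapping.lookup E P \<le> place_val P z"
      using RR_D[OF z z0 P] RR_D[OF z', of P] zz z0 P H[OF P] w(3)
      by (cases "P = Q") (simp_all add: lookup_G)
  qed
  then show "z = 0" "z' = 0" using L_E zz by auto
qed

lemma ev_0: "ev 0 = 0"
  using ev_scale[of 0 0] G_regular[OF RR_0] by simp

lemma ev_inj_on:
  assumes C: "C = G \<or> C = H" shows "inj_on ev (L C)"
proof (rule inj_onI)
  fix z z' assume z: "z \<in> L C" "z' \<in> L C" "ev z = ev z'"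
  have reg: "z \<in> regular" "z' \<in> regular" "z - z' \<in> regular"
    using z RR_diff[OF z(1,2)] C G_regular H_regular by auto
  have "ev z = ev (z - z') + ev z'" using ev_add[OF reg(3,2)] by simp
  then have "ev (z - z') = 0" using z(3) by simp
  then have "z - z' = 0"
    using C same_values_imp_0(1)[of "z - z'" 0] same_values_imp_0(2)[of 0 "z - z'"]
      RR_diff[OF z(1,2)] RR_0 ev_0 by auto
  then show "z = z'" by simp
qed

text \<open>The divisor \<open>H\<close> differs from \<open>E + k2 * Q\<close> by that of \<open>w\<close>.\<close>

lemma L_H_image: "(\<lambda>z. z * inverse w) ` L (E + Poly_Mapping.single Q (int k2)) = L H"
proof -
  let ?C = "E + Poly_Mapping.single Q (int k2)"
  have look: "Poly_Mapping.lookup ?C P = Poly_Mapping.lookup H P - place_val P w" if "P \<in> places \<iota>" for P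
    using H[OF that] by (simp add: lookup_add lookup_single when_def)
  have inv: "place_val P (inverse w) = - place_val P w" if "P \<in> places \<iota>" for P
  proof -
    interpret discrete_place \<iota> P by (rule discrete[OF that])
    show ?thesis by (rule v_inverse[OF w(1)])
  qed
  show ?thesis
  proof (intro set_eqI iffI)
    fix z assume "z \<in> (\<lambda>z. z * inverse w) ` L ?C"
    then obtain z0 where "z0 \<in> L ?C" "z = z0 * inverse w" by auto
    then show "z \<in> L H" using RR_mult[of z0 ?C "inverse w" H] look inv w(1) by simp
  next
    fix z assume "z \<in> L H"
    then have "z * w \<in> L ?C" using RR_mult[of z H w ?C] look w(1) by simp
    moreover have "z = (z * w) * inverse w" using w(1) by simp
    ultimately show "z \<in> (\<lambda>z. z * inverse w) ` L ?C" by blast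
  qed
qed

lemma code_G: "vec.subspace (ag_code \<iota> R G)" "vec.dim (ag_code \<iota> R G) = k1"
proof -
  obtain B where B: "finite B" "L G \<subseteq> ks.span B"
    using RR_dimension(2)[OF Q Q_res Q_deg genus E] unfolding G by blast
  show "vec.subspace (ag_code \<iota> R G)" "vec.dim (ag_code \<iota> R G) = k1"
    unfolding ag_code_eq
    using dim_image[OF RR_subspace B, of ev] ev_add ev_scale G_regular ev_inj_on
      RR_dimension(1)[OF Q Q_res Q_deg genus E, of k1]
    by (simp_all add: G[symmetric])
qed

lemma code_H: "vec.subspace (ag_code \<iota> R H)" "vec.dim (ag_code \<iota> R H) = k2"
proof -
  let ?W = "L (E + Poly_Mapping.single Q (int k2))" and ?T = "\<lambda>z. ev (z * inverse w)"
  obtain B where B: "finite B" "?W \<subseteq> ks.span B"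
    using RR_dimension(2)[OF Q Q_res Q_deg genus E] by blast
  have LH: "z * inverse w \<in> L H" if "z \<in> ?W" for z using that L_H_image by blast
  have im: "?T ` ?W = ag_code \<iota> R H"
    unfolding ag_code_eq L_H_image[symmetric] by (simp add: image_image)
  have add: "?T (z + z') = ?T z + ?T z'" if "z \<in> ?W" "z' \<in> ?W" for z z'
    using ev_add[OF H_regular[OF LH[OF that(1)]] H_regular[OF LH[OF that(2)]]]
    by (simp add: distrib_right)
  have scale: "?T (\<iota> c * z) = c *s ?T z" if "z \<in> ?W" for c z
    using ev_scale[OF H_regular[OF LH[OF that]], of c] by (simp add: mult.assoc)
  have inj: "inj_on ?T ?W"
  proof (rule inj_onI)
    fix z z' assume z: "z \<in> ?W" "z' \<in> ?W" "?T z = ?T z'"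
    have "z * inverse w = z' * inverse w"
      using inj_onD[OF ev_inj_on z(3) LH[OF z(1)] LH[OF z(2)]] by simp
    then show "z = z'" using w(1) by simp
  qed
  show "vec.subspace (ag_code \<iota> R H)" "vec.dim (ag_code \<iota> R H) = k2"
    using dim_image[OF RR_subspace B add scale inj] RR_dimension(1)[OF Q Q_res Q_deg genus E, of k2]
    unfolding im by simp_all
qed

theorem complementary: "linear_complementary_pair (ag_code \<iota> R G) (ag_code \<iota> R H)"
proof (rule linear_complementary_pairI)
  show "ag_code \<iota> R G \<inter> ag_code \<iota> R H = {0}"
  proof
    show "ag_code \<iota> R G \<inter> ag_code \<iota> R H \<subseteq> {0}"
      unfolding ag_code_eq using same_values_imp_0 ev_0 by auto
    show "{0} \<subseteq> ag_code \<iota> R G \<inter> ag_code \<iota> R H"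
      using code_G(1) code_H(1) vec.subspace_0 by auto
  qed
qed (use code_G code_H k in simp_all)

end

section \<open>Divisors of \<open>y\<close> and of \<open>x - b\<close> on a Kummer curve\<close>

text \<open>
  On rational functions, the value at \<open>S\<close> is the value at the restriction of \<open>S\<close> times that of a prime
  element of the restriction; this factor is the ramification index.
\<close>

lemma (in kummer_place) ramification_index_dvd:
  assumes z: "z \<noteq> 0"
  shows "int (ramification_index h S (h -` S)) dvd v (h z)"
proof -
  have P: "h -` S \<in> places rat_const" by (rule restriction_place[OF nontrivial])
  interpret P: discrete_place rat_const "h -` S" by (rule discrete_place_rational[OF P])
  have nz: "h w \<noteq> 0 \<longleftrightarrow> w \<noteq> 0" for w using field_embedding_eq_0_iff[OF emb_h] by simp
  have unit: "v (h w) = 0" if "w \<in> P.V" "w \<notin> h -` S" for w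
  proof -
    have "inverse w \<notin> h -` S" using P.unit_inverse[OF that] by blast
    then have "inverse (h w) \<notin> S" by (simp add: field_embedding_inverse[OF emb_h])
    then show ?thesis using that V_iff[of "h w"] P.unit_nonzero[OF that(2)] nz v_unit by auto
  qed
  define e where "e = v (h P.unif)"
  have e: "e > 0" using P.unif v_pos_iff[of "h P.unif"] nz by (simp add: e_def)
  have eq: "v (h w) = e * P.v w" if w: "w \<noteq> 0" for w
  proof -
    obtain u where u: "u \<in> P.V" "u \<notin> h -` S" "w = P.unif powi P.v w * u"
      using P.v_decomp[OF w] by blast
    have "h w = h P.unif powi P.v w * h u"
      by (subst u(3)) (simp add: h_mult field_embedding_powi[OF emb_h])
    moreover have "h u \<noteq> 0" "h P.unif powi P.v w \<noteq> 0"
      using P.unit_nonzero[OF u(2)] P.unif(1) nz by simp_all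
    ultimately show ?thesis
      using v_mult[of "h P.unif powi P.v w" "h u"] v_powi[of "h P.unif"] unit[OF u(1,2)] P.unif(1) nz
      by (simp add: e_def)
  qed
  have "ramification_index h S (h -` S) = nat e"
    unfolding ramification_index_def
  proof (rule the_equality)
    show "\<forall>z. z \<noteq> 0 \<longrightarrow> v (h z) = int (nat e) * P.v z" using eq e by simp
    fix d assume "\<forall>z. z \<noteq> 0 \<longrightarrow> v (h z) = int d * P.v z"
    then show "d = nat e" using P.unif(1) P.v_unif by (auto simp: e_def)
  qed
  then show ?thesis using eq[OF z] e by simp
qed

locale kummer_curve =
  fixes h :: "'k::{field,finite} poly fract \<Rightarrow> 'f::field" and \<iota> :: "'k \<Rightarrow> 'f" and y :: 'f
    and m r :: nat and a :: "nat \<Rightarrow> 'k" and lam :: "nat \<Rightarrow> nat"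
  assumes m: "m \<ge> 2" and char_m: "\<not> CHAR('k) dvd m" and inj_a: "inj_on a {1..r}"
    and lam: "\<And>k. k \<in> {1..r} \<Longrightarrow> 1 \<le> lam k \<and> lam k \<le> m - 1"
    and coprime_lam: "coprime (\<Sum>k=1..r. lam k) m"
    and F: "kummer_function_field h y m r a lam" and \<iota>: "\<iota> = h \<circ> rat_const"
begin

definition f :: "'k poly" where "f = (\<Prod>k=1..r. [:- a k, 1:] ^ lam k)"

lemma Fract_linear: "Fract [:- b, 1:] 1 = rat_x - rat_const b"
  by (simp add: rat_x_def rat_const_def)

lemma Fract_f: "Fract f 1 = (\<Prod>k=1..r. (rat_x - rat_const (a k)) ^ lam k)"
proof -
  have mult: "Fract (p * q) 1 = Fract p 1 * Fract q 1" for p q :: "'k poly" by simp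
  have "Fract (\<Prod>k\<in>K. [:- a k, 1:] ^ lam k) 1 = (\<Prod>k\<in>K. (rat_x - rat_const (a k)) ^ lam k)" for K
    by (induction K rule: infinite_finite_induct)
      (simp_all add: One_fract_def Fract_power mult del: mult_fract flip: Fract_linear)
  then show ?thesis by (simp add: f_def)
qed

end

sublocale kummer_curve \<subseteq> kummer_extension h y m f \<iota>
proof
  have emb: "field_embedding h" and
    y: "y ^ m = (\<Prod>k=1..r. (h rat_x - h (rat_const (a k))) ^ lam k)" and
    gen: "generated_field (range h \<union> {y}) = UNIV"
    using F by (auto simp: kummer_function_field_def)
  show "field_embedding h" by (rule emb)
  show "m > 0" using m by simp
  have "h (Fract f 1) = y ^ m"
    unfolding Fract_f y by (simp add: field_embedding_simps[OF emb])
  then show "y ^ m = h (Fract f 1)" "y ^ m \<in> range h" by (metis rangeI)+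
  show "generated_field (range h \<union> {y}) = UNIV" by (rule gen)
  show "f \<noteq> 0" by (simp add: f_def)
  show "\<iota> = h \<circ> rat_const" by (rule \<iota>)
qed

context kummer_curve
begin

lemma degree_f: "degree f = (\<Sum>k=1..r. lam k)"
  unfolding f_def by (subst degree_prod_sum_eq) (auto simp: degree_linear_power)

lemma function_field: "function_field \<iota>"
  by (intro function_field.intro emb_\<iota> discrete_place)

lemma kummer_place: "S \<in> places \<iota> \<Longrightarrow> kummer_place h y m f \<iota> S"
  by (intro kummer_place.intro place_over_rational) (unfold_locales)

lemma kummer_place_infinite:
  assumes "S \<in> places_over \<iota> h infinite_place"
  shows "kummer_place_infinite h y m f \<iota> S"
proof -
  have S: "S \<in> places \<iota>" "lies_over h S infinite_place" using assms by (auto simp: places_over_def)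
  interpret kummer_place h y m f \<iota> S by (rule kummer_place[OF S(1)])
  show ?thesis
    by unfold_locales (use S(2) lies_over_infinite_iff coprime_lam degree_f in auto)
qed

lemma point_branch:
  assumes k: "k \<in> {1..r}"
  shows "kummer_point h y m f \<iota> (a k) (lam k) (\<Prod>j\<in>{1..r} - {k}. [:- a j, 1:] ^ lam j)"
proof -
  let ?\<phi> = "\<Prod>j\<in>{1..r} - {k}. [:- a j, 1:] ^ lam j"
  have "(\<Prod>j\<in>{1..r}. [:- a j, 1:] ^ lam j) = [:- a k, 1:] ^ lam k * ?\<phi>"
    using k by (intro prod.remove) simp_all
  then have "f = [:- a k, 1:] ^ lam k * ?\<phi>" by (simp only: f_def)
  moreover have "a k \<noteq> a j" if "j \<in> {1..r} - {k}" for j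
    using inj_onD[OF inj_a, of k j] k that by auto
  then have "poly ?\<phi> (a k) \<noteq> 0" by (auto simp: poly_prod)
  ultimately show ?thesis
    using char_m by (intro kummer_point.intro kummer_extension_axioms kummer_point_axioms.intro) simp_all
qed

lemma point_unbranched:
  assumes b: "b \<notin> a ` {1..r}" shows "kummer_point h y m f \<iota> b 0 f"
proof -
  have "b \<noteq> a k" if "k \<in> {1..r}" for k using b that by blast
  then have "poly f b \<noteq> 0" by (auto simp: f_def poly_prod)
  then show ?thesis
    using char_m by (intro kummer_point.intro kummer_extension_axioms kummer_point_axioms.intro) simp_all
qed

lemma Z_eq: "kummer_point.Z h b = h rat_x - \<iota> b" if "kummer_point h y m f \<iota> b l \<phi>"
proof -
  interpret kummer_point h y m f \<iota> b l \<phi> by (rule that)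
  show ?thesis by (simp add: Z_def Fract_linear field_embedding_diff[OF emb_h] \<iota>)
qed

lemma kummer_point_place:
  assumes pt: "kummer_point h y m f \<iota> b l \<phi>" and S: "S \<in> places_over \<iota> h (finite_place b)"
  shows "kummer_point_place h y m f \<iota> b l \<phi> S"
proof -
  have S: "S \<in> places \<iota>" "lies_over h S (finite_place b)" using S by (auto simp: places_over_def)
  interpret kummer_place h y m f \<iota> S by (rule kummer_place[OF S(1)])
  have "kummer_point.Z h b \<in> S" using S(2) lies_over_finite_iff by (simp add: Z_eq[OF pt])
  then show ?thesis
    by (rule kummer_point_place.intro[OF pt kummer_place[OF S(1)] kummer_point_place_axioms.intro])
qed

lemma point_exists: "\<exists>l \<phi>. kummer_point h y m f \<iota> b l \<phi>"
  using point_branch point_unbranched by (cases "b \<in> a ` {1..r}") blast+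

lemma finite_places_over: "finite (places_over \<iota> h (finite_place b))"
proof -
  obtain l \<phi> where pt: "kummer_point h y m f \<iota> b l \<phi>" using point_exists by blast
  show ?thesis by (rule kummer_point.finite_places[OF pt kummer_point_place[OF pt]])
qed

lemma rational_place_residue:
  assumes S: "S \<in> places_over \<iota> h (finite_place b)" and rat: "rational_place \<iota> S" and z: "z \<in> place_ring S"
  shows "\<exists>c. z - \<iota> c \<in> S"
proof -
  obtain l \<phi> where pt: "kummer_point h y m f \<iota> b l \<phi>" using point_exists by blast
  interpret kummer_point_place h y m f \<iota> b l \<phi> S by (rule kummer_point_place[OF pt S])
  show ?thesis using rational_residue[OF fin residue_basis _ z] rat by (simp add: rational_place_def)
qed

lemma v_branch:
  assumes k: "k \<in> {1..r}" and S: "S \<in> places_over \<iota> h (finite_place (a k))"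
  shows "place_val S (h rat_x - \<iota> (a k)) = int (m div gcd m (lam k))"
    "place_val S y = int (lam k div gcd m (lam k))"
proof -
  note pt = point_branch[OF k]
  interpret kummer_point_place h y m f \<iota> "a k" "lam k" "\<Prod>j\<in>{1..r} - {k}. [:- a j, 1:] ^ lam j" S
    by (rule kummer_point_place[OF pt S])
  show "place_val S (h rat_x - \<iota> (a k)) = int (m div gcd m (lam k))"
    using v_Z Z_eq[OF pt] by (simp add: m'_def g_def)
  show "place_val S y = int (lam k div gcd m (lam k))"
    using v_y by (simp add: l'_def g_def)
qed

lemma v_unbranched:
  assumes b: "b \<notin> a ` {1..r}" and S: "S \<in> places_over \<iota> h (finite_place b)"
  shows "place_val S (h rat_x - \<iota> b) = 1" "place_val S y = 0"
proof -
  note pt = point_unbranched[OF b]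
  interpret kummer_point_place h y m f \<iota> b 0 f S by (rule kummer_point_place[OF pt S])
  show "place_val S (h rat_x - \<iota> b) = 1"
    using v_Z Z_eq[OF pt] m by (simp add: m'_def g_def)
  show "place_val S y = 0"
    using v_y by (simp add: l'_def g_def)
qed

lemma v_infinite:
  assumes S: "S \<in> places_over \<iota> h infinite_place"
  shows "place_val S (h rat_x - \<iota> b) = - int m" "place_val S y = - int (\<Sum>k=1..r. lam k)"
proof -
  interpret kummer_place_infinite h y m f \<iota> S by (rule kummer_place_infinite[OF S])
  show "place_val S (h rat_x - \<iota> b) = - int m"
    using v_hp_infinite[OF X_pole, of "[:- b, 1:]"] v_X by (simp add: hp_linear)
  show "place_val S y = - int (\<Sum>k=1..r. lam k)" using v_y by (simp add: degree_f)
qed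

lemma v_X_minus_off:
  assumes S: "S \<in> places \<iota>" "S \<notin> places_over \<iota> h infinite_place" "S \<notin> places_over \<iota> h (finite_place b)"
  shows "place_val S (h rat_x - \<iota> b) = 0"
proof -
  interpret kummer_place h y m f \<iota> S by (rule kummer_place[OF S(1)])
  have "h rat_x - \<iota> b \<in> V" using S lies_over_infinite_iff V_diff V_const by (auto simp: places_over_def)
  moreover have "h rat_x - \<iota> b \<notin> S" using S lies_over_finite_iff by (auto simp: places_over_def)
  ultimately show ?thesis by (rule v_unit)
qed

lemma v_y_off:
  assumes S: "S \<in> places \<iota>" "S \<notin> places_over \<iota> h infinite_place"
    "\<And>k. k \<in> {1..r} \<Longrightarrow> S \<notin> places_over \<iota> h (finite_place (a k))"
  shows "place_val S y = 0"
proof -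
  interpret kummer_place h y m f \<iota> S by (rule kummer_place[OF S(1)])
  have eq: "y ^ m = (\<Prod>k=1..r. (h rat_x - \<iota> (a k)) ^ lam k)"
    using F by (simp add: kummer_function_field_def \<iota>)
  have nz: "(h rat_x - \<iota> (a k)) ^ lam k \<noteq> 0" for k using X_minus_nonzero by simp
  have "v (y ^ m) = (\<Sum>k=1..r. v ((h rat_x - \<iota> (a k)) ^ lam k))" unfolding eq by (rule v_prod) (rule nz)
  also have "\<dots> = (\<Sum>k=1..r. 0)"
    using v_power[OF X_minus_nonzero] v_X_minus_off[OF S(1,2)] S(3) by (intro sum.cong) auto
  finally show ?thesis using v_power[OF y_nonzero, of m] m by simp
qed

lemma places_over_disjoint:
  assumes "S \<in> places_over \<iota> h (finite_place b)"
  shows "S \<notin> places_over \<iota> h infinite_place" "S \<in> places_over \<iota> h (finite_place c) \<Longrightarrow> c = b"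
proof -
  have S: "S \<in> places \<iota>" using assms by (simp add: places_over_def)
  interpret kummer_place h y m f \<iota> S by (rule kummer_place[OF S])
  have b: "h rat_x - \<iota> b \<in> S" using assms lies_over_finite_iff by (simp add: places_over_def)
  show "S \<notin> places_over \<iota> h infinite_place"
    using X_V[OF b] lies_over_infinite_iff by (simp add: places_over_def)
  assume "S \<in> places_over \<iota> h (finite_place c)"
  then have c: "h rat_x - \<iota> c \<in> S" using lies_over_finite_iff by (simp add: places_over_def)
  show "c = b" using const_unique[OF c b] .
qed

text \<open>
  Too few places lie over a branch point for it to split completely: there are at most
  \<open>gcd m (lam k)\<close> rational ones, and \<open>lam k < m\<close>.
\<close>

lemma card_places_branch:
  assumes k: "k \<in> {1..r}" and rat: "\<And>S. S \<in> places_over \<iota> h (finite_place (a k)) \<Longrightarrow> rational_place \<iota> S"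
  shows "card (places_over \<iota> h (finite_place (a k))) < m"
proof -
  note pt = point_branch[OF k]
  have "card (places_over \<iota> h (finite_place (a k))) \<le> kummer_point.g m (lam k)"
    by (rule kummer_point.card_rational_places[OF pt kummer_point_place[OF pt]])
      (use rational_place_residue rat in blast)+
  also have "\<dots> = gcd m (lam k)" by (rule kummer_point.g_def[OF pt])
  also have "\<dots> \<le> lam k" using lam[OF k] by (intro dvd_imp_le) auto
  also have "\<dots> < m" using lam[OF k] m by linarith
  finally show ?thesis .
qed

text \<open>The ramification index \<open>m\<close> divides the value \<open>m div gcd m (lam k)\<close> of \<open>x - a k\<close>.\<close>

lemma totally_ramified_gcd:
  assumes k: "k \<in> {1..r}" and ram: "totally_ramified \<iota> h (finite_place (a k))"
    and deg: "extension_degree h = m"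
  shows "gcd m (lam k) = 1"
proof -
  obtain S where S: "places_over \<iota> h (finite_place (a k)) = {S}"
      "ramification_index h S (finite_place (a k)) = m"
    using ram deg by (auto simp: totally_ramified_def)
  then have over: "S \<in> places_over \<iota> h (finite_place (a k))" by simp
  then have pl: "S \<in> places \<iota>" "lies_over h S (finite_place (a k))" by (auto simp: places_over_def)
  interpret kummer_place h y m f \<iota> S by (rule kummer_place[OF pl(1)])
  have eq: "h rat_x - \<iota> (a k) = h (rat_x - rat_const (a k))"
    by (simp add: field_embedding_diff[OF emb_h] \<iota>)
  have "h rat_x - \<iota> (a k) \<in> S" using pl lies_over_finite_iff by simp
  then have "rat_x - rat_const (a k) \<in> h -` S" by (simp add: eq)
  then have P: "h -` S = finite_place (a k)" by (rule finite_place_eqI[OF restriction_place[OF nontrivial]])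
  have "rat_x - rat_const (a k) \<noteq> 0" using X_minus_nonzero[of "a k"] eq field_embedding_0[OF emb_h] by auto
  from ramification_index_dvd[OF this] have "int m dvd int (m div gcd m (lam k))"
    using P S(2) v_branch(1)[OF k over] eq by simp
  then have "m \<le> m div gcd m (lam k)" using m by (intro dvd_imp_le) (auto simp: div_greater_zero_iff gcd_le1_nat)
  moreover have "m div gcd m (lam k) < m" if "gcd m (lam k) > 1"
    using that m by (intro div_less_dividend) simp_all
  moreover have "gcd m (lam k) > 0" using m by simp
  ultimately show ?thesis by linarith
qed

end

section \<open>Complementary pairs on Kummer curves\<close>

theorem theorem5p1:
  fixes h :: "'k::{field,finite} poly fract \<Rightarrow> 'f::field"
    and \<iota> :: "'k \<Rightarrow> 'f"
    and y :: 'f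
    and m r n t N g :: nat
    and s :: int
    and a :: "nat \<Rightarrow> 'k"
    and lam :: "nat \<Rightarrow> nat"
    and \<alpha> :: "nat \<Rightarrow> int"
    and Q :: "nat \<Rightarrow> 'f set"
    and P :: "nat \<Rightarrow> 'k poly fract set"
    and R :: "'n::finite \<Rightarrow> 'f set"
    and D E G H :: "'f set \<Rightarrow>\<^sub>0 int"
  assumes m: "m \<ge> 2" and r: "r \<ge> 2"
    and char: "\<not> CHAR('k) dvd m"
    and a: "inj_on a {1..r}"
    and lam: "\<And>k. k \<in> {1..r} \<Longrightarrow> 1 \<le> lam k \<and> lam k \<le> m - 1"
    and lam0: "lam 0 = (\<Sum>k=1..r. lam k)" "coprime (lam 0) m"
    and F: "kummer_function_field h y m r a lam"
    and \<iota>: "\<iota> = h \<circ> rat_const"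
    and g: "has_genus \<iota> g" "g \<ge> 1"
    and Q0: "places_over \<iota> h infinite_place = {Q 0}"
    and n: "2 \<le> n" "n \<le> r"
    and ram: "\<And>k. k \<in> {1..n} \<Longrightarrow> totally_ramified \<iota> h (finite_place (a k))"
    and Q: "\<And>k. k \<in> {1..n} \<Longrightarrow> Q k \<in> places_over \<iota> h (finite_place (a k))"
    and P: "inj_on P {1..t}"
      "\<And>i. i \<in> {1..t} \<Longrightarrow> rational_place rat_const (P i)"
      "\<And>i. i \<in> {1..t} \<Longrightarrow> splits_completely \<iota> h (P i)"
    and N: "N = m * t" "CARD('n) = N"
    and R: "bij_betw R UNIV {S. rational_place \<iota> S \<and> (\<exists>i\<in>{1..t}. lies_over h S (P i))}"
    and D: "D = (\<Sum>i\<in>UNIV. Poly_Mapping.single (R i) 1)"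
    and E: "E = (\<Sum>k=0..n. Poly_Mapping.single (Q k) (\<alpha> k))"
      "non_special \<iota> g E" "div_degree \<iota> E = int g - 1"
    and s: "(real g - 1) / real (lam 0) < real_of_int s"
      "real_of_int s < (real N + 1 - real g) / real (lam 0)"
    and G: "G = (\<Sum>k=1..n. Poly_Mapping.single (Q k) (\<alpha> k))
                + Poly_Mapping.single (Q 0) (\<alpha> 0 + int N - s * int (lam 0))"
    and H: "H = (\<Sum>k=1..n. Poly_Mapping.single (Q k) (s * int (lam k) + \<alpha> k))
                + Poly_Mapping.single (Q 0) (\<alpha> 0)
                + (\<Sum>k=n+1..r. \<Sum>S\<in>places_over \<iota> h (finite_place (a k)).
                     Poly_Mapping.single S ((s * int (lam k)) div int (gcd m (lam k))))"
  shows "Poly_Mapping.keys D \<inter> Poly_Mapping.keys G = {}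
    \<and> Poly_Mapping.keys D \<inter> Poly_Mapping.keys H = {}
    \<and> linear_complementary_pair (ag_code \<iota> R G) (ag_code \<iota> R H)
    \<and> code_parameters (ag_code \<iota> R G) (int N) (int N - s * int (lam 0))
    \<and> code_parameters (ag_code \<iota> R H) (int N) (s * int (lam 0))"
proof -
  interpret kummer_curve h \<iota> y m r a lam
    by unfold_locales (use m char a lam lam0 F \<iota> in auto)
  interpret function_field \<iota> by (rule function_field)
  have Q0_over: "Q 0 \<in> places_over \<iota> h infinite_place" using Q0 by simp
  then have Q0_place: "Q 0 \<in> places \<iota>" by (simp add: places_over_def)
  interpret I: kummer_place_infinite h y m f \<iota> "Q 0" by (rule kummer_place_infinite[OF Q0_over])
  have deg: "extension_degree h = m" by (rule I.extension_degree)
  have Q_places: "Q k \<in> places \<iota>" if "k \<in> {1..n}" for k using Q[OF that] by (simp add: places_over_def)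
  let ?over = "\<lambda>b. places_over \<iota> h (finite_place b)"

  \<comment> \<open>The place at infinity has only one place above it and branch points have too few, so every
     split place belongs to some \<open>p i\<close> outside the branch locus. There are \<open>N\<close> evaluation places by
     hypothesis and \<open>N\<close> places over the \<open>p i\<close>; hence all of the latter are rational.\<close>
  have "\<exists>c. P i = finite_place c" if i: "i \<in> {1..t}" for i
  proof -
    have "P i \<noteq> infinite_place"
    proof
      assume "P i = infinite_place"
      then have "card {Q 0} = m" using P(3)[OF i] Q0 deg by (simp add: splits_completely_def)
      then show False using m by simp
    qed
    then show ?thesis using rational_place_rat_cases[OF P(2)[OF i]] by blast
  qed
  then obtain p where p: "\<And>i. i \<in> {1..t} \<Longrightarrow> P i = finite_place (p i)" by metis
  have p_inj: "inj_on p {1..t}" using P(1) p by (metis (no_types, lifting) inj_on_def)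
  have card_over: "card (?over (p i)) = m" if "i \<in> {1..t}" for i
    using P(3)[OF that] p[OF that] deg by (simp add: splits_completely_def)
  define U where "U = (\<Union>i\<in>{1..t}. ?over (p i))"
  have finU: "finite U" unfolding U_def using finite_places_over by blast
  have "card U = (\<Sum>i\<in>{1..t}. card (?over (p i)))"
    unfolding U_def
  proof (rule card_UN_disjoint)
    show "\<forall>i\<in>{1..t}. \<forall>j\<in>{1..t}. i \<noteq> j \<longrightarrow> ?over (p i) \<inter> ?over (p j) = {}"
    proof (intro ballI impI)
      fix i j assume ij: "i \<in> {1..t}" "j \<in> {1..t}" "i \<noteq> j"
      then have "p j \<noteq> p i" using inj_onD[OF p_inj, of j i] by auto
      then show "?over (p i) \<inter> ?over (p j) = {}" using places_over_disjoint(2) by blast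
    qed
  qed (simp_all add: finite_places_over)
  then have cardU: "card U = N" using card_over N(1) by simp
  have "range R = {S. rational_place \<iota> S \<and> (\<exists>i\<in>{1..t}. lies_over h S (P i))}"
    using R by (simp add: bij_betw_def)
  then have R_iff: "S \<in> range R \<longleftrightarrow> rational_place \<iota> S \<and> S \<in> U" for S
    using p by (auto simp: U_def places_over_def rational_place_def)
  have "card (range R) = N" using card_image[of R UNIV] R N(2) by (auto simp only: bij_betw_def)
  moreover have "range R \<subseteq> U" using R_iff by blast
  ultimately have range_R: "range R = U" using cardU by (intro card_subset_eq[OF finU]) simp_all
  have rat: "rational_place \<iota> S" if "S \<in> U" for S using that R_iff range_R by blast
  have p_unbranched: "p i \<notin> a ` {1..r}" if i: "i \<in> {1..t}" for i
  proof
    assume "p i \<in> a ` {1..r}"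
    then obtain k where k: "k \<in> {1..r}" "p i = a k" by blast
    have "card (?over (a k)) < m" using card_places_branch[OF k(1)] rat i k(2) unfolding U_def by force
    then show False using card_over[OF i] k(2) by simp
  qed
  have R_over: "\<exists>i\<in>{1..t}. R j \<in> ?over (p i)" for j
    using range_R unfolding U_def by blast
  have R_not_infinite: "R j \<notin> places_over \<iota> h infinite_place" for j
    using R_over[of j] places_over_disjoint(1) by blast
  have R_not_branch: "R j \<notin> ?over (a k)" if "k \<in> {1..r}" for j k
    using R_over[of j] places_over_disjoint(2) p_unbranched that by blast
  have R_place: "R j \<in> places \<iota>" for j using R_over[of j] by (auto simp: places_over_def)
  have R_Q0: "R j \<noteq> Q 0" for j using R_not_infinite[of j] Q0 by auto
  have R_Q: "R j \<noteq> Q k" if "k \<in> {1..n}" for j k using R_not_branch[of k j] Q[OF that] that n by auto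

  \<comment> \<open>The divisors relative to \<open>E\<close>; \<open>H\<close> is \<open>E\<close> plus the divisor of zeros of \<open>y ^ s\<close>.\<close>
  have lam0_pos: "lam 0 > 0"
  proof -
    have "lam 1 \<le> lam 0" unfolding lam0(1) using r by (intro member_le_sum) auto
    then show ?thesis using lam[of 1] r by simp
  qed
  have s_pos: "s > 0"
  proof -
    have "(real g - 1) / real (lam 0) \<ge> 0" using g(2) by simp
    then show ?thesis using s(1) by linarith
  qed
  have s_le: "s * int (lam 0) \<le> int N"
  proof -
    have "real_of_int s * real (lam 0) < real N + 1 - real g"
      using s(2) lam0_pos by (simp add: pos_less_divide_eq)
    then have "real_of_int (s * int (lam 0)) < real_of_int (int N + 1 - int g)" by simp
    then have "s * int (lam 0) < int N + 1 - int g" by (simp only: of_int_less_iff)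
    then show ?thesis using g(2) by simp
  qed
  define k1 k2 where "k1 = nat (int N - s * int (lam 0))" and "k2 = nat (s * int (lam 0))"
  have k1: "int k1 = int N - s * int (lam 0)" and k2: "int k2 = s * int (lam 0)"
    using s_le s_pos by (simp_all add: k1_def k2_def)
  have E_split: "E = Poly_Mapping.single (Q 0) (\<alpha> 0) + (\<Sum>k=1..n. Poly_Mapping.single (Q k) (\<alpha> k))"
    unfolding E(1) by (simp add: sum.atLeast_Suc_atMost)
  have G_eq: "G = E + Poly_Mapping.single (Q 0) (int k1)"
  proof -
    have "\<alpha> 0 + int N - s * int (lam 0) = \<alpha> 0 + int k1" using k1 by simp
    then show ?thesis unfolding G E_split by (simp only: single_add add_ac)
  qed
  have gcd_1: "gcd m (lam k) = 1" if "k \<in> {1..n}" for k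
    using totally_ramified_gcd[OF _ ram[OF that] deg] that n by simp
  define C where "C = (\<Sum>k=1..n. Poly_Mapping.single (Q k) (s * int (lam k)))
      + (\<Sum>k=n+1..r. \<Sum>S\<in>?over (a k). Poly_Mapping.single S ((s * int (lam k)) div int (gcd m (lam k))))"
  have H_eq: "H = E + C"
    unfolding H E_split C_def by (simp add: single_add sum.distrib add_ac)
  have lookup_C: "Poly_Mapping.lookup C S =
      (\<Sum>k=1..n. if Q k = S then s * int (lam k) else 0) +
      (\<Sum>k=n+1..r. if S \<in> ?over (a k) then (s * int (lam k)) div int (gcd m (lam k)) else 0)" for S
  proof -
    have "Poly_Mapping.lookup (\<Sum>S'\<in>?over (a k). Poly_Mapping.single S' c) S =
        (if S \<in> ?over (a k) then c else 0)" for k and c :: int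
      using finite_places_over[of "a k"]
      by (simp add: lookup_sum lookup_single when_def sum.delta)
    then show ?thesis
      unfolding C_def by (simp add: lookup_add lookup_sum lookup_single when_def)
  qed
  have Q_iff: "Q k = S \<longleftrightarrow> S \<in> ?over (a k)" if "k \<in> {1..n}" for k S
    using ram[OF that] Q[OF that] by (auto simp: totally_ramified_def)
  have lookup_C': "Poly_Mapping.lookup C S =
      (\<Sum>k=1..r. if S \<in> ?over (a k) then s * int (lam k div gcd m (lam k)) else 0)" for S
  proof -
    have "(s * int (lam k)) div int (gcd m (lam k)) = s * int (lam k div gcd m (lam k))" for k
      by (simp add: div_mult_swap zdiv_int)
    then have "Poly_Mapping.lookup C S =
        (\<Sum>k=1..n. if S \<in> ?over (a k) then s * int (lam k div gcd m (lam k)) else 0) +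
        (\<Sum>k=n+1..r. if S \<in> ?over (a k) then s * int (lam k div gcd m (lam k)) else 0)"
      unfolding lookup_C using Q_iff gcd_1 by (intro arg_cong2[of _ _ _ _ "(+)"] sum.cong) auto
    also have "\<dots> = (\<Sum>k=1..r. if S \<in> ?over (a k) then s * int (lam k div gcd m (lam k)) else 0)"
    proof -
      have split: "{1..r} = {1..n} \<union> {n+1..r}" using n by auto
      show ?thesis unfolding split by (rule sum.union_disjoint[symmetric]) auto
    qed
    finally show ?thesis .
  qed
  define w where "w = y ^ nat s"
  have v_w: "place_val S w = s * place_val S y" if "S \<in> places \<iota>" for S
  proof -
    interpret S: discrete_place \<iota> S by (rule discrete[OF that])
    show ?thesis using S.v_power[OF y_nonzero, of "nat s"] s_pos by (simp add: w_def)
  qed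
  have C_not_branch: "Poly_Mapping.lookup C S = 0" if "\<And>k. k \<in> {1..r} \<Longrightarrow> S \<notin> ?over (a k)" for S
    unfolding lookup_C' using that by (intro sum.neutral) simp
  have C_w: "Poly_Mapping.lookup C S = place_val S w + (if S = Q 0 then int k2 else 0)"
    if S: "S \<in> places \<iota>" for S
  proof (cases "\<exists>k\<in>{1..r}. S \<in> ?over (a k)")
    case True
    then obtain k where k: "k \<in> {1..r}" "S \<in> ?over (a k)" by blast
    have uniq: "S \<in> ?over (a j) \<longleftrightarrow> j = k" if "j \<in> {1..r}" for j
      using places_over_disjoint(2)[OF k(2), of "a j"] inj_onD[OF a _ that k(1)] k(2) by metis
    have "Poly_Mapping.lookup C S = (\<Sum>j=1..r. if j = k then s * int (lam k div gcd m (lam k)) else 0)"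
      unfolding lookup_C' using uniq by (intro sum.cong) auto
    also have "\<dots> = s * int (lam k div gcd m (lam k))" using k(1) by simp
    also have "\<dots> = place_val S w" using v_w[OF S] v_branch(2)[OF k] by simp
    finally show ?thesis using places_over_disjoint(1)[OF k(2)] Q0 by auto
  next
    case False
    then have C0: "Poly_Mapping.lookup C S = 0" using C_not_branch by blast
    show ?thesis
    proof (cases "S = Q 0")
      case True
      then show ?thesis using C0 v_w[OF S] v_infinite(2)[OF Q0_over] k2 lam0(1) by simp
    next
      case nQ: False
      then have "place_val S y = 0" using False Q0 by (intro v_y_off S) auto
      then show ?thesis using C0 v_w[OF S] nQ by simp
    qed
  qed
  have C_nonneg: "Poly_Mapping.lookup C S \<ge> 0" for S
    unfolding lookup_C' using s_pos by (intro sum_nonneg) auto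
  have E_R: "Poly_Mapping.lookup E (R j) = 0" for j
  proof -
    have "Poly_Mapping.lookup E (R j) = (\<Sum>k=0..n. if Q k = R j then \<alpha> k else 0)"
      unfolding E(1) by (simp add: lookup_sum lookup_single when_def)
    also have "\<dots> = 0"
    proof (rule sum.neutral, rule ballI)
      fix k assume "k \<in> {0..n}"
      then show "(if Q k = R j then \<alpha> k else 0) = 0" using R_Q0[of j] R_Q[of k j] by (cases "k = 0") auto
    qed
    finally show ?thesis .
  qed
  have C_R: "Poly_Mapping.lookup C (R j) = 0" for j using C_not_branch R_not_branch by blast

  \<comment> \<open>The function with simple zeros at the evaluation places and its only pole at \<open>Q 0\<close>.\<close>
  define \<psi> where "\<psi> = (\<Prod>i=1..t. h rat_x - \<iota> (p i))"
  have nz: "h rat_x - \<iota> b \<noteq> 0" for b by (rule I.X_minus_nonzero)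
  have v_\<psi>: "place_val S \<psi> = (\<Sum>i=1..t. place_val S (h rat_x - \<iota> (p i)))" if "S \<in> places \<iota>" for S
  proof -
    interpret S: discrete_place \<iota> S by (rule discrete[OF that])
    show ?thesis unfolding \<psi>_def by (rule S.v_prod) (rule nz)
  qed
  have \<psi>_R: "place_val (R j) \<psi> = 1" for j
  proof -
    obtain i where i: "i \<in> {1..t}" "R j \<in> ?over (p i)" using R_over by blast
    have "place_val (R j) (h rat_x - \<iota> (p i')) = (if i' = i then 1 else 0)" if "i' \<in> {1..t}" for i'
    proof (cases "i' = i")
      case True
      then show ?thesis using v_unbranched(1)[OF p_unbranched[OF i(1)] i(2)] by simp
    next
      case False
      then have "R j \<notin> ?over (p i')"
        using places_over_disjoint(2)[OF i(2), of "p i'"] inj_onD[OF p_inj _ that i(1)] by metis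
      then show ?thesis using v_X_minus_off[OF R_place R_not_infinite] False by simp
    qed
    then have "place_val (R j) \<psi> = (\<Sum>i'=1..t. if i' = i then 1 else 0)"
      unfolding v_\<psi>[OF R_place] by (intro sum.cong) auto
    then show ?thesis using i(1) by simp
  qed
  have \<psi>_off: "place_val S \<psi> = 0" if S: "S \<in> places \<iota>" "S \<noteq> Q 0" "S \<notin> range R" for S
  proof -
    have "S \<notin> ?over (p i)" if "i \<in> {1..t}" for i using S(3) range_R that unfolding U_def by blast
    then show ?thesis
      unfolding v_\<psi>[OF S(1)] using S Q0 by (intro sum.neutral ballI v_X_minus_off) auto
  qed
  have \<psi>_Q0: "place_val (Q 0) \<psi> = - int CARD('n)"
    unfolding v_\<psi>[OF Q0_place] using v_infinite(1)[OF Q0_over] N by simp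

  interpret evaluation_pair \<iota> "Q 0" R E G H w \<psi> k1 k2 g
  proof unfold_locales
    show "place_degree \<iota> (Q 0) = 1" by (rule I.place_degree_1) (use I.residue in auto)
    show "\<exists>c. z - \<iota> c \<in> R j" if "z \<in> place_ring (R j)" for j z
      using R_over[of j] rational_place_residue[OF _ rat that] range_R by blast
    show "k1 + k2 = CARD('n)" using k1 k2 N(2) by linarith
    show "w \<noteq> 0" using y_nonzero by (simp add: w_def)
    show "place_val S w \<ge> 0" if "S \<in> places \<iota>" "S \<noteq> Q 0" for S
      using C_w[OF that(1)] C_nonneg[of S] that by simp
    show "place_val (Q 0) w = - int k2"
      using v_w[OF Q0_place] v_infinite(2)[OF Q0_over] k2 lam0(1) by simp
    show "place_val (R j) w = 0" for j using C_w[OF R_place, of j] C_R R_Q0 by simp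
    show "\<psi> \<noteq> 0" using nz by (simp add: \<psi>_def)
    show "Poly_Mapping.lookup H S = Poly_Mapping.lookup E S + place_val S w + (if S = Q 0 then int k2 else 0)"
      if "S \<in> places \<iota>" for S using C_w[OF that] by (simp add: H_eq lookup_add)
  qed (use Q0_place I.residue g E R_place R_Q0 E_R \<psi>_off \<psi>_R \<psi>_Q0 G_eq in auto)

  have "Poly_Mapping.keys D \<subseteq> range R"
    unfolding D using keys_sum[of "\<lambda>i. Poly_Mapping.single (R i) (1 :: int)" UNIV] by auto
  then have "Poly_Mapping.keys D \<inter> Poly_Mapping.keys G = {}" "Poly_Mapping.keys D \<inter> Poly_Mapping.keys H = {}"
    using lookup_G_R v_w_R_H by (auto simp: in_keys_iff)
  moreover have "code_parameters (ag_code \<iota> R G) (int N) (int N - s * int (lam 0))"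
    using code_G k1 N(2) by (simp add: code_parameters_def)
  moreover have "code_parameters (ag_code \<iota> R H) (int N) (s * int (lam 0))"
    using code_H k2 N(2) by (simp add: code_parameters_def)
  ultimately show ?thesis using complementary by blast
qed

end
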